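(* Let $\mu$ be an infinitely divisible distribution on $\mathbb{R}$ with Lévy measure $\nu(dx)=g(x)\,dx$ such that $\nu(\mathbb{R})=\infty$ (and $\nu((1,\infty))>0$). Let $f_0$ be a density of the infinitely divisible distribution $\mu_0$ with characteristic function $\widehat\mu_0(z)=\exp\{\int_{-1}^{1}(e^{izy}-1-izy)g(y)\,dy\}$. Suppose that $g_1(x)=\mathbf 1_{\{x>1\}}g(x)/\nu((1,\infty))$ is bounded and that there exists $\gamma>0$ such that $$\lim_{x\to\infty}e^{\gamma x}f_0(x)=0.$$ For a density $f$ of $\mu$ consider the following properties: (i) $f\in\mathcal{S}_+$ and $f$ is almost decreasing (al.d.); (ii) $g_1\in\mathcal{S}_+$; (iii) $g_1\in\mathcal{L}$ and $\lim_{x\to\infty}f(x)/g_1(x)=\nu((1,\infty))$. Then: (a) If $g$ is asymptotic to a non-increasing function (a.n.i.), then one can choose the density $f$ of $\mu$ such that (i), (ii) and (iii) are equivalent. (b) If $g$ is al.d., then one can choose the density $f$ of $\mu$ such that (ii) and (iii) are equivalent and imply (i).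
   Context: The characteristic function of $\mu$ is $\widehat\mu(z)=\exp\{\int_{-\infty}^\infty(e^{izy}-1-izy\mathbf 1_{\{|y|\le1\}})\nu(dy)+iaz-\frac12b^2z^2\}$ with $a\in\mathbb{R}$, $b\ge0$ and Lévy measure $\nu$ ($\nu(\{0\})=0$, $\int(1\wedge x^2)\nu(dx)<\infty$). "Choose a density $f$" means choosing a version of the Lebesgue density of $\mu$. Notation: $\mathbb{R}_+=[0,\infty)$; $\alpha(x)\sim\beta(x)$ means $\alpha(x)/\beta(x)\to1$ as $x\to\infty$; $h^{\ast n}$ is $n$-fold convolution. For a probability density $h$ on $\mathbb{R}$ with distribution function $H$ and $\overline H=1-H$: - $h\in\mathcal{L}$ (long-tailed) if there is $x_0>0$ with $h(x)>0$ for $x\ge x_0$ and, for each fixed $y>0$, $h(x+y)\sim h(x)$. - $h\in\mathcal{S}$ (subexponential) if $h\in\mathcal{L}$ and $h^{\ast2}(x)\sim2h(x)$. - $h\in\mathcal{S}_+$ (weakly subexponential) if $h\in\mathcal{L}$ and the density $h_+(x)=\mathbf 1_{\mathbb{R}_+}(x)h(x)/\overline H(0)$ belongs to $\mathcal{S}$. For a non-negative function $h$ on $\mathbb{R}$ (a probability density, or a possibly non-proper density of a Lévy measure): - $h$ is asymptotic to a non-increasing function (a.n.i.) if, for some $x_0>0$, $h$ is locally bounded and positive on $[x_0,\infty)$, and $\sup_{t\ge x}h(t)\sim h(x)$ and $\inf_{x_0\le t\le x}h(t)\sim h(x)$. - $h$ is almost decreasing (al.d.) if there are $x_0>0$ and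 $K>0$ such that $h(x+y)\le Kh(x)$ for all $x>x_0$, $y>0$. *)

theory Defs
  imports "HOL-Probability.Probability" "HOL-Library.Landau_Symbols"
begin

subsection \<open>Infinitely divisible distributions\<close>

primrec convolution_power :: "nat \<Rightarrow> real measure \<Rightarrow> real measure" where
  "convolution_power 0 M = return borel 0"
| "convolution_power (Suc n) M = convolution M (convolution_power n M)"

definition infinitely_divisible :: "real measure \<Rightarrow> bool" where
  "infinitely_divisible M \<longleftrightarrow> real_distribution M \<and>
     (\<forall>n\<ge>1. \<exists>N. real_distribution N \<and> M = convolution_power n N)"

definition levy_measure :: "real measure \<Rightarrow> bool" where
  "levy_measure \<nu> \<longleftrightarrow> sets \<nu> = sets borel \<and> emeasure \<nu> {0} = 0 \<and>
     (\<integral>\<^sup>+x. ennreal (min 1 (x\<^sup>2)) \<partial>\<nu>) < \<infinity>"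

definition has_levy_measure :: "real measure \<Rightarrow> real measure \<Rightarrow> bool" where
  "has_levy_measure M \<nu> \<longleftrightarrow> levy_measure \<nu> \<and>
     (\<exists>a b. b \<ge> 0 \<and>
       (\<forall>z. char M z =
          exp ((CLINT y|\<nu>. iexp (z * y) - 1
                  - \<i> * of_real z * of_real y * indicator {y. \<bar>y\<bar> \<le> 1} y)
               + \<i> * of_real a * of_real z - of_real (b\<^sup>2 * z\<^sup>2 / 2))))"

text \<open>A density is a fixed everywhere finite, non-negative Borel function, not an
  equivalence class: the asymptotic properties below depend on the version.\<close>

definition density_of :: "real measure \<Rightarrow> (real \<Rightarrow> real) \<Rightarrow> bool" where
  "density_of M f \<longleftrightarrow> f \<in> borel_measurable borel \<and> (\<forall>x. 0 \<le> f x) \<and>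
     M = density lborel (\<lambda>x. ennreal (f x))"

definition probability_density :: "(real \<Rightarrow> real) \<Rightarrow> bool" where
  "probability_density h \<longleftrightarrow> h \<in> borel_measurable borel \<and> (\<forall>x. 0 \<le> h x) \<and>
     prob_space (density lborel (\<lambda>x. ennreal (h x)))"

subsection \<open>Classes of densities\<close>

text \<open>If the integrand is not integrable, the Bochner integral is 0. This does not affect
  \<open>subexponential_density\<close>: where the convolution is really infinite and \<open>h x > 0\<close>, the
  ratio of the two sides is 0 instead of infinite, and neither is close to 1.\<close>

definition density_convolution :: "(real \<Rightarrow> real) \<Rightarrow> (real \<Rightarrow> real) \<Rightarrow> real \<Rightarrow> real" where
  "density_convolution h k x = (LBINT y. h (x - y) * k y)"

definition long_tailed_density :: "(real \<Rightarrow> real) \<Rightarrow> bool" where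
  "long_tailed_density h \<longleftrightarrow> probability_density h \<and>
     (\<exists>x0>0. \<forall>x\<ge>x0. h x > 0) \<and>
     (\<forall>y>0. (\<lambda>x. h (x + y)) \<sim>[at_top] h)"

definition subexponential_density :: "(real \<Rightarrow> real) \<Rightarrow> bool" where
  "subexponential_density h \<longleftrightarrow> long_tailed_density h \<and>
     density_convolution h h \<sim>[at_top] (\<lambda>x. 2 * h x)"

definition tail_df :: "(real \<Rightarrow> real) \<Rightarrow> real \<Rightarrow> real" where
  "tail_df h x = 1 - cdf (density lborel (\<lambda>t. ennreal (h t))) x"

definition positive_part_density :: "(real \<Rightarrow> real) \<Rightarrow> real \<Rightarrow> real" where
  "positive_part_density h x = indicator {0..} x * h x / tail_df h 0"

definition weakly_subexponential_density :: "(real \<Rightarrow> real) \<Rightarrow> bool" where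
  "weakly_subexponential_density h \<longleftrightarrow> long_tailed_density h \<and>
     subexponential_density (positive_part_density h)"

text \<open>The condition \<open>bdd_above\<close> makes explicit that the suprema are finite. Given local
  boundedness this is implied by the supremum being asymptotic to the finite function \<open>h\<close>,
  but \<open>Sup\<close> of an unbounded set of reals is an unspecified real number.\<close>

definition asymptotic_to_nonincreasing :: "(real \<Rightarrow> real) \<Rightarrow> bool" where
  "asymptotic_to_nonincreasing h \<longleftrightarrow>
     (\<exists>x0>0. (\<forall>x\<ge>x0. h x > 0) \<and> (\<forall>x\<ge>x0. bounded (h ` {x0..x})) \<and>
        bdd_above (h ` {x0..}) \<and>
        (\<lambda>x. SUP t\<in>{x..}. h t) \<sim>[at_top] h \<and>
        (\<lambda>x. INF t\<in>{x0..x}. h t) \<sim>[at_top] h)"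

definition almost_decreasing :: "(real \<Rightarrow> real) \<Rightarrow> bool" where
  "almost_decreasing h \<longleftrightarrow>
     (\<exists>x0>0. \<exists>K>0. \<forall>x>x0. \<forall>y>0. h (x + y) \<le> K * h x)"

end

theory Submission
  imports Defs "HOL-Real_Asymp.Real_Asymp"
begin

text \<open>
  Let \<open>v\<close> be \<open>g\<close> restricted to \<open>\<bar>y\<bar> > 1\<close>, with total mass \<open>lam\<close>, and let \<open>u\<close> be
  \<open>exp (- lam)\<close> times the density that arises from \<open>f0\<close> by adding the Gaussian component and the
  drift. The version of the density of \<open>\<mu>\<close> used for all implications is the pointwise sum
  \<open>f = (\<Sum>n. u * v\<^sup>*\<^sup>n / n!)\<close> (\<open>nexp v u\<close> below). That it is a density of \<open>\<mu>\<close> follows by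
  comparing characteristic functions.

  The operator \<open>nexp\<close> turns sums into compositions, at every point and not only almost everywhere.
  Hence for each \<open>A \<ge> 1\<close> one has \<open>f = (\<Sum>n. r * t\<^sup>*\<^sup>n / n!)\<close>, where \<open>t\<close> is \<open>g\<close> restricted to
  \<open>(A, \<infinity>)\<close> and \<open>r \<ge> u\<close> (depending on \<open>A\<close>) has an exponentially small right tail and total mass
  \<open>exp (- \<nu> (A, \<infinity>))\<close>, which tends to 1 as \<open>A\<close> grows (lemma \<open>cutoff\<close>).

  For a long-tailed almost decreasing \<open>h\<close> (\<open>regular_tail\<close>), three facts carry the argument.
  First, \<open>r = o(h)\<close>, and \<open>r * h 1\<^bsub>(A,\<infinity>)\<^esub>\<close> is asymptotic to the mass of \<open>r\<close> times \<open>h\<close>, by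
  dominated convergence (\<open>nconv_tail_part_asymp\<close>). Second, for densities, subexponentiality of \<open>h\<close>
  means that \<open>h 1\<^bsub>(A,\<infinity>)\<^esub> * h 1\<^bsub>(A,\<infinity>)\<^esub> \<le> \<epsilon> h\<close> for large \<open>A\<close>
  (\<open>small_middle\<close>, \<open>weakly_subexponential_iff\<close>), a condition that is stable under asymptotic
  equivalence. Third, if in addition \<open>t \<le> C h\<close> beyond \<open>A\<close>, then the terms \<open>n \<ge> 2\<close> of the series
  are together at most a small multiple of \<open>r * h 1\<^bsub>(A,\<infinity>)\<^esub>\<close> (\<open>nexp_remainder\<close>).

  An asymptotically non-increasing \<open>g\<close> is almost decreasing, so \<open>g\<close> is almost decreasing in
  both cases. If \<open>g1\<close> is weakly subexponential, the three facts with \<open>h = g\<close> give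
  \<open>f \<sim> g\<close>, and \<open>f\<close> inherits the properties of \<open>g\<close>, which are stable under asymptotic
  equivalence.

  If conversely \<open>g1\<close> is long-tailed and \<open>f \<sim> g\<close>, the first-order term \<open>r * t\<close> already
  accounts for nearly all of \<open>f\<close>, so \<open>r * t * t\<close>, hence \<open>u * t * t\<close>, is at most a small
  multiple of \<open>g\<close>. As \<open>u\<close> is fixed and has positive mass on a bounded interval, and
  translations change \<open>g\<close> only by bounded factors, \<open>t * t\<close> itself is at most a small
  multiple of \<open>g\<close>, after an increase of \<open>A\<close>.

  Finally, let \<open>f\<close> be weakly subexponential and almost decreasing, and \<open>g\<close> asymptotic to a
  non-increasing function. This monotonicity gives \<open>g = O(f)\<close>, so the three facts apply with
  \<open>h = f\<close> and leave \<open>f\<close> close to \<open>r * t\<close>. Monotonicity confines \<open>r * t\<close> at \<open>x\<close>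
  between \<open>g (x + B)\<close> and \<open>g (x - B)\<close>, up to factors near 1 and a small multiple of \<open>f\<close>, and
  the translation by \<open>B\<close> is removed because \<open>f\<close>, rather than \<open>g\<close>, is known to be long-tailed.
\<close>

section \<open>Convolution of extended non-negative functions and its exponential\<close>

text \<open>Values in \<open>[0, \<infinity>]\<close> make convolution total, so that commutativity, associativity and
  exchange with sums hold at every point without integrability conditions.\<close>

definition nconv :: "(real \<Rightarrow> ennreal) \<Rightarrow> (real \<Rightarrow> ennreal) \<Rightarrow> real \<Rightarrow> ennreal" where
  "nconv u v x = (\<integral>\<^sup>+y. u (x - y) * v y \<partial>lborel)"

lemma nconv_measurable [measurable]:
  assumes [measurable]: "u \<in> borel_measurable borel" "v \<in> borel_measurable borel"
  shows "nconv u v \<in> borel_measurable borel"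
  unfolding nconv_def[abs_def] by measurable

lemma nn_integral_reflect:
  assumes [measurable]: "u \<in> borel_measurable borel"
  shows "(\<integral>\<^sup>+y. u ((x::real) - y) \<partial>lborel) = (\<integral>\<^sup>+y. u y \<partial>lborel)"
  using nn_integral_real_affine[of u "-1" x] by simp

lemma nn_integral_translate:
  assumes [measurable]: "u \<in> borel_measurable borel"
  shows "(\<integral>\<^sup>+y. u (y - (x::real)) \<partial>lborel) = (\<integral>\<^sup>+y. u y \<partial>lborel)"
  using nn_integral_real_affine[of u "1" "-x"] by (simp add: algebra_simps)

lemma nconv_commute:
  assumes [measurable]: "u \<in> borel_measurable borel" "v \<in> borel_measurable borel"
  shows "nconv u v = nconv v u"
proof
  fix x
  have "(\<integral>\<^sup>+y. u (x - y) * v (x - (x - y)) \<partial>lborel) = (\<integral>\<^sup>+y. u y * v (x - y) \<partial>lborel)"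
    by (rule nn_integral_reflect[where u="\<lambda>y. u y * v (x - y)"]) measurable
  then show "nconv u v x = nconv v u x" by (simp add: nconv_def mult.commute)
qed

lemma nconv_assoc:
  assumes [measurable]: "u \<in> borel_measurable borel" "v \<in> borel_measurable borel"
    "w \<in> borel_measurable borel"
  shows "nconv (nconv u v) w = nconv u (nconv v w)"
proof
  fix x
  have "nconv u (nconv v w) x = (\<integral>\<^sup>+z. (\<integral>\<^sup>+y. u (x - z) * (v (z - y) * w y) \<partial>lborel) \<partial>lborel)"
    unfolding nconv_def by (subst nn_integral_cmult) auto
  also have "\<dots> = (\<integral>\<^sup>+y. (\<integral>\<^sup>+z. u (x - z) * (v (z - y) * w y) \<partial>lborel) \<partial>lborel)"
    by (rule lborel_pair.Fubini') measurable
  also have "\<dots> = (\<integral>\<^sup>+y. (\<integral>\<^sup>+z. u (x - y - z) * (v z * w y) \<partial>lborel) \<partial>lborel)"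
  proof (rule nn_integral_cong)
    fix y
    have "(\<integral>\<^sup>+z. u (x - y - (z - y)) * (v (z - y) * w y) \<partial>lborel)
        = (\<integral>\<^sup>+z. u (x - y - z) * (v z * w y) \<partial>lborel)"
      by (rule nn_integral_translate[where u="\<lambda>z. u (x - y - z) * (v z * w y)"]) measurable
    then show "(\<integral>\<^sup>+z. u (x - z) * (v (z - y) * w y) \<partial>lborel)
        = (\<integral>\<^sup>+z. u (x - y - z) * (v z * w y) \<partial>lborel)" by simp
  qed
  also have "\<dots> = (\<integral>\<^sup>+y. (\<integral>\<^sup>+z. u (x - y - z) * v z \<partial>lborel) * w y \<partial>lborel)"
    by (subst nn_integral_multc[symmetric]) (auto simp: mult.assoc)
  also have "\<dots> = nconv (nconv u v) w x" by (simp add: nconv_def)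
  finally show "nconv (nconv u v) w x = nconv u (nconv v w) x" by simp
qed

lemma nconv_right_commute:
  assumes [measurable]: "u \<in> borel_measurable borel" "v \<in> borel_measurable borel"
    "w \<in> borel_measurable borel"
  shows "nconv (nconv u v) w = nconv (nconv u w) v"
  by (simp add: nconv_assoc nconv_commute[of v w])

lemma nconv_mono: "(\<And>y. u y \<le> u' y) \<Longrightarrow> (\<And>y. v y \<le> v' y) \<Longrightarrow> nconv u v x \<le> nconv u' v' x"
  unfolding nconv_def by (intro nn_integral_mono mult_mono) auto

lemma nconv_add_right:
  assumes [measurable]: "u \<in> borel_measurable borel" "v \<in> borel_measurable borel"
    "w \<in> borel_measurable borel"
  shows "nconv u (\<lambda>y. v y + w y) x = nconv u v x + nconv u w x"
  unfolding nconv_def by (simp add: distrib_left nn_integral_add)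

lemma nconv_add_left:
  assumes [measurable]: "u \<in> borel_measurable borel" "v \<in> borel_measurable borel"
    "w \<in> borel_measurable borel"
  shows "nconv (\<lambda>y. u y + v y) w x = nconv u w x + nconv v w x"
  unfolding nconv_def by (simp add: distrib_right nn_integral_add)

lemma nconv_cmult_left:
  assumes [measurable]: "u \<in> borel_measurable borel" "v \<in> borel_measurable borel"
  shows "nconv (\<lambda>y. c * u y) v x = c * nconv u v x"
  unfolding nconv_def by (subst nn_integral_cmult[symmetric]) (auto simp: mult.assoc)

lemma nconv_cmult_right:
  assumes [measurable]: "u \<in> borel_measurable borel" "v \<in> borel_measurable borel"
  shows "nconv u (\<lambda>y. c * v y) x = c * nconv u v x"
  unfolding nconv_def by (subst nn_integral_cmult[symmetric]) (auto simp: ac_simps)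

lemma nconv_sum_left:
  assumes [measurable]: "\<And>i. u i \<in> borel_measurable borel" "v \<in> borel_measurable borel"
  shows "nconv (\<lambda>y. \<Sum>i\<in>I. u i y) v x = (\<Sum>i\<in>I. nconv (u i) v x)"
  unfolding nconv_def by (subst nn_integral_sum[symmetric]) (auto simp: sum_distrib_right)

lemma nconv_suminf_left:
  assumes [measurable]: "\<And>i::nat. u i \<in> borel_measurable borel" "v \<in> borel_measurable borel"
  shows "nconv (\<lambda>y. \<Sum>i. u i y) v x = (\<Sum>i. nconv (u i) v x)"
  unfolding nconv_def by (subst nn_integral_suminf[symmetric]) (auto simp: ennreal_suminf_multc)

lemma nconv_tilt:
  assumes [measurable]: "u \<in> borel_measurable borel" "v \<in> borel_measurable borel"
  shows "nconv u v x * ennreal (exp (\<gamma> * x))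
    = nconv (\<lambda>y. u y * ennreal (exp (\<gamma> * y))) (\<lambda>y. v y * ennreal (exp (\<gamma> * y))) x"
proof -
  have e: "ennreal (exp (\<gamma> * x)) = ennreal (exp (\<gamma> * (x - y))) * ennreal (exp (\<gamma> * y))" for y
    by (simp add: ennreal_mult[symmetric] exp_add[symmetric] algebra_simps)
  have "nconv u v x * ennreal (exp (\<gamma> * x))
      = (\<integral>\<^sup>+y. u (x - y) * v y * ennreal (exp (\<gamma> * x)) \<partial>lborel)"
    unfolding nconv_def by (subst nn_integral_multc) auto
  also have "\<dots> = (\<integral>\<^sup>+y. u (x - y) * v y * (ennreal (exp (\<gamma> * (x - y))) * ennreal (exp (\<gamma> * y))) \<partial>lborel)"
    using e by simp
  also have "\<dots> = nconv (\<lambda>y. u y * ennreal (exp (\<gamma> * y))) (\<lambda>y. v y * ennreal (exp (\<gamma> * y))) x"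
    unfolding nconv_def by (simp add: ac_simps)
  finally show ?thesis .
qed

lemma nn_integral_nconv:
  assumes [measurable]: "u \<in> borel_measurable borel" "v \<in> borel_measurable borel"
  shows "(\<integral>\<^sup>+x. nconv u v x \<partial>lborel) = (\<integral>\<^sup>+x. u x \<partial>lborel) * (\<integral>\<^sup>+x. v x \<partial>lborel)"
proof -
  have "(\<integral>\<^sup>+x. nconv u v x \<partial>lborel) = (\<integral>\<^sup>+y. (\<integral>\<^sup>+x. u (x - y) * v y \<partial>lborel) \<partial>lborel)"
    unfolding nconv_def by (rule lborel_pair.Fubini') measurable
  also have "\<dots> = (\<integral>\<^sup>+y. (\<integral>\<^sup>+x. u x \<partial>lborel) * v y \<partial>lborel)"
    by (subst nn_integral_multc) (auto simp: nn_integral_translate)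
  finally show ?thesis by (simp add: nn_integral_cmult)
qed

lemma nn_integral_nconv_tilt:
  assumes [measurable]: "u \<in> borel_measurable borel" "v \<in> borel_measurable borel"
  shows "(\<integral>\<^sup>+x. nconv u v x * ennreal (exp (\<gamma> * x)) \<partial>lborel)
    = (\<integral>\<^sup>+x. u x * ennreal (exp (\<gamma> * x)) \<partial>lborel) * (\<integral>\<^sup>+x. v x * ennreal (exp (\<gamma> * x)) \<partial>lborel)"
  by (simp add: nconv_tilt nn_integral_nconv)

text \<open>The \<open>n\<close>-fold convolution of \<open>u\<close> with \<open>v\<close>; applying \<open>v\<close> to a function \<open>u\<close> avoids a unit for
  convolution.\<close>

primrec cpow :: "(real \<Rightarrow> ennreal) \<Rightarrow> nat \<Rightarrow> (real \<Rightarrow> ennreal) \<Rightarrow> real \<Rightarrow> ennreal" where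
  "cpow v 0 u = u"
| "cpow v (Suc n) u = nconv (cpow v n u) v"

text \<open>\<open>nexp v u\<close> is \<open>u\<close> convolved with the exponential \<open>\<Sum>n. v\<^sup>*\<^sup>n / n!\<close>: up to the normalising factor
  \<open>exp (- \<integral>v)\<close>, it is \<open>u\<close> convolved with the compound Poisson distribution with Levy density \<open>v\<close>.\<close>

definition nexp :: "(real \<Rightarrow> ennreal) \<Rightarrow> (real \<Rightarrow> ennreal) \<Rightarrow> real \<Rightarrow> ennreal" where
  "nexp v u x = (\<Sum>n. ennreal (1 / fact n) * cpow v n u x)"

lemma cpow_measurable [measurable]:
  assumes [measurable]: "u \<in> borel_measurable borel" "v \<in> borel_measurable borel"
  shows "cpow v n u \<in> borel_measurable borel"
  by (induction n) auto

lemma nexp_measurable [measurable]: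
  assumes [measurable]: "u \<in> borel_measurable borel" "v \<in> borel_measurable borel"
  shows "nexp v u \<in> borel_measurable borel"
  unfolding nexp_def[abs_def] by measurable

lemma cpow_nconv:
  assumes [measurable]: "u \<in> borel_measurable borel" "v \<in> borel_measurable borel"
    "w \<in> borel_measurable borel"
  shows "cpow v n (nconv u w) = nconv (cpow v n u) w"
proof (induction n)
  case (Suc n)
  then show ?case using nconv_right_commute[of "cpow v n u" w v] by simp
qed simp

text \<open>The induction step of the binomial theorem, for coefficients indexed by the two exponents.\<close>

lemma binomial_step:
  fixes D :: "nat \<Rightarrow> nat \<Rightarrow> 'a::comm_semiring_1"
  shows "(\<Sum>k\<le>n. of_nat (n choose k) * (D (Suc k) (n - k) + D k (Suc (n - k))))
    = (\<Sum>k\<le>Suc n. of_nat (Suc n choose k) * D k (Suc n - k))"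
proof -
  have "(\<Sum>k\<le>Suc n. of_nat (Suc n choose k) * D k (Suc n - k))
      = D 0 (Suc n) + (\<Sum>k\<le>n. of_nat (Suc n choose Suc k) * D (Suc k) (n - k))"
    by (subst sum.atMost_Suc_shift) simp
  also have "\<dots> = (D 0 (Suc n) + (\<Sum>k\<le>n. of_nat (n choose Suc k) * D (Suc k) (n - k)))
      + (\<Sum>k\<le>n. of_nat (n choose k) * D (Suc k) (n - k))"
    by (simp add: algebra_simps sum.distrib)
  also have "D 0 (Suc n) + (\<Sum>k\<le>n. of_nat (n choose Suc k) * D (Suc k) (n - k))
      = (\<Sum>k\<le>Suc n. of_nat (n choose k) * D k (Suc n - k))"
    by (subst sum.atMost_Suc_shift) simp
  also have "\<dots> = (\<Sum>k\<le>n. of_nat (n choose k) * D k (Suc (n - k)))"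
    by (simp add: Suc_diff_le binomial_eq_0)
  finally show ?thesis by (simp add: distrib_left sum.distrib ac_simps)
qed

lemma cpow_add:
  assumes [measurable]: "u \<in> borel_measurable borel" "s \<in> borel_measurable borel"
    "t \<in> borel_measurable borel"
  shows "cpow (\<lambda>y. s y + t y) n u x
    = (\<Sum>k\<le>n. of_nat (n choose k) * cpow t k (cpow s (n - k) u) x)"
proof (induction n arbitrary: x)
  case (Suc n)
  have eq: "cpow (\<lambda>y. s y + t y) n u
      = (\<lambda>x. \<Sum>k\<le>n. of_nat (n choose k) * cpow t k (cpow s (n - k) u) x)"
    using Suc by blast
  have "cpow (\<lambda>y. s y + t y) (Suc n) u x
      = nconv (\<lambda>x. \<Sum>k\<le>n. of_nat (n choose k) * cpow t k (cpow s (n - k) u) x) (\<lambda>y. s y + t y) x"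
    by (simp only: cpow.simps eq)
  also have "\<dots> = (\<Sum>k\<le>n. of_nat (n choose k) * nconv (cpow t k (cpow s (n - k) u)) (\<lambda>y. s y + t y) x)"
    by (subst nconv_sum_left) (auto simp: nconv_cmult_left)
  also have "\<dots> = (\<Sum>k\<le>n. of_nat (n choose k)
      * (cpow t (Suc k) (cpow s (n - k) u) x + cpow t k (cpow s (Suc (n - k)) u) x))"
    by (simp add: nconv_add_right cpow_nconv add.commute)
  also have "\<dots> = (\<Sum>k\<le>Suc n. of_nat (Suc n choose k) * cpow t k (cpow s (Suc n - k) u) x)"
    by (rule binomial_step)
  finally show ?case .
qed simp

lemma suminf_ennreal_swap:
  fixes a :: "nat \<Rightarrow> nat \<Rightarrow> ennreal"
  shows "(\<Sum>i. \<Sum>j. a i j) = (\<Sum>j. \<Sum>i. a i j)"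
proof -
  have "(\<Sum>i. \<Sum>j. a i j) = (\<integral>\<^sup>+i. (\<Sum>j. a i j) \<partial>count_space UNIV)"
    by (simp add: nn_integral_count_space_nat)
  also have "\<dots> = (\<Sum>j. \<integral>\<^sup>+i. a i j \<partial>count_space UNIV)"
    by (rule nn_integral_suminf) simp
  finally show ?thesis by (simp add: nn_integral_count_space_nat)
qed

lemma suminf_ennreal_triangle:
  fixes a :: "nat \<Rightarrow> nat \<Rightarrow> ennreal"
  shows "(\<Sum>n. \<Sum>k\<le>n. a k (n - k)) = (\<Sum>k. \<Sum>j. a k j)"
proof -
  have "(\<Sum>n. \<Sum>k\<le>n. a k (n - k)) = (\<Sum>n. \<Sum>k. if k \<le> n then a k (n - k) else 0)"
  proof (rule suminf_cong)
    fix n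
    have "(\<Sum>k. if k \<le> n then a k (n - k) else 0) = (\<Sum>k\<le>n. if k \<le> n then a k (n - k) else 0)"
      by (rule suminf_finite) auto
    then show "(\<Sum>k\<le>n. a k (n - k)) = (\<Sum>k. if k \<le> n then a k (n - k) else 0)" by simp
  qed
  also have "\<dots> = (\<Sum>k. \<Sum>n. if k \<le> n then a k (n - k) else 0)"
    by (rule suminf_ennreal_swap)
  also have "\<dots> = (\<Sum>k. \<Sum>j. a k j)"
  proof (rule suminf_cong)
    fix k
    have "(\<Sum>j. a k j) = (\<Sum>j. if k \<le> j + k then a k (j + k - k) else 0)" by simp
    also have "\<dots> = (\<Sum>n. if k \<le> n then a k (n - k) else 0)"
      using suminf_offset[of "\<lambda>n. if k \<le> n then a k (n - k) else 0" k] by simp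
    finally show "(\<Sum>n. if k \<le> n then a k (n - k) else 0) = (\<Sum>j. a k j)" by simp
  qed
  finally show ?thesis .
qed

lemma cpow_nexp:
  assumes [measurable]: "u \<in> borel_measurable borel" "s \<in> borel_measurable borel"
    "t \<in> borel_measurable borel"
  shows "cpow t k (nexp s u) x = (\<Sum>j. ennreal (1 / fact j) * cpow t k (cpow s j u) x)"
proof (induction k arbitrary: x)
  case (Suc k)
  then have eq: "cpow t k (nexp s u) = (\<lambda>x. \<Sum>j. ennreal (1 / fact j) * cpow t k (cpow s j u) x)"
    by auto
  show ?case by (simp add: eq nconv_suminf_left nconv_cmult_left)
qed (simp add: nexp_def)

text \<open>The functional equation of the exponential. It holds at every point, which allows one fixed
  version of the density to be decomposed at different levels.\<close>

lemma nexp_add: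
  assumes [measurable]: "u \<in> borel_measurable borel" "s \<in> borel_measurable borel"
    "t \<in> borel_measurable borel"
  shows "nexp (\<lambda>y. s y + t y) u = nexp t (nexp s u)"
proof
  fix x
  have c: "ennreal (1 / fact n) * of_nat (n choose k) = ennreal (1 / fact k) * ennreal (1 / fact (n - k))"
    if "k \<le> n" for k n :: nat
    using that by (simp add: ennreal_of_nat_eq_real_of_nat ennreal_mult[symmetric] binomial_fact field_simps)
  have "nexp (\<lambda>y. s y + t y) u x = (\<Sum>n. \<Sum>k\<le>n. ennreal (1 / fact k) *
      (ennreal (1 / fact (n - k)) * cpow t k (cpow s (n - k) u) x))"
    unfolding nexp_def
    by (auto simp: cpow_add sum_distrib_left mult.assoc[symmetric] c intro!: suminf_cong sum.cong)
  also have "\<dots> = (\<Sum>k. \<Sum>j. ennreal (1 / fact k) * (ennreal (1 / fact j) * cpow t k (cpow s j u) x))"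
    by (rule suminf_ennreal_triangle)
  also have "\<dots> = nexp t (nexp s u) x"
    by (simp add: nexp_def[of t] cpow_nexp)
  finally show "nexp (\<lambda>y. s y + t y) u x = nexp t (nexp s u) x" .
qed

lemma suminf_exp_ennreal:
  assumes "0 \<le> l"
  shows "(\<Sum>n. ennreal (1 / fact n) * ennreal l ^ n) = ennreal (exp l)"
proof -
  have "(\<lambda>n. l ^ n / fact n) sums exp l"
    using exp_converges[of l] by (simp add: divide_inverse mult.commute)
  then have "(\<Sum>n. ennreal (l ^ n / fact n)) = ennreal (exp l)"
    using assms by (intro suminf_ennreal_eq) auto
  then show ?thesis
    using assms by (simp add: ennreal_power ennreal_mult[symmetric])
qed

lemma nn_integral_cpow:
  assumes [measurable]: "u \<in> borel_measurable borel" "v \<in> borel_measurable borel"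
  shows "(\<integral>\<^sup>+x. cpow v n u x \<partial>lborel) = (\<integral>\<^sup>+x. v x \<partial>lborel) ^ n * (\<integral>\<^sup>+x. u x \<partial>lborel)"
  by (induction n) (auto simp: nn_integral_nconv ac_simps)

lemma nn_integral_nexp:
  assumes [measurable]: "u \<in> borel_measurable borel" "v \<in> borel_measurable borel"
    and l: "(\<integral>\<^sup>+x. v x \<partial>lborel) = ennreal l" "0 \<le> l"
  shows "(\<integral>\<^sup>+x. nexp v u x \<partial>lborel) = ennreal (exp l) * (\<integral>\<^sup>+x. u x \<partial>lborel)"
proof -
  have "(\<integral>\<^sup>+x. nexp v u x \<partial>lborel)
      = (\<Sum>n. ennreal (1 / fact n) * ennreal l ^ n * (\<integral>\<^sup>+x. u x \<partial>lborel))"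
    unfolding nexp_def
    by (subst nn_integral_suminf) (auto simp: nn_integral_cmult nn_integral_cpow l mult.assoc)
  then show ?thesis using suminf_exp_ennreal[OF l(2)] by (simp add: ennreal_suminf_multc)
qed

lemma nexp_ge: "u x \<le> nexp v u x"
proof -
  have "(\<Sum>n<Suc 0. ennreal (1 / fact n) * cpow v n u x) \<le> nexp v u x"
    unfolding nexp_def by (rule sum_le_suminf) auto
  then show ?thesis by simp
qed

section \<open>Functions with an exponentially small right tail\<close>

text \<open>The weighted \<open>L\<^sup>1\<close> norm and the weighted supremum over \<open>[a, \<infinity>)\<close> are controlled together, with
  the same \<open>a\<close> before and after convolution. Jumps \<open>y \<le> 0\<close> only evaluate \<open>u\<close> further to the right,
  so \<open>s\<close> has to be bounded only on \<open>(0, \<infinity>)\<close>.\<close>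

lemma nconv_tilt_bounds:
  fixes u s :: "real \<Rightarrow> ennreal"
  assumes [measurable]: "u \<in> borel_measurable borel" "s \<in> borel_measurable borel"
    and u: "(\<integral>\<^sup>+x. u x * ennreal (exp (\<gamma> * x)) \<partial>lborel) \<le> W"
      "\<And>x. a \<le> x \<Longrightarrow> u x * ennreal (exp (\<gamma> * x)) \<le> W"
    and s: "(\<integral>\<^sup>+x. s x * ennreal (exp (\<gamma> * x)) \<partial>lborel) \<le> L"
      "\<And>x. 0 < x \<Longrightarrow> s x * ennreal (exp (\<gamma> * x)) \<le> L"
  shows "(\<integral>\<^sup>+x. nconv u s x * ennreal (exp (\<gamma> * x)) \<partial>lborel) \<le> 2 * L * W"
    and "a \<le> x \<Longrightarrow> nconv u s x * ennreal (exp (\<gamma> * x)) \<le> 2 * L * W"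
proof -
  have "(\<integral>\<^sup>+x. nconv u s x * ennreal (exp (\<gamma> * x)) \<partial>lborel) \<le> W * L"
    unfolding nn_integral_nconv_tilt[OF assms(1,2)] using u(1) s(1) by (intro mult_mono) auto
  also have "\<dots> \<le> W * L + W * L" by (rule add_increasing2) auto
  also have "\<dots> = 2 * L * W" by (simp only: mult_2 distrib_right mult.commute[of W L])
  finally show "(\<integral>\<^sup>+x. nconv u s x * ennreal (exp (\<gamma> * x)) \<partial>lborel) \<le> 2 * L * W" .
next
  assume x: "a \<le> x"
  define U where "U y = u y * ennreal (exp (\<gamma> * y))" for y
  define S where "S y = s y * ennreal (exp (\<gamma> * y))" for y
  have [measurable]: "U \<in> borel_measurable borel" "S \<in> borel_measurable borel"
    unfolding U_def[abs_def] S_def[abs_def] by measurable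
  have "nconv u s x * ennreal (exp (\<gamma> * x)) = (\<integral>\<^sup>+y. U (x - y) * S y \<partial>lborel)"
    unfolding nconv_tilt[OF assms(1,2)] by (simp add: nconv_def U_def S_def)
  also have "\<dots> \<le> (\<integral>\<^sup>+y. W * S y + L * U (x - y) \<partial>lborel)"
  proof (rule nn_integral_mono)
    fix y
    show "U (x - y) * S y \<le> W * S y + L * U (x - y)"
    proof (cases "y > 0")
      case True
      then have "U (x - y) * S y \<le> U (x - y) * L"
        using s(2) by (intro mult_left_mono) (auto simp: S_def)
      then show ?thesis by (simp add: mult.commute add_increasing)
    next
      case False
      then have "U (x - y) * S y \<le> W * S y"
        using u(2) x by (intro mult_right_mono) (auto simp: U_def)
      then show ?thesis by (simp add: add_increasing2)
    qed
  qed
  also have "\<dots> = W * (\<integral>\<^sup>+y. S y \<partial>lborel) + L * (\<integral>\<^sup>+y. U y \<partial>lborel)"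
    by (simp add: nn_integral_add nn_integral_cmult nn_integral_reflect)
  also have "\<dots> \<le> W * L + L * W"
    using u(1) s(1) by (intro add_mono mult_left_mono) (auto simp: U_def S_def)
  finally show "nconv u s x * ennreal (exp (\<gamma> * x)) \<le> 2 * L * W"
    by (simp only: mult_2 distrib_right mult.commute[of W L])
qed

text \<open>Finite mass, a finite exponential moment, and \<open>u x = O(exp (- \<gamma> x))\<close> as \<open>x \<rightarrow> \<infinity>\<close>. No
  pointwise bound is required on the left of \<open>a\<close>, where \<open>u\<close> may be unbounded.\<close>

definition light_tail :: "real \<Rightarrow> (real \<Rightarrow> ennreal) \<Rightarrow> bool" where
  "light_tail \<gamma> u \<longleftrightarrow> u \<in> borel_measurable borel \<and> (\<integral>\<^sup>+x. u x \<partial>lborel) < \<infinity> \<and>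
     (\<exists>a W. W < \<infinity> \<and> (\<integral>\<^sup>+x. u x * ennreal (exp (\<gamma> * x)) \<partial>lborel) \<le> W \<and>
       (\<forall>x\<ge>a. u x * ennreal (exp (\<gamma> * x)) \<le> W))"

lemma light_tail_measurable: "light_tail \<gamma> u \<Longrightarrow> u \<in> borel_measurable borel"
  by (simp add: light_tail_def)

lemma light_tail_nconv:
  assumes u: "light_tail \<gamma> u" and [measurable]: "s \<in> borel_measurable borel"
    and s: "(\<integral>\<^sup>+x. s x \<partial>lborel) < \<infinity>" "(\<integral>\<^sup>+x. s x * ennreal (exp (\<gamma> * x)) \<partial>lborel) \<le> L"
      "\<And>x. 0 < x \<Longrightarrow> s x * ennreal (exp (\<gamma> * x)) \<le> L" "L < \<infinity>"
  shows "light_tail \<gamma> (nconv u s)"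
proof -
  have [measurable]: "u \<in> borel_measurable borel" and ui: "(\<integral>\<^sup>+x. u x \<partial>lborel) < \<infinity>"
    using u by (auto simp: light_tail_def)
  obtain a W where W: "W < \<infinity>" "(\<integral>\<^sup>+x. u x * ennreal (exp (\<gamma> * x)) \<partial>lborel) \<le> W"
    "\<And>x. a \<le> x \<Longrightarrow> u x * ennreal (exp (\<gamma> * x)) \<le> W" using u unfolding light_tail_def by blast
  note b = nconv_tilt_bounds[OF _ _ W(2,3) s(2,3), simplified]
  have "2 * L * W < \<infinity>" using W(1) s(4) by (simp add: ennreal_mult_less_top)
  moreover have "(\<integral>\<^sup>+x. nconv u s x \<partial>lborel) < \<infinity>"
    using ui s(1) by (simp add: nn_integral_nconv ennreal_mult_less_top)
  ultimately show ?thesis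
    unfolding light_tail_def
    using b(1) b(2) by (intro conjI exI[of _ a] exI[of _ "2 * L * W"]) auto
qed

lemma light_tail_nexp:
  assumes u: "light_tail \<gamma> u" and [measurable]: "s \<in> borel_measurable borel"
    and s: "(\<integral>\<^sup>+x. s x \<partial>lborel) < \<infinity>" "(\<integral>\<^sup>+x. s x * ennreal (exp (\<gamma> * x)) \<partial>lborel) \<le> L"
      "\<And>x. 0 < x \<Longrightarrow> s x * ennreal (exp (\<gamma> * x)) \<le> L" "L < \<infinity>"
  shows "light_tail \<gamma> (nexp s u)"
proof -
  have [measurable]: "u \<in> borel_measurable borel" and ui: "(\<integral>\<^sup>+x. u x \<partial>lborel) < \<infinity>"
    using u by (auto simp: light_tail_def)
  obtain a W where W: "W < \<infinity>" "(\<integral>\<^sup>+x. u x * ennreal (exp (\<gamma> * x)) \<partial>lborel) \<le> W"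
    "\<And>x. a \<le> x \<Longrightarrow> u x * ennreal (exp (\<gamma> * x)) \<le> W" using u unfolding light_tail_def by blast
  have it: "(\<integral>\<^sup>+x. cpow s n u x * ennreal (exp (\<gamma> * x)) \<partial>lborel) \<le> (2 * L) ^ n * W
      \<and> (\<forall>x\<ge>a. cpow s n u x * ennreal (exp (\<gamma> * x)) \<le> (2 * L) ^ n * W)" for n
  proof (induction n)
    case (Suc n)
    show ?case
      using nconv_tilt_bounds[of "cpow s n u" s \<gamma> "(2 * L) ^ n * W" a L] Suc s(2,3)
      by (simp add: ac_simps)
  qed (use W in auto)
  obtain l where l: "2 * L = ennreal l" "0 \<le> l"
    using s(4) by (cases "2 * L" rule: ennreal_cases) (auto simp: ennreal_mult_eq_top_iff)
  have E: "(\<Sum>n. ennreal (1 / fact n) * ((2 * L) ^ n * W)) = ennreal (exp l) * W"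
    unfolding l(1) suminf_exp_ennreal[OF l(2), symmetric]
    by (simp add: ennreal_suminf_multc[symmetric] mult.assoc)
  have 1: "nexp s u x * ennreal (exp (\<gamma> * x)) \<le> ennreal (exp l) * W" if "a \<le> x" for x
  proof -
    have "nexp s u x * ennreal (exp (\<gamma> * x))
        = (\<Sum>n. ennreal (1 / fact n) * (cpow s n u x * ennreal (exp (\<gamma> * x))))"
      unfolding nexp_def by (simp add: ennreal_suminf_multc[symmetric] mult.assoc)
    also have "\<dots> \<le> (\<Sum>n. ennreal (1 / fact n) * ((2 * L) ^ n * W))"
      using it that by (intro suminf_le mult_left_mono) auto
    finally show ?thesis using E by simp
  qed
  have 2: "(\<integral>\<^sup>+x. nexp s u x * ennreal (exp (\<gamma> * x)) \<partial>lborel) \<le> ennreal (exp l) * W"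
  proof -
    have "(\<integral>\<^sup>+x. nexp s u x * ennreal (exp (\<gamma> * x)) \<partial>lborel)
        = (\<Sum>n. ennreal (1 / fact n) * (\<integral>\<^sup>+x. cpow s n u x * ennreal (exp (\<gamma> * x)) \<partial>lborel))"
      unfolding nexp_def
      by (simp add: ennreal_suminf_multc[symmetric] mult.assoc nn_integral_suminf nn_integral_cmult)
    also have "\<dots> \<le> (\<Sum>n. ennreal (1 / fact n) * ((2 * L) ^ n * W))"
      using it by (intro suminf_le mult_left_mono) auto
    finally show ?thesis using E by simp
  qed
  obtain l' where l': "(\<integral>\<^sup>+x. s x \<partial>lborel) = ennreal l'" "0 \<le> l'"
    using s(1) by (cases "\<integral>\<^sup>+x. s x \<partial>lborel" rule: ennreal_cases) auto
  have "(\<integral>\<^sup>+x. nexp s u x \<partial>lborel) < \<infinity>"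
    using ui by (simp add: nn_integral_nexp[OF _ _ l'] ennreal_mult_less_top)
  moreover have "ennreal (exp l) * W < \<infinity>" using W(1) by (simp add: ennreal_mult_less_top)
  ultimately show ?thesis
    unfolding light_tail_def
    using 1 2 by (intro conjI exI[of _ a] exI[of _ "ennreal (exp l) * W"]) auto
qed

section \<open>Long-tailed almost decreasing functions\<close>

text \<open>\<open>h\<close> restricted to \<open>(A, \<infinity>)\<close>.\<close>

definition tail_part :: "(real \<Rightarrow> real) \<Rightarrow> real \<Rightarrow> real \<Rightarrow> ennreal" where
  "tail_part h A x = (if A < x then ennreal (h x) else 0)"

lemma tail_part_measurable [measurable]:
  "h \<in> borel_measurable borel \<Longrightarrow> tail_part h A \<in> borel_measurable borel"
  unfolding tail_part_def[abs_def] by (intro measurable_If) auto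

lemma tail_part_antimono: "A \<le> B \<Longrightarrow> tail_part h B x \<le> tail_part h A x"
  by (auto simp: tail_part_def)

text \<open>This makes an inequality for all sufficiently large arguments valid for all arguments, once \<open>A\<close> is
  large.\<close>

lemma nconv_tail_part_eq_0: "x \<le> 2 * A \<Longrightarrow> nconv (tail_part h A) (tail_part k A) x = 0"
proof -
  assume "x \<le> 2 * A"
  then have "tail_part h A (x - y) * tail_part k A y = 0" for y
    by (auto simp: tail_part_def)
  then show ?thesis by (simp add: nconv_def del: mult_eq_0_iff)
qed

text \<open>Long-tailed and almost decreasing, without normalisation: \<open>h\<close> may be a probability density or
  the density of a Levy measure, and only its behaviour near \<open>\<infinity>\<close> matters.\<close>

definition regular_tail :: "(real \<Rightarrow> real) \<Rightarrow> bool" where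
  "regular_tail h \<longleftrightarrow> h \<in> borel_measurable borel \<and> (\<forall>x. 0 \<le> h x) \<and>
     (\<exists>a. \<forall>x\<ge>a. 0 < h x) \<and> (\<forall>y>0. (\<lambda>x. h (x + y)) \<sim>[at_top] h) \<and>
     (\<exists>a K. \<forall>x\<ge>a. \<forall>y\<ge>0. h (x + y) \<le> K * h x)"

lemma filterlim_add_const: "filterlim (\<lambda>x::real. x + y) at_top at_top"
  by (subst add.commute) (rule filterlim_tendsto_add_at_top[OF tendsto_const filterlim_ident])

lemma long_tailed_shift:
  fixes h :: "real \<Rightarrow> real"
  assumes pos: "\<forall>x\<ge>a. 0 < h x" and lt: "\<forall>y>0. (\<lambda>x. h (x + y)) \<sim>[at_top] h"
  shows "((\<lambda>x. h (x + y) / h x) \<longlongrightarrow> 1) at_top"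
proof -
  have ev: "eventually (\<lambda>x. h x \<noteq> 0) at_top"
    using eventually_ge_at_top[of a] by eventually_elim (use pos in force)
  have p: "((\<lambda>x. h (x + y) / h x) \<longlongrightarrow> 1) at_top" if "y > 0" for y
    using lt that ev by (intro asymp_equivD_strong) (auto elim: eventually_mono)
  consider "y > 0" | "y = 0" | "y < 0" by linarith
  then show ?thesis
  proof cases
    case 2
    show ?thesis
      by (rule tendsto_eventually) (use ev 2 in \<open>auto elim!: eventually_mono\<close>)
  next
    case 3
    have "((\<lambda>x. h (x + y + - y) / h (x + y)) \<longlongrightarrow> 1) at_top"
      using filterlim_compose[OF p[of "- y"] filterlim_add_const[of y]] 3 by simp
    from tendsto_inverse[OF this] show ?thesis by simp
  qed (rule p)
qed

lemma regular_tail_shift: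
  assumes "regular_tail h" shows "((\<lambda>x. h (x + y) / h x) \<longlongrightarrow> 1) at_top"
  using assms long_tailed_shift[of _ h y] unfolding regular_tail_def by blast

text \<open>A Potter-type bound with arbitrarily small exponent \<open>\<delta>\<close>. Almost monotonicity replaces the uniform
  convergence theorem for long-tailed functions: it handles non-integer translations.\<close>

lemma regular_tail_potter:
  assumes h: "regular_tail h" and "0 < \<delta>"
  obtains C a where "0 < C" "\<And>x. a \<le> x \<Longrightarrow> 0 < h x"
    "\<And>x y. a \<le> x \<Longrightarrow> a \<le> x - y \<Longrightarrow> h (x - y) \<le> C * (1 + exp (\<delta> * y)) * h x"
proof -
  obtain a0 where a0: "\<And>x. a0 \<le> x \<Longrightarrow> 0 < h x" using h unfolding regular_tail_def by blast
  obtain a1 K where K: "\<And>x y. a1 \<le> x \<Longrightarrow> 0 \<le> y \<Longrightarrow> h (x + y) \<le> K * h x"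
    using h unfolding regular_tail_def by blast
  have "eventually (\<lambda>x. exp (-\<delta>) < h (x + 1) / h x) at_top"
    using regular_tail_shift[OF h, of 1] \<open>0 < \<delta>\<close> by (intro order_tendstoD) auto
  then obtain a2 where a2: "\<And>x. a2 \<le> x \<Longrightarrow> exp (-\<delta>) < h (x + 1) / h x"
    by (auto simp: eventually_at_top_linorder)
  define a where "a = max a0 (max a1 a2)"
  have pos: "0 < h x" if "a \<le> x" for x using that a0 by (auto simp: a_def)
  have one: "h x \<le> exp \<delta> * h (x + 1)" if "a \<le> x" for x
    using a2[of x] that pos[of x] by (auto simp: a_def exp_minus field_simps)
  have it: "h x \<le> exp (\<delta> * real n) * h (x + real n)" if "a \<le> x" for x n
  proof (induction n)
    case (Suc n)
    have "exp (\<delta> * real n) * h (x + real n) \<le> exp (\<delta> * real n) * (exp \<delta> * h (x + real n + 1))"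
      using that by (intro mult_left_mono one) auto
    also have "\<dots> = exp (\<delta> * real (Suc n)) * h (x + real (Suc n))"
      by (simp add: algebra_simps exp_add)
    finally show ?case using Suc by linarith
  qed simp
  \<comment> \<open>Almost decreasing with \<open>y = 0\<close> forces \<open>K\<close> to be positive.\<close>
  have "0 < K"
  proof (rule ccontr)
    assume "\<not> 0 < K"
    then have "K * h a \<le> 0" using pos[of a] by (intro mult_nonpos_nonneg) auto
    moreover have "h a \<le> K * h a" using K[of a 0] by (auto simp: a_def)
    ultimately show False using pos[of a] by linarith
  qed
  define C where "C = K * exp \<delta> + K"
  show thesis
  proof (rule that[of C a])
    show "0 < C" using \<open>0 < K\<close> by (simp add: C_def add_pos_pos)
    fix x y assume x: "a \<le> x" "a \<le> x - y"
    show "h (x - y) \<le> C * (1 + exp (\<delta> * y)) * h x"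
    proof (cases "y \<ge> 0")
      case False
      have "h (x - y) \<le> K * h x" using K[of x "-y"] x False by (auto simp: a_def)
      also have "\<dots> \<le> C * (1 + exp (\<delta> * y)) * h x"
      proof (intro mult_right_mono)
        have "K * 1 \<le> C * (1 + exp (\<delta> * y))"
          using \<open>0 < K\<close> by (intro mult_mono) (auto simp: C_def)
        then show "K \<le> C * (1 + exp (\<delta> * y))" by simp
      qed (use pos x in force)
      finally show ?thesis .
    next
      case True
      define n where "n = nat \<lfloor>y\<rfloor>"
      have n: "real n \<le> y" "y \<le> real n + 1"
        using True unfolding n_def by linarith+
      have "h (x - y) \<le> exp (\<delta> * real n) * h (x - y + real n)" by (rule it) (use x in auto)
      also have "\<dots> \<le> exp (\<delta> * real n) * (exp \<delta> * h (x - y + real n + 1))"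
        using x by (intro mult_left_mono one) auto
      also have "\<dots> = exp (\<delta> * real (Suc n)) * h (x - y + real n + 1)"
        by (simp add: algebra_simps exp_add)
      also have "\<dots> \<le> exp (\<delta> * real (Suc n)) * (K * h x)"
      proof (intro mult_left_mono)
        show "h (x - y + real n + 1) \<le> K * h x"
          using K[of x "real n + 1 - y"] x n by (auto simp: a_def algebra_simps)
      qed auto
      also have "\<dots> \<le> C * (1 + exp (\<delta> * y)) * h x"
      proof -
        have "exp (\<delta> * real (Suc n)) \<le> exp \<delta> * exp (\<delta> * y)"
          using n(1) \<open>0 < \<delta>\<close> by (simp add: exp_add[symmetric] algebra_simps)
        then have "exp (\<delta> * real (Suc n)) * K \<le> exp \<delta> * exp (\<delta> * y) * K"
          using \<open>0 < K\<close> by simp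
        also have "\<dots> \<le> C * (1 + exp (\<delta> * y))"
          using \<open>0 < K\<close> by (simp add: C_def algebra_simps add_increasing)
        finally show ?thesis
          using pos[of x] x by (simp add: mult.assoc[symmetric] mult_right_mono)
      qed
      finally show ?thesis .
    qed
  qed (use pos in auto)
qed

lemma light_tail_negligible:
  assumes h: "regular_tail h" and r: "light_tail \<gamma> r" and "0 < \<gamma>" "0 < \<epsilon>"
  shows "eventually (\<lambda>x. r x \<le> ennreal (\<epsilon> * h x)) at_top"
proof -
  obtain b W where W: "W < \<infinity>" "\<And>x. b \<le> x \<Longrightarrow> r x * ennreal (exp (\<gamma> * x)) \<le> W"
    using r unfolding light_tail_def by blast
  obtain w where w: "W = ennreal w" "0 \<le> w" using W(1) by (cases W) auto
  obtain C a where C: "0 < C" "\<And>x. a \<le> x \<Longrightarrow> 0 < h x"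
    "\<And>x y. a \<le> x \<Longrightarrow> a \<le> x - y \<Longrightarrow> h (x - y) \<le> C * (1 + exp (\<gamma> / 2 * y)) * h x"
    using regular_tail_potter[OF h, of "\<gamma> / 2"] \<open>0 < \<gamma>\<close> by auto
  have "((\<lambda>x. w * C * (1 + exp (\<gamma> / 2 * (x - a))) * exp (- \<gamma> * x)) \<longlongrightarrow> 0) at_top"
    using \<open>0 < \<gamma>\<close> by real_asymp
  then have "eventually (\<lambda>x. w * C * (1 + exp (\<gamma> / 2 * (x - a))) * exp (- \<gamma> * x) < \<epsilon> * h a) at_top"
    using \<open>0 < \<epsilon>\<close> C(2)[of a] by (intro order_tendstoD) auto
  then show ?thesis
    using eventually_ge_at_top[of a] eventually_ge_at_top[of b]
  proof eventually_elim
    case (elim x)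
    have "r x = r x * ennreal (exp (\<gamma> * x)) * ennreal (exp (- \<gamma> * x))"
      by (simp add: mult.assoc ennreal_mult[symmetric] exp_add[symmetric])
    also have "\<dots> \<le> ennreal w * ennreal (exp (- \<gamma> * x))"
      using W(2)[of x] elim w by (intro mult_right_mono) auto
    also have "\<dots> = ennreal (w * exp (- \<gamma> * x))" using w by (simp add: ennreal_mult)
    also have "\<dots> \<le> ennreal (\<epsilon> * h x)"
    proof (rule ennreal_leI)
      have "w * exp (- \<gamma> * x) * h a \<le> w * exp (- \<gamma> * x) * (C * (1 + exp (\<gamma> / 2 * (x - a))) * h x)"
        using C(3)[of x "x - a"] elim w by (intro mult_left_mono) auto
      also have "\<dots> = (w * C * (1 + exp (\<gamma> / 2 * (x - a))) * exp (- \<gamma> * x)) * h x"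
        by (simp add: mult_ac)
      also have "\<dots> \<le> (\<epsilon> * h a) * h x"
        using elim C(2)[of x] by (intro mult_right_mono) auto
      finally have "(w * exp (- \<gamma> * x)) * h a \<le> (\<epsilon> * h x) * h a" by (simp add: mult_ac)
      then show "w * exp (- \<gamma> * x) \<le> \<epsilon> * h x" using C(2)[of a] by simp
    qed
    finally show ?case .
  qed
qed

text \<open>Smoothing: \<open>r * h 1\<^bsub>(A,\<infinity>)\<^esub> \<sim> m h\<close> with \<open>m\<close> the mass of \<open>r\<close>, by dominated convergence with the
  Potter-type bound. The threshold \<open>a\<close> does not depend on \<open>r\<close>, because \<open>r\<close> will be chosen after \<open>A\<close>.\<close>

lemma nconv_tail_part_asymp:
  assumes h: "regular_tail h" and "0 < \<gamma>"
  obtains a where "\<And>A r m q. a \<le> A \<Longrightarrow> r \<in> borel_measurable borel \<Longrightarrow>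
      (\<integral>\<^sup>+x. r x \<partial>lborel) = ennreal m \<Longrightarrow> 0 \<le> m \<Longrightarrow>
      (\<integral>\<^sup>+x. r x * ennreal (exp (\<gamma> * x)) \<partial>lborel) < \<infinity> \<Longrightarrow>
      (m < q \<longrightarrow> eventually (\<lambda>x. nconv r (tail_part h A) x \<le> ennreal (q * h x)) at_top) \<and>
      (q < m \<longrightarrow> eventually (\<lambda>x. ennreal (q * h x) \<le> nconv r (tail_part h A) x) at_top)"
proof -
  have [measurable]: "h \<in> borel_measurable borel" and h0: "\<And>x. 0 \<le> h x"
    using h by (auto simp: regular_tail_def)
  obtain C a where C: "0 < C" "\<And>x. a \<le> x \<Longrightarrow> 0 < h x"
    "\<And>x y. a \<le> x \<Longrightarrow> a \<le> x - y \<Longrightarrow> h (x - y) \<le> C * (1 + exp (\<gamma> * y)) * h x"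
    using regular_tail_potter[OF h \<open>0 < \<gamma>\<close>] by auto
  show thesis
  proof (rule that[of a])
    fix A r m q
    assume A: "a \<le> A" and [measurable]: "r \<in> borel_measurable borel"
      and m: "(\<integral>\<^sup>+x. r x \<partial>lborel) = ennreal m" "0 \<le> m"
      and e: "(\<integral>\<^sup>+x. r x * ennreal (exp (\<gamma> * x)) \<partial>lborel) < \<infinity>"
    define M where "M = density lborel r"
    have [measurable_cong, simp]: "sets M = sets borel" by (simp add: M_def)
    have sM: "space M = UNIV" by (simp add: M_def)
    have eM: "emeasure M UNIV = ennreal m" using m by (simp add: M_def emeasure_density)
    interpret M: finite_measure M by standard (simp add: eM sM)
    have mM: "measure M UNIV = m" using eM m by (simp add: measure_def)
    define k where "k x y = (if A < x - y then h (x - y) / h x else 0)" for x y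
    have [measurable]: "k x \<in> borel_measurable borel" for x
      unfolding k_def[abs_def] by (intro measurable_If) auto
    have kb: "norm (k x y) \<le> C * (1 + exp (\<gamma> * y))" if "a \<le> x" for x y
    proof (cases "A < x - y")
      case True
      then have "h (x - y) \<le> C * (1 + exp (\<gamma> * y)) * h x" using C(3)[of x y] A that by auto
      then have "h (x - y) / h x \<le> C * (1 + exp (\<gamma> * y))"
        using C(2)[OF that] by (simp add: pos_divide_le_eq)
      then show ?thesis using True h0 by (simp add: k_def)
    qed (use C(1) in \<open>auto simp: k_def intro!: mult_nonneg_nonneg add_nonneg_nonneg\<close>)
    have iexp: "integrable M (\<lambda>y. exp (\<gamma> * y))"
      using e by (intro integrableI_bounded) (auto simp: M_def nn_integral_density mult.commute)
    have idom: "integrable M (\<lambda>y. C * (1 + exp (\<gamma> * y)))"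
      using iexp by (intro integrable_mult_right Bochner_Integration.integrable_add) auto
    have lim: "((\<lambda>x. \<integral>y. k x y \<partial>M) \<longlongrightarrow> (\<integral>y. 1 \<partial>M)) at_top"
    proof (rule integral_dominated_convergence_at_top[where w="\<lambda>y. C * (1 + exp (\<gamma> * y))"])
      show "AE y in M. ((\<lambda>x. k x y) \<longlongrightarrow> 1) at_top"
      proof (rule AE_I2)
        fix y
        have "eventually (\<lambda>x. h (x + - y) / h x = k x y) at_top"
          using eventually_gt_at_top[of "A + y"] by eventually_elim (auto simp: k_def)
        from Lim_transform_eventually[OF regular_tail_shift[OF h, of "-y"] this]
        show "((\<lambda>x. k x y) \<longlongrightarrow> 1) at_top" .
      qed
      show "eventually (\<lambda>x. AE y in M. norm (k x y) \<le> C * (1 + exp (\<gamma> * y))) at_top"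
        using eventually_ge_at_top[of a] by eventually_elim (use kb in auto)
    qed (use idom in auto)
    then have lim: "((\<lambda>x. \<integral>y. k x y \<partial>M) \<longlongrightarrow> m) at_top" by (simp add: sM mM)
    have eq: "nconv r (tail_part h A) x = ennreal ((\<integral>y. k x y \<partial>M) * h x)" if "a \<le> x" for x
    proof -
      have ik: "integrable M (k x)"
        by (rule Bochner_Integration.integrable_bound[OF idom])
          (use kb[OF that] in \<open>auto intro!: AE_I2 intro: order_trans[OF _ abs_ge_self]\<close>)
      have k0: "0 \<le> k x y" for y using h0 by (auto simp: k_def)
      have "nconv r (tail_part h A) x = nconv (tail_part h A) r x" by (simp add: nconv_commute)
      also have "\<dots> = (\<integral>\<^sup>+y. ennreal (k x y * h x) \<partial>M)"
        unfolding nconv_def M_def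
        by (subst nn_integral_density)
           (use C(2)[OF that] in \<open>auto simp: tail_part_def k_def mult.commute intro!: nn_integral_cong\<close>)
      also have "\<dots> = ennreal (\<integral>y. k x y * h x \<partial>M)"
        using ik k0 h0 by (intro nn_integral_eq_integral) auto
      finally show ?thesis by simp
    qed
    have "eventually (\<lambda>x. nconv r (tail_part h A) x \<le> ennreal (q * h x)) at_top" if "m < q"
      using order_tendstoD(2)[OF lim that] eventually_ge_at_top[of a]
      by eventually_elim (auto simp: eq h0 intro!: ennreal_leI mult_right_mono)
    moreover have "eventually (\<lambda>x. ennreal (q * h x) \<le> nconv r (tail_part h A) x) at_top" if "q < m"
      using order_tendstoD(1)[OF lim that] eventually_ge_at_top[of a]
      by eventually_elim (auto simp: eq h0 intro!: ennreal_leI mult_right_mono)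
    ultimately show "(m < q \<longrightarrow> eventually (\<lambda>x. nconv r (tail_part h A) x \<le> ennreal (q * h x)) at_top) \<and>
      (q < m \<longrightarrow> eventually (\<lambda>x. ennreal (q * h x) \<le> nconv r (tail_part h A) x) at_top)"
      by blast
  qed
qed

section \<open>The subexponentiality condition and the remainder of the series\<close>

text \<open>The contribution to \<open>h * h\<close> from both arguments being larger than \<open>A\<close> is negligible relative to
  \<open>h\<close> as \<open>A \<rightarrow> \<infinity>\<close>. The inequality is required at every \<open>x\<close>, so that it can be iterated inside
  convolutions; \<open>small_middleI\<close> shows that large \<open>x\<close> suffice.\<close>

definition small_middle :: "(real \<Rightarrow> real) \<Rightarrow> bool" where
  "small_middle h \<longleftrightarrow> (\<forall>\<epsilon>>0. \<exists>A. \<forall>A'\<ge>A. \<forall>x.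
     nconv (tail_part h A') (tail_part h A') x \<le> ennreal (\<epsilon> * h x))"

lemma small_middleI:
  assumes "\<And>\<epsilon>. 0 < \<epsilon> \<Longrightarrow> \<exists>A. eventually (\<lambda>x. nconv (tail_part h A) (tail_part h A) x \<le> ennreal (\<epsilon> * h x)) at_top"
  shows "small_middle h"
  unfolding small_middle_def
proof (intro allI impI)
  fix \<epsilon> :: real assume "0 < \<epsilon>"
  then obtain A b where A: "\<And>x. b \<le> x \<Longrightarrow> nconv (tail_part h A) (tail_part h A) x \<le> ennreal (\<epsilon> * h x)"
    using assms[of \<epsilon>] by (auto simp: eventually_at_top_linorder)
  show "\<exists>A. \<forall>A'\<ge>A. \<forall>x. nconv (tail_part h A') (tail_part h A') x \<le> ennreal (\<epsilon> * h x)"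
  proof (intro exI[of _ "max 0 (max A b)"] allI impI)
    fix A' x assume A': "max 0 (max A b) \<le> A'"
    show "nconv (tail_part h A') (tail_part h A') x \<le> ennreal (\<epsilon> * h x)"
    proof (cases "x \<le> 2 * A'")
      case False
      have "nconv (tail_part h A') (tail_part h A') x \<le> nconv (tail_part h A) (tail_part h A) x"
        using A' by (intro nconv_mono tail_part_antimono) auto
      also have "\<dots> \<le> ennreal (\<epsilon> * h x)" using A A' False by auto
      finally show ?thesis .
    qed (simp add: nconv_tail_part_eq_0)
  qed
qed

lemma small_middleD:
  assumes "small_middle h" "\<And>x. 0 \<le> h x" "0 < \<delta>"
  obtains A0 where "\<And>A x. A0 \<le> A \<Longrightarrow>
    nconv (tail_part h A) (tail_part h A) x \<le> ennreal \<delta> * tail_part h A x"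
proof -
  obtain A where A: "\<And>A' x. A \<le> A' \<Longrightarrow> nconv (tail_part h A') (tail_part h A') x \<le> ennreal (\<delta> * h x)"
    using assms unfolding small_middle_def by blast
  show thesis
  proof (rule that[of "max 0 A"])
    fix A' x assume A': "max 0 A \<le> A'"
    show "nconv (tail_part h A') (tail_part h A') x \<le> ennreal \<delta> * tail_part h A' x"
    proof (cases "x \<le> A'")
      case True then show ?thesis using A' by (simp add: nconv_tail_part_eq_0)
    next
      case False then show ?thesis using A[of A' x] A' assms(2,3)
        by (simp add: tail_part_def[of h _ x] ennreal_mult[symmetric])
    qed
  qed
qed

lemma small_middle_transfer:
  assumes h: "small_middle h" and [measurable]: "h \<in> borel_measurable borel"
    and kh: "0 \<le> C" "0 < D" "\<And>x. 0 \<le> h x"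
      "eventually (\<lambda>x. k x \<le> C * h x) at_top" "eventually (\<lambda>x. h x \<le> D * k x) at_top"
  shows "small_middle k"
proof (rule small_middleI)
  fix \<epsilon> :: real assume "0 < \<epsilon>"
  define \<delta> where "\<delta> = \<epsilon> / (C^2 * D + 1)"
  have "0 < C^2 * D + 1" using kh(1,2) by (intro add_nonneg_pos) auto
  then have "0 < \<delta>" and \<delta>: "C^2 * D * \<delta> \<le> \<epsilon>"
    using \<open>0 < \<epsilon>\<close> by (auto simp: \<delta>_def field_simps)
  obtain A where A: "\<And>A' x. A \<le> A' \<Longrightarrow> nconv (tail_part h A') (tail_part h A') x \<le> ennreal (\<delta> * h x)"
    using h \<open>0 < \<delta>\<close> unfolding small_middle_def by blast
  obtain b where b: "\<And>x. b \<le> x \<Longrightarrow> k x \<le> C * h x" using kh(4) by (auto simp: eventually_at_top_linorder)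
  define A' where "A' = max A b"
  have le: "tail_part k A' x \<le> ennreal C * tail_part h A' x" for x
    using b[of x] kh(1,3) by (auto simp: tail_part_def A'_def ennreal_mult[symmetric] intro!: ennreal_leI)
  show "\<exists>A. eventually (\<lambda>x. nconv (tail_part k A) (tail_part k A) x \<le> ennreal (\<epsilon> * k x)) at_top"
    using kh(5)
  proof (intro exI[of _ A'], elim eventually_mono)
    fix x assume x: "h x \<le> D * k x"
    have "nconv (tail_part k A') (tail_part k A') x
        \<le> nconv (\<lambda>x. ennreal C * tail_part h A' x) (\<lambda>x. ennreal C * tail_part h A' x) x"
      by (intro nconv_mono le)
    also have "\<dots> = ennreal C * (ennreal C * nconv (tail_part h A') (tail_part h A') x)"
      by (simp add: nconv_cmult_left nconv_cmult_right)
    also have "\<dots> \<le> ennreal C * (ennreal C * ennreal (\<delta> * h x))"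
      by (intro mult_left_mono A) (auto simp: A'_def)
    also have "\<dots> = ennreal (C * (C * (\<delta> * h x)))"
      using kh(1) \<open>0 < \<delta>\<close> kh(3)[of x] by (simp add: ennreal_mult)
    also have "\<dots> \<le> ennreal (\<epsilon> * k x)"
    proof (rule ennreal_leI)
      have "C * (C * (\<delta> * h x)) \<le> C * (C * (\<delta> * (D * k x)))"
        using x kh(1) \<open>0 < \<delta>\<close> by (intro mult_left_mono) auto
      also have "\<dots> = (C^2 * D * \<delta>) * k x" by (simp add: power2_eq_square)
      also have "\<dots> \<le> \<epsilon> * k x"
      proof (rule mult_right_mono[OF \<delta>])
        have "0 \<le> D * k x" using kh(3) x by (rule order_trans)
        then show "0 \<le> k x" using kh(2) by (simp add: zero_le_mult_iff)
      qed
      finally show "C * (C * (\<delta> * h x)) \<le> \<epsilon> * k x" .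
    qed
    finally show "nconv (tail_part k A') (tail_part k A') x \<le> ennreal (\<epsilon> * k x)" .
  qed
qed

text \<open>Iterating the hypothesis on \<open>k\<close> bounds the terms of order at least 2 by \<open>C\<^sup>2 \<epsilon> r * k\<close>, up to the
  coefficients \<open>1 / n!\<close>; the condition \<open>C * \<epsilon> \<le> 1\<close> keeps the powers of \<open>C * \<epsilon>\<close> bounded.\<close>

lemma nexp_remainder:
  fixes r t k :: "real \<Rightarrow> ennreal"
  assumes [measurable]: "r \<in> borel_measurable borel" "t \<in> borel_measurable borel" "k \<in> borel_measurable borel"
    and t: "\<And>x. t x \<le> ennreal C * k x" and k: "\<And>x. nconv k k x \<le> ennreal \<epsilon> * k x"
    and c: "0 \<le> C" "0 \<le> \<epsilon>" "C * \<epsilon> \<le> 1"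
  shows "nexp t r x \<le> r x + nconv r t x + ennreal (exp 1 * C^2 * \<epsilon>) * nconv r k x"
proof -
  have mono: "nconv w t x \<le> ennreal C * nconv w k x" if [measurable]: "w \<in> borel_measurable borel" for w x
    using nconv_mono[of w w t "\<lambda>x. ennreal C * k x" x] t by (simp add: nconv_cmult_right)
  have step: "nconv (nconv r k) t x \<le> ennreal (C * \<epsilon>) * nconv r k x" for x
  proof -
    have "nconv (nconv r k) t x \<le> ennreal C * nconv r (nconv k k) x"
      using mono[of "nconv r k"] by (simp add: nconv_assoc)
    also have "\<dots> \<le> ennreal C * nconv r (\<lambda>x. ennreal \<epsilon> * k x) x"
      by (intro mult_left_mono nconv_mono k) auto
    finally show ?thesis using c by (simp add: nconv_cmult_right ennreal_mult mult.assoc)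
  qed
  have p: "cpow t (Suc (Suc n)) r x \<le> ennreal (C^2 * \<epsilon>) * nconv r k x" for n x
  proof (induction n arbitrary: x)
    case 0
    have "cpow t (Suc (Suc 0)) r x \<le> nconv (\<lambda>x. ennreal C * nconv r k x) t x"
      using mono[of r] by (auto intro!: nconv_mono)
    also have "\<dots> = ennreal C * nconv (nconv r k) t x" by (simp add: nconv_cmult_left)
    also have "\<dots> \<le> ennreal C * (ennreal (C * \<epsilon>) * nconv r k x)"
      by (intro mult_left_mono step) auto
    finally show ?case using c by (simp add: ennreal_mult[symmetric] mult.assoc[symmetric] power2_eq_square)
  next
    case (Suc n)
    have "cpow t (Suc (Suc (Suc n))) r x \<le> nconv (\<lambda>x. ennreal (C^2 * \<epsilon>) * nconv r k x) t x"
      using Suc by (simp only: cpow.simps(2)[of t "Suc (Suc n)"]) (auto intro!: nconv_mono)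
    also have "\<dots> = ennreal (C^2 * \<epsilon>) * nconv (nconv r k) t x" by (simp add: nconv_cmult_left)
    also have "\<dots> \<le> ennreal (C^2 * \<epsilon>) * (1 * nconv r k x)"
      by (intro mult_left_mono order_trans[OF step] mult_right_mono) (use c in auto)
    finally show ?case by simp
  qed
  have "nexp t r x = (\<Sum>n. ennreal (1 / fact (n + 2)) * cpow t (n + 2) r x)
      + (\<Sum>n<2. ennreal (1 / fact n) * cpow t n r x)"
    unfolding nexp_def by (rule suminf_offset) auto
  also have "(\<Sum>n<2. ennreal (1 / fact n) * cpow t n r x) = r x + nconv r t x"
    by (simp add: numeral_2_eq_2)
  finally have eq: "nexp t r x = (\<Sum>n. ennreal (1 / fact (n + 2)) * cpow t (n + 2) r x) + (r x + nconv r t x)" .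
  have "(\<Sum>n. ennreal (1 / fact (n + 2)) * cpow t (n + 2) r x)
      \<le> (\<Sum>n. ennreal (1 / fact n) * ennreal 1 ^ n * (ennreal (C^2 * \<epsilon>) * nconv r k x))"
  proof (intro suminf_le mult_mono)
    fix n
    show "ennreal (1 / fact (n + 2)) \<le> ennreal (1 / fact n) * ennreal 1 ^ n"
    proof -
      have "1 / fact (n + 2) \<le> (1 / fact n :: real)"
        by (rule frac_le) (simp_all del: fact_Suc add: fact_mono)
      from ennreal_leI[OF this] show ?thesis by (simp only: ennreal_1 power_one mult_1_right)
    qed
    show "cpow t (n + 2) r x \<le> ennreal (C^2 * \<epsilon>) * nconv r k x" using p[of n x] by simp
  qed auto
  also have "\<dots> = ennreal (exp 1) * (ennreal (C^2 * \<epsilon>) * nconv r k x)"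
    using suminf_exp_ennreal[of 1] by (simp only: ennreal_suminf_multc)
  also have "\<dots> = ennreal (exp 1 * C^2 * \<epsilon>) * nconv r k x"
    using c by (simp only: mult.assoc[symmetric] ennreal_mult'[symmetric] exp_ge_zero)
  finally show ?thesis
    unfolding eq by (subst add.commute) (rule add_left_mono)
qed

lemma nexp_ge_second_order:
  "nconv r t x + ennreal (1/2) * nconv (nconv r t) t x \<le> nexp t r x"
proof -
  have "(\<Sum>n<3. ennreal (1 / fact n) * cpow t n r x) \<le> nexp t r x"
    unfolding nexp_def by (rule sum_le_suminf) auto
  moreover have "(\<Sum>n<3. ennreal (1 / fact n) * cpow t n r x)
      = r x + (nconv r t x + ennreal (1/2) * nconv (nconv r t) t x)"
    by (simp add: numeral_3_eq_3 add.assoc)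
  ultimately show ?thesis
    using order_trans[OF add_increasing[OF zero_le order_refl]] by auto
qed

lemma nn_integral_outside:
  fixes u :: "real \<Rightarrow> ennreal"
  assumes [measurable]: "u \<in> borel_measurable borel" and u: "(\<integral>\<^sup>+x. u x \<partial>lborel) < \<infinity>" and "0 < \<epsilon>"
  obtains B where "0 < B" "\<And>B'. B \<le> B' \<Longrightarrow> (\<integral>\<^sup>+x. u x * indicator {x. B' < \<bar>x\<bar>} x \<partial>lborel) < \<epsilon>"
proof -
  define M where "M = density lborel u"
  have [measurable_cong, simp]: "sets M = sets borel" by (simp add: M_def)
  have sM: "space M = UNIV" by (simp add: M_def)
  have eM: "emeasure M UNIV < \<infinity>" using u by (simp add: M_def emeasure_density)
  interpret M: finite_measure M by standard (use eM in \<open>simp add: sM\<close>)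
  have I: "(\<integral>\<^sup>+x. u x * indicator {x. B < \<bar>x\<bar>} x \<partial>lborel) = emeasure M {x. B < \<bar>x\<bar>}" for B
    by (simp add: M_def emeasure_density)
  have "(\<lambda>n. emeasure M {x. real n < \<bar>x\<bar>}) \<longlonglongrightarrow> emeasure M (\<Inter>n. {x. real n < \<bar>x\<bar>})"
    by (rule Lim_emeasure_decseq) (auto simp: decseq_def)
  also have "(\<Inter>n. {x::real. real n < \<bar>x\<bar>}) = {}"
  proof -
    have "\<exists>n. \<not> real n < \<bar>x\<bar>" for x using reals_Archimedean2[of "\<bar>x\<bar>"] by (meson less_asym)
    then show ?thesis by blast
  qed
  finally have "(\<lambda>n. emeasure M {x. real n < \<bar>x\<bar>}) \<longlonglongrightarrow> 0" by simp
  then have "eventually (\<lambda>n. emeasure M {x. real n < \<bar>x\<bar>} < \<epsilon>) sequentially"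
    using \<open>0 < \<epsilon>\<close> by (rule order_tendstoD)
  then obtain n where n: "emeasure M {x. real n < \<bar>x\<bar>} < \<epsilon>" by (auto simp: eventually_sequentially)
  show thesis
  proof (rule that[of "real n + 1"])
    fix B' assume "real n + 1 \<le> B'"
    then have "emeasure M {x. B' < \<bar>x\<bar>} \<le> emeasure M {x. real n < \<bar>x\<bar>}"
      by (intro emeasure_mono) auto
    with n show "(\<integral>\<^sup>+x. u x * indicator {x. B' < \<bar>x\<bar>} x \<partial>lborel) < \<epsilon>" by (simp add: I)
  qed auto
qed

lemma nn_integral_inside_ge:
  fixes u :: "real \<Rightarrow> ennreal"
  assumes [measurable]: "u \<in> borel_measurable borel" and u: "(\<integral>\<^sup>+x. u x \<partial>lborel) = ennreal m" "q < m" "0 \<le> m"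
  obtains B where "0 < B" "ennreal q \<le> (\<integral>\<^sup>+x. u x * indicator {x. \<bar>x\<bar> \<le> B} x \<partial>lborel)"
proof -
  obtain B where B: "0 < B" "(\<integral>\<^sup>+x. u x * indicator {x. B < \<bar>x\<bar>} x \<partial>lborel) < ennreal (m - q)"
    using nn_integral_outside[of u "ennreal (m - q)"] u by (auto simp: ennreal_less_top)
  have "ennreal m = (\<integral>\<^sup>+x. u x * indicator {x. \<bar>x\<bar> \<le> B} x + u x * indicator {x. B < \<bar>x\<bar>} x \<partial>lborel)"
    unfolding u(1)[symmetric] by (intro nn_integral_cong) (auto simp: indicator_def)
  also have "\<dots> = (\<integral>\<^sup>+x. u x * indicator {x. \<bar>x\<bar> \<le> B} x \<partial>lborel) + (\<integral>\<^sup>+x. u x * indicator {x. B < \<bar>x\<bar>} x \<partial>lborel)"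
    by (intro nn_integral_add) measurable
  also have "\<dots> \<le> (\<integral>\<^sup>+x. u x * indicator {x. \<bar>x\<bar> \<le> B} x \<partial>lborel) + ennreal (m - q)"
    using B by (intro add_left_mono) auto
  finally have le: "ennreal m \<le> (\<integral>\<^sup>+x. u x * indicator {x. \<bar>x\<bar> \<le> B} x \<partial>lborel) + ennreal (m - q)" .
  have "ennreal q \<le> (\<integral>\<^sup>+x. u x * indicator {x. \<bar>x\<bar> \<le> B} x \<partial>lborel)"
  proof (cases "0 \<le> q")
    case True
    then have "ennreal (m - q) + ennreal q = ennreal m" using u by (subst ennreal_plus[symmetric]) auto
    then have "ennreal (m - q) + ennreal q
        \<le> ennreal (m - q) + (\<integral>\<^sup>+x. u x * indicator {x. \<bar>x\<bar> \<le> B} x \<partial>lborel)"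
      using le by (metis add.commute)
    then show ?thesis unfolding ennreal_add_left_cancel_le by simp
  qed (simp add: ennreal_neg)
  with B(1) show thesis by (rule that)
qed

lemma tendsto_ratio_1I:
  fixes f g :: "real \<Rightarrow> real"
  assumes pos: "eventually (\<lambda>x. 0 < g x) at_top"
    and le: "\<And>\<epsilon>. 0 < \<epsilon> \<Longrightarrow> \<epsilon> < 1 \<Longrightarrow> eventually (\<lambda>x. (1 - \<epsilon>) * g x \<le> f x) at_top"
      "\<And>\<epsilon>. 0 < \<epsilon> \<Longrightarrow> \<epsilon> < 1 \<Longrightarrow> eventually (\<lambda>x. f x \<le> (1 + \<epsilon>) * g x) at_top"
  shows "((\<lambda>x. f x / g x) \<longlongrightarrow> 1) at_top"
proof (rule tendstoI)
  fix e :: real assume "0 < e"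
  define \<epsilon> where "\<epsilon> = min (e / 2) (1 / 2)"
  have \<epsilon>: "0 < \<epsilon>" "\<epsilon> < 1" "\<epsilon> < e" using \<open>0 < e\<close> by (auto simp: \<epsilon>_def)
  show "eventually (\<lambda>x. dist (f x / g x) 1 < e) at_top"
    using pos le(1)[OF \<epsilon>(1,2)] le(2)[OF \<epsilon>(1,2)]
  proof eventually_elim
    case (elim x)
    then have "1 - \<epsilon> \<le> f x / g x" "f x / g x \<le> 1 + \<epsilon>"
      by (auto simp: pos_le_divide_eq pos_divide_le_eq)
    then show ?case using \<epsilon> by (auto simp: dist_real_def)
  qed
qed

lemma ratio_bounds:
  fixes f g :: "real \<Rightarrow> real"
  assumes lim: "((\<lambda>x. f x / g x) \<longlongrightarrow> c) at_top" and pos: "eventually (\<lambda>x. 0 < g x) at_top"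
  shows "q < c \<Longrightarrow> eventually (\<lambda>x. q * g x \<le> f x) at_top"
    and "c < q \<Longrightarrow> eventually (\<lambda>x. f x \<le> q * g x) at_top"
proof -
  show "eventually (\<lambda>x. q * g x \<le> f x) at_top" if "q < c"
    using order_tendstoD(1)[OF lim that] pos
    by eventually_elim (auto simp: pos_less_divide_eq)
  show "eventually (\<lambda>x. f x \<le> q * g x) at_top" if "c < q"
    using order_tendstoD(2)[OF lim that] pos
    by eventually_elim (auto simp: pos_divide_less_eq)
qed

lemma regular_tail_pos: "regular_tail h \<Longrightarrow> eventually (\<lambda>x. 0 < h x) at_top"
  by (auto simp: regular_tail_def eventually_at_top_linorder)

lemma eventually_at_top_shift:
  "eventually P at_top \<Longrightarrow> eventually (\<lambda>x::real. P (x + y)) at_top"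
  using filterlim_add_const[of y] by (auto simp: filterlim_iff)

lemma asymp_shiftI:
  fixes k :: "real \<Rightarrow> real"
  assumes "((\<lambda>x. k (x + y) / k x) \<longlongrightarrow> 1) at_top" "eventually (\<lambda>x. 0 < k x) at_top"
  shows "(\<lambda>x. k (x + y)) \<sim>[at_top] k"
  by (rule asymp_equivI') (use assms in auto)

lemma regular_tail_transfer:
  assumes h: "regular_tail h" and lim: "((\<lambda>x. k x / h x) \<longlongrightarrow> c) at_top" and "0 < c"
    and k: "k \<in> borel_measurable borel" "\<And>x. 0 \<le> k x"
  shows "regular_tail k"
proof -
  note hpos = regular_tail_pos[OF h]
  note b = ratio_bounds[OF lim hpos]
  have kpos: "eventually (\<lambda>x. 0 < k x) at_top"
  proof -
    have "eventually (\<lambda>x. c / 2 * h x \<le> k x) at_top" using \<open>0 < c\<close> by (intro b(1)) auto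
    with hpos show ?thesis
    proof eventually_elim
      case (elim x)
      then have "0 < c / 2 * h x" using \<open>0 < c\<close> by simp
      with elim show ?case by linarith
    qed
  qed
  have sh: "((\<lambda>x. k (x + y) / k x) \<longlongrightarrow> 1) at_top" for y
  proof -
    have "((\<lambda>x. (k (x + y) / h (x + y)) * (h (x + y) / h x) / (k x / h x)) \<longlongrightarrow> c * 1 / c) at_top"
      using \<open>0 < c\<close> by (intro tendsto_intros lim regular_tail_shift[OF h]
        filterlim_compose[OF lim filterlim_add_const]) auto
    moreover have "eventually (\<lambda>x. (k (x + y) / h (x + y)) * (h (x + y) / h x) / (k x / h x) = k (x + y) / k x) at_top"
      using hpos eventually_at_top_shift[OF hpos, of y] by eventually_elim auto
    ultimately have "((\<lambda>x. k (x + y) / k x) \<longlongrightarrow> c * 1 / c) at_top"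
      by (rule Lim_transform_eventually)
    then show ?thesis using \<open>0 < c\<close> by simp
  qed
  obtain a K where K: "\<And>x y. a \<le> x \<Longrightarrow> 0 \<le> y \<Longrightarrow> h (x + y) \<le> K * h x" 
    using h unfolding regular_tail_def by blast
  obtain a1 where a1: "\<And>x. a1 \<le> x \<Longrightarrow> k x \<le> 2 * c * h x" "\<And>x. a1 \<le> x \<Longrightarrow> c / 2 * h x \<le> k x" "\<And>x. a1 \<le> x \<Longrightarrow> 0 < h x"
    using eventually_conj[OF b(2)[of "2 * c"] eventually_conj[OF b(1)[of "c / 2"] hpos]] \<open>0 < c\<close>
    by (auto simp: eventually_at_top_linorder)
  have "k (x + y) \<le> (4 * K) * k x" if "max a a1 \<le> x" "0 \<le> y" for x y
  proof -
    have "0 \<le> K * h x" using K[of x y] a1(3)[of "x + y"] that by auto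
    then have K0: "0 \<le> K" using a1(3)[of x] that by (auto simp: zero_le_mult_iff)
    have "k (x + y) \<le> 2 * c * h (x + y)" using a1 that by auto
    also have "\<dots> \<le> 2 * c * (K * h x)" using K that \<open>0 < c\<close> by auto
    also have "\<dots> = 4 * K * (c / 2 * h x)" by simp
    also have "\<dots> \<le> 4 * K * k x" using a1(2)[of x] that K0 by (intro mult_left_mono) auto
    finally show ?thesis .
  qed
  then have "\<exists>a K. \<forall>x\<ge>a. \<forall>y\<ge>0. k (x + y) \<le> K * k x" by blast
  moreover have "\<exists>a. \<forall>x\<ge>a. 0 < k x" using kpos by (simp add: eventually_at_top_linorder)
  moreover have "(\<lambda>x. k (x + y)) \<sim>[at_top] k" for y by (rule asymp_shiftI[OF sh kpos])
  ultimately show ?thesis using k by (simp add: regular_tail_def)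
qed

section \<open>Asymptotics of the convolution exponential\<close>

lemma light_tail_finite:
  assumes "light_tail \<gamma> u"
  shows "eventually (\<lambda>x. u x < \<infinity>) at_top" "(\<integral>\<^sup>+x. u x * ennreal (exp (\<gamma> * x)) \<partial>lborel) < \<infinity>"
proof -
  obtain a W where W: "W < \<infinity>" "(\<integral>\<^sup>+x. u x * ennreal (exp (\<gamma> * x)) \<partial>lborel) \<le> W"
    "\<And>x. a \<le> x \<Longrightarrow> u x * ennreal (exp (\<gamma> * x)) \<le> W" using assms unfolding light_tail_def by blast
  have "u x < \<infinity>" if "a \<le> x" for x
  proof (rule ccontr)
    assume "\<not> u x < \<infinity>"
    then have "u x = top" by (simp add: less_top[symmetric])
    then have "u x * ennreal (exp (\<gamma> * x)) = \<infinity>" by (simp add: ennreal_top_mult)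
    then show False using W(1) W(3)[OF that] by auto
  qed
  then show "eventually (\<lambda>x. u x < \<infinity>) at_top" by (auto simp: eventually_at_top_linorder)
  show "(\<integral>\<^sup>+x. u x * ennreal (exp (\<gamma> * x)) \<partial>lborel) < \<infinity>" using W(1,2) by (rule le_less_trans[rotated])
qed

lemma ennreal_le_cancel_middle:
  assumes "ennreal a \<le> P" "P + X \<le> ennreal b" "0 \<le> a" "a \<le> b"
  shows "X \<le> ennreal (b - a)"
proof -
  have "ennreal a + X \<le> P + X" using assms(1) by (rule add_right_mono)
  also have "\<dots> \<le> ennreal b" by fact
  also have "ennreal b = ennreal a + ennreal (b - a)"
    using assms(3,4) by (subst ennreal_plus[symmetric]) auto
  finally show ?thesis by (simp add: ennreal_add_left_cancel_le)
qed

text \<open>Here \<open>f\<close> is the version of the density whose asymptotics are studied. It is \<open>F\<close>, which is finite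
  almost everywhere and on a neighbourhood of \<open>\<infinity>\<close>, with the value \<open>\<infinity>\<close> replaced by 0.\<close>

locale perturbed_exponential =
  fixes g :: "real \<Rightarrow> real" and u :: "real \<Rightarrow> ennreal" and \<gamma> lam :: real
    and v F :: "real \<Rightarrow> ennreal" and f :: "real \<Rightarrow> real"
  defines "v \<equiv> (\<lambda>y. if 1 < \<bar>y\<bar> then ennreal (g y) else 0)"
    and "F \<equiv> nexp v u"
    and "f \<equiv> (\<lambda>x. enn2real (F x))"
  assumes g_meas [measurable]: "g \<in> borel_measurable borel" and g_nonneg: "\<And>x. 0 \<le> g x"
    and g_bdd: "\<exists>b. \<forall>x>1. g x \<le> b"
    and lam: "0 \<le> lam" "(\<integral>\<^sup>+y. v y \<partial>lborel) = ennreal lam"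
    and gam: "0 < \<gamma>" and u_light: "light_tail \<gamma> u"
    and u_mass: "(\<integral>\<^sup>+x. u x \<partial>lborel) = ennreal (exp (- lam))"
begin

lemma v_meas [measurable]: "v \<in> borel_measurable borel"
  unfolding v_def by (intro measurable_If) auto

lemma u_meas [measurable]: "u \<in> borel_measurable borel"
  using u_light by (rule light_tail_measurable)

lemma F_meas [measurable]: "F \<in> borel_measurable borel"
  unfolding F_def by measurable

lemma f_meas [measurable]: "f \<in> borel_measurable borel"
  unfolding f_def by measurable

lemma f_nonneg: "0 \<le> f x"
  by (simp add: f_def)

lemma F_mass: "(\<integral>\<^sup>+x. F x \<partial>lborel) = 1"
  using lam by (simp add: F_def nn_integral_nexp[OF _ _ lam(2,1)] u_mass ennreal_mult[symmetric] exp_add[symmetric])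

text \<open>Jumps up to \<open>A\<close> are absorbed into the factor \<open>r\<close>, which keeps an exponentially small right tail
  since \<open>g\<close> is bounded on \<open>(1, A]\<close>.\<close>

lemma split_at:
  assumes "1 \<le> A"
  obtains r m where "light_tail \<gamma> r" "F = nexp (tail_part g A) r" "\<And>x. u x \<le> r x"
    "(\<integral>\<^sup>+x. r x \<partial>lborel) = ennreal m" "m = exp (- enn2real (\<integral>\<^sup>+x. tail_part g A x \<partial>lborel))"
proof -
  define s where "s y = (if 1 < \<bar>y\<bar> \<and> y \<le> A then ennreal (g y) else 0)" for y
  have [measurable]: "s \<in> borel_measurable borel"
    unfolding s_def[abs_def] by (intro measurable_If) auto
  have v: "v = (\<lambda>y. s y + tail_part g A y)"
    using assms by (auto simp: v_def s_def tail_part_def)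
  have I: "ennreal lam = (\<integral>\<^sup>+y. s y \<partial>lborel) + (\<integral>\<^sup>+y. tail_part g A y \<partial>lborel)"
    unfolding lam(2)[symmetric] v by (rule nn_integral_add) measurable
  have fin: "(\<integral>\<^sup>+y. s y \<partial>lborel) < top" "(\<integral>\<^sup>+y. tail_part g A y \<partial>lborel) < top"
    using I by (metis ennreal_add_eq_top ennreal_neq_top less_top)+
  define ls where "ls = enn2real (\<integral>\<^sup>+y. s y \<partial>lborel)"
  define lt where "lt = enn2real (\<integral>\<^sup>+y. tail_part g A y \<partial>lborel)"
  have ls: "(\<integral>\<^sup>+y. s y \<partial>lborel) = ennreal ls" "0 \<le> ls" using fin by (auto simp: ls_def)
  have lt: "(\<integral>\<^sup>+y. tail_part g A y \<partial>lborel) = ennreal lt" "0 \<le> lt" using fin by (auto simp: lt_def)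
  have sum: "lam = ls + lt" using I lam(1) ls lt by (simp add: ennreal_plus[symmetric] del: ennreal_plus)
  obtain b where b: "\<And>x. 1 < x \<Longrightarrow> g x \<le> b" using g_bdd by auto
  define r where "r = nexp s u"
  define E where "E = exp (\<gamma> * A)"
  have "light_tail \<gamma> r"
    unfolding r_def
  proof (rule light_tail_nexp[OF u_light, where L="ennreal (max b ls * E)"])
    have e: "s x * ennreal (exp (\<gamma> * x)) \<le> s x * ennreal E" for x
      using gam by (cases "x \<le> A") (auto simp: s_def E_def intro!: mult_left_mono ennreal_leI)
    have "(\<integral>\<^sup>+x. s x * ennreal (exp (\<gamma> * x)) \<partial>lborel) \<le> (\<integral>\<^sup>+x. s x * ennreal E \<partial>lborel)"
      by (intro nn_integral_mono e)
    also have "\<dots> = ennreal (ls * E)"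
      using ls by (simp add: nn_integral_multc E_def ennreal_mult)
    also have "\<dots> \<le> ennreal (max b ls * E)"
      by (intro ennreal_leI mult_right_mono) (auto simp: E_def)
    finally show "(\<integral>\<^sup>+x. s x * ennreal (exp (\<gamma> * x)) \<partial>lborel) \<le> ennreal (max b ls * E)" .
    show "s x * ennreal (exp (\<gamma> * x)) \<le> ennreal (max b ls * E)" if "0 < x" for x
    proof -
      have "s x \<le> ennreal (max b ls)" using b[of x] that by (auto simp: s_def intro!: ennreal_leI)
      then have "s x * ennreal E \<le> ennreal (max b ls) * ennreal E" by (rule mult_right_mono) simp
      also have "\<dots> = ennreal (max b ls * E)" using ls(2) by (intro ennreal_mult[symmetric]) (auto simp: E_def)
      finally show ?thesis using e[of x] by simp
    qed
  qed (use fin in auto)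
  moreover have "F = nexp (tail_part g A) r" unfolding F_def v r_def by (rule nexp_add) measurable
  moreover have "u x \<le> r x" for x unfolding r_def by (rule nexp_ge)
  moreover have "(\<integral>\<^sup>+x. r x \<partial>lborel) = ennreal (exp (- lt))"
    unfolding r_def by (subst nn_integral_nexp[OF _ _ ls])
      (auto simp: u_mass sum ennreal_mult[symmetric] exp_add[symmetric])
  ultimately show thesis by (intro that[of r "exp (- lt)"]) (auto simp: lt_def)
qed

lemma tail_mass_small:
  assumes "0 < \<epsilon>"
  obtains A0 where "\<And>A. A0 \<le> A \<Longrightarrow> 1 \<le> A" "\<And>A. A0 \<le> A \<Longrightarrow> 1 - \<epsilon> < exp (- enn2real (\<integral>\<^sup>+x. tail_part g A x \<partial>lborel))"
proof -
  obtain B where B: "0 < B" "\<And>B'. B \<le> B' \<Longrightarrow> (\<integral>\<^sup>+x. v x * indicator {x. B' < \<bar>x\<bar>} x \<partial>lborel) < ennreal \<epsilon>"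
    using nn_integral_outside[OF v_meas, of "ennreal \<epsilon>"] lam(2) assms by (auto simp: ennreal_less_top)
  show thesis
  proof (rule that[of "max 1 B"])
    fix A assume A: "max 1 B \<le> A"
    have "(\<integral>\<^sup>+x. tail_part g A x \<partial>lborel) \<le> (\<integral>\<^sup>+x. v x * indicator {x. A < \<bar>x\<bar>} x \<partial>lborel)"
      using A by (intro nn_integral_mono) (auto simp: tail_part_def v_def indicator_def)
    also have "\<dots> < ennreal \<epsilon>" using B(2) A by auto
    finally have "enn2real (\<integral>\<^sup>+x. tail_part g A x \<partial>lborel) < \<epsilon>"
      by (cases "\<integral>\<^sup>+x. tail_part g A x \<partial>lborel" rule: ennreal_cases) (auto simp: ennreal_less_iff)
    then show "1 - \<epsilon> < exp (- enn2real (\<integral>\<^sup>+x. tail_part g A x \<partial>lborel))"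
      using exp_ge_add_one_self[of "- enn2real (\<integral>\<^sup>+x. tail_part g A x \<partial>lborel)"] by linarith
  qed auto
qed

text \<open>\<open>split_at\<close> for all large \<open>A\<close>, with the mass of \<open>r\<close> as close to 1 as desired.\<close>

lemma cutoff:
  assumes "0 < \<epsilon>"
  obtains A0 where "\<And>A. A0 \<le> A \<Longrightarrow> 1 \<le> A \<and> (\<exists>r m. light_tail \<gamma> r \<and> F = nexp (tail_part g A) r \<and> (\<forall>x. u x \<le> r x) \<and>
    (\<integral>\<^sup>+x. r x \<partial>lborel) = ennreal m \<and> 0 \<le> m \<and> 1 - \<epsilon> < m \<and> m \<le> 1)"
proof -
  obtain A0 where A0: "\<And>A. A0 \<le> A \<Longrightarrow> 1 \<le> A"
    "\<And>A. A0 \<le> A \<Longrightarrow> 1 - \<epsilon> < exp (- enn2real (\<integral>\<^sup>+x. tail_part g A x \<partial>lborel))"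
    using tail_mass_small[OF assms] by blast
  show thesis
  proof (rule that[of A0])
    fix A assume A: "A0 \<le> A"
    obtain r m where "light_tail \<gamma> r" "F = nexp (tail_part g A) r" "\<And>x. u x \<le> r x"
      "(\<integral>\<^sup>+x. r x \<partial>lborel) = ennreal m" "m = exp (- enn2real (\<integral>\<^sup>+x. tail_part g A x \<partial>lborel))"
      using split_at[OF A0(1)[OF A]] by blast
    then show "1 \<le> A \<and> (\<exists>r m. light_tail \<gamma> r \<and> F = nexp (tail_part g A) r \<and> (\<forall>x. u x \<le> r x) \<and>
      (\<integral>\<^sup>+x. r x \<partial>lborel) = ennreal m \<and> 0 \<le> m \<and> 1 - \<epsilon> < m \<and> m \<le> 1)"
      using A0[OF A] by (intro conjI exI[of _ r] exI[of _ m]) simp_all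
  qed
qed

text \<open>Boundedness of \<open>g\<close> on \<open>(1, \<infinity>)\<close> bounds the sum of all terms of the series except \<open>r\<close>.\<close>

lemma F_eq_f: "eventually (\<lambda>x. F x = ennreal (f x)) at_top"
proof -
  obtain r m where r: "light_tail \<gamma> r" "F = nexp (tail_part g 1) r"
    "(\<integral>\<^sup>+x. r x \<partial>lborel) = ennreal m"
    using split_at[of 1] by (metis order_refl)
  note [measurable] = light_tail_measurable[OF r(1)]
  obtain b where b: "\<And>x. 1 < x \<Longrightarrow> g x \<le> b" using g_bdd by auto
  define t where "t = tail_part g 1"
  have [measurable]: "t \<in> borel_measurable borel" by (simp add: t_def)
  have "(\<integral>\<^sup>+x. t x \<partial>lborel) \<le> (\<integral>\<^sup>+x. v x \<partial>lborel)"
    by (intro nn_integral_mono) (auto simp: t_def tail_part_def v_def)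
  then obtain l where l: "(\<integral>\<^sup>+x. t x \<partial>lborel) = ennreal l" "0 \<le> l"
    using lam(2) by (cases "\<integral>\<^sup>+x. t x \<partial>lborel" rule: ennreal_cases) (auto simp: top_unique)
  have one: "nconv w t x \<le> ennreal b * (\<integral>\<^sup>+x. w x \<partial>lborel)" if [measurable]: "w \<in> borel_measurable borel" for w x
  proof -
    have "nconv w t x \<le> (\<integral>\<^sup>+y. ennreal b * w (x - y) \<partial>lborel)"
      unfolding nconv_def using b
      by (intro nn_integral_mono) (auto simp: t_def tail_part_def mult.commute intro!: mult_right_mono ennreal_leI)
    also have "\<dots> = ennreal b * (\<integral>\<^sup>+x. w x \<partial>lborel)"
      by (simp add: nn_integral_cmult nn_integral_reflect)
    finally show ?thesis .
  qed
  have "F x \<le> r x + ennreal (exp l) * (ennreal b * ennreal m)" for x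
  proof -
    have "F x = (\<Sum>n. ennreal (1 / fact (n + 1)) * cpow t (n + 1) r x)
        + (\<Sum>n<1. ennreal (1 / fact n) * cpow t n r x)"
      unfolding r(2) nexp_def t_def by (rule suminf_offset) auto
    also have "(\<Sum>n<1. ennreal (1 / fact n) * cpow t n r x) = r x" by simp
    also have "(\<Sum>n. ennreal (1 / fact (n + 1)) * cpow t (n + 1) r x)
        \<le> (\<Sum>n. ennreal (1 / fact n) * ennreal l ^ n * (ennreal b * ennreal m))"
    proof (rule suminf_le)
      fix n
      have "1 / fact (n + 1) \<le> (1 / fact n :: real)"
        by (rule frac_le) (simp_all del: fact_Suc add: fact_mono)
      then have 1: "ennreal (1 / fact (n + 1)) \<le> ennreal (1 / fact n)" by (rule ennreal_leI)
      have 2: "cpow t (n + 1) r x \<le> ennreal b * (ennreal l ^ n * ennreal m)"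
        using one[of "cpow t n r" x] by (simp add: nn_integral_cpow l r(3))
      have "ennreal (1 / fact (n + 1)) * cpow t (n + 1) r x
          \<le> ennreal (1 / fact n) * (ennreal b * (ennreal l ^ n * ennreal m))"
        by (rule mult_mono[OF 1 2]) auto
      then show "ennreal (1 / fact (n + 1)) * cpow t (n + 1) r x
          \<le> ennreal (1 / fact n) * ennreal l ^ n * (ennreal b * ennreal m)"
        by (simp only: mult_ac)
    qed auto
    also have "\<dots> = ennreal (exp l) * (ennreal b * ennreal m)"
      using suminf_exp_ennreal[OF l(2)] by (simp only: ennreal_suminf_multc)
    finally show ?thesis by (simp only: add.commute add_right_mono)
  qed
  moreover have "ennreal (exp l) * (ennreal b * ennreal m) < top" by (simp add: ennreal_mult_less_top)
  ultimately have fin: "F x < top" if "r x < top" for x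
    using that by (metis ennreal_add_less_top le_less_trans)
  show ?thesis using light_tail_finite(1)[OF r(1)]
    by eventually_elim (use fin in \<open>simp add: f_def\<close>)
qed

lemma density_asymp_if_subexponential:
  assumes g: "regular_tail g" "small_middle g"
  shows "((\<lambda>x. f x / g x) \<longlongrightarrow> 1) at_top"
proof -
  obtain a where a: "\<And>A r m q. a \<le> A \<Longrightarrow> r \<in> borel_measurable borel \<Longrightarrow>
      (\<integral>\<^sup>+x. r x \<partial>lborel) = ennreal m \<Longrightarrow> 0 \<le> m \<Longrightarrow>
      (\<integral>\<^sup>+x. r x * ennreal (exp (\<gamma> * x)) \<partial>lborel) < \<infinity> \<Longrightarrow>
      (m < q \<longrightarrow> eventually (\<lambda>x. nconv r (tail_part g A) x \<le> ennreal (q * g x)) at_top) \<and>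
      (q < m \<longrightarrow> eventually (\<lambda>x. ennreal (q * g x) \<le> nconv r (tail_part g A) x) at_top)"
    using nconv_tail_part_asymp[OF g(1) gam] by blast
  have "eventually (\<lambda>x. (1 - \<epsilon>) * g x \<le> f x \<and> f x \<le> (1 + \<epsilon>) * g x) at_top"
    if e: "0 < \<epsilon>" "\<epsilon> < 1" for \<epsilon>
  proof -
    define \<delta> where "\<delta> = \<epsilon> / (4 * exp 1)"
    have \<delta>: "0 < \<delta>" "\<delta> \<le> 1" using e exp_ge_add_one_self[of "1::real"] by (auto simp: \<delta>_def field_simps)
    obtain A0 where A0: "\<And>A. A0 \<le> A \<Longrightarrow> 1 \<le> A \<and> (\<exists>r m. light_tail \<gamma> r \<and> F = nexp (tail_part g A) r \<and> (\<forall>x. u x \<le> r x) \<and>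
      (\<integral>\<^sup>+x. r x \<partial>lborel) = ennreal m \<and> 0 \<le> m \<and> 1 - \<epsilon> < m \<and> m \<le> 1)"
      using cutoff[OF e(1)] by blast
    obtain A1 where A1: "\<And>A x. A1 \<le> A \<Longrightarrow>
        nconv (tail_part g A) (tail_part g A) x \<le> ennreal \<delta> * tail_part g A x"
      using small_middleD[OF g(2) g_nonneg \<delta>(1)] by blast
    define A where "A = max a (max A0 A1)"
    have "A0 \<le> A" by (simp add: A_def)
    then obtain r m where r: "light_tail \<gamma> r" "F = nexp (tail_part g A) r"
      "(\<integral>\<^sup>+x. r x \<partial>lborel) = ennreal m" "0 \<le> m" "1 - \<epsilon> < m" "m \<le> 1"
      using A0 by blast
    note [measurable] = light_tail_measurable[OF r(1)]
    define t where "t = tail_part g A"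
    have [measurable]: "t \<in> borel_measurable borel" by (simp add: t_def)
    have tt: "nconv t t x \<le> ennreal \<delta> * t x" for x
      using A1[of A x] by (simp add: t_def A_def)
    note ab = a[OF _ light_tail_measurable[OF r(1)] r(3,4) light_tail_finite(2)[OF r(1)], of A]
    have U: "eventually (\<lambda>x. nconv r t x \<le> ennreal ((1 + \<epsilon>/4) * g x)) at_top"
      using ab r(6) e by (auto simp: t_def A_def)
    have L: "eventually (\<lambda>x. ennreal ((1 - \<epsilon>) * g x) \<le> nconv r t x) at_top"
      using ab r(5) by (auto simp: t_def A_def)
    have N: "eventually (\<lambda>x. r x \<le> ennreal ((\<epsilon>/4) * g x)) at_top"
      using light_tail_negligible[OF g(1) r(1) gam, of "\<epsilon>/4"] e by simp
    show ?thesis using U L N F_eq_f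
    proof eventually_elim
      case (elim x)
      have "ennreal ((1 - \<epsilon>) * g x) \<le> nconv r t x + ennreal (1/2) * nconv (nconv r t) t x"
        using elim(2) by (rule add_increasing2[rotated]) simp
      also have "\<dots> \<le> F x"
        unfolding r(2) t_def[symmetric] by (rule nexp_ge_second_order)
      finally have "ennreal ((1 - \<epsilon>) * g x) \<le> F x" .
      then have lo: "(1 - \<epsilon>) * g x \<le> f x" using elim(4) by (simp add: f_nonneg)
      have "F x \<le> r x + nconv r t x + ennreal (exp 1 * \<delta>) * nconv r t x"
        using nexp_remainder[of r t t 1 \<delta> x] tt \<delta> by (simp add: r(2) t_def[symmetric])
      also have "\<dots> \<le> ennreal ((\<epsilon>/4) * g x) + ennreal ((1 + \<epsilon>/4) * g x) + ennreal (exp 1 * \<delta>) * ennreal ((1 + \<epsilon>/4) * g x)"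
        using elim by (intro add_mono mult_left_mono) auto
      also have "\<dots> = ennreal ((\<epsilon>/4) * g x + (1 + \<epsilon>/4) * g x + exp 1 * \<delta> * ((1 + \<epsilon>/4) * g x))"
        using e \<delta> g_nonneg[of x] by (simp add: ennreal_plus ennreal_mult)
      also have "exp 1 * \<delta> = \<epsilon> / 4" by (simp add: \<delta>_def)
      finally have "F x \<le> ennreal ((\<epsilon>/4) * g x + (1 + \<epsilon>/4) * g x + \<epsilon>/4 * ((1 + \<epsilon>/4) * g x))" .
      then have "f x \<le> (\<epsilon>/4) * g x + (1 + \<epsilon>/4) * g x + \<epsilon>/4 * ((1 + \<epsilon>/4) * g x)"
        using e g_nonneg[of x] unfolding elim(4)
        by (subst (asm) ennreal_le_iff) (auto intro!: add_nonneg_nonneg mult_nonneg_nonneg)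
      also have "\<dots> = (\<epsilon>/4 + (1 + \<epsilon>/4) + \<epsilon>/4 * (1 + \<epsilon>/4)) * g x" by (simp add: algebra_simps)
      also have "\<dots> \<le> (1 + \<epsilon>) * g x"
      proof (intro mult_right_mono g_nonneg)
        have "\<epsilon> * \<epsilon> \<le> \<epsilon> * 1" using e by (intro mult_left_mono) auto
        moreover have "\<epsilon>/4 + (1 + \<epsilon>/4) + \<epsilon>/4 * (1 + \<epsilon>/4) = 1 + 3/4 * \<epsilon> + (\<epsilon> * \<epsilon>)/16"
          by (simp add: algebra_simps)
        ultimately show "\<epsilon>/4 + (1 + \<epsilon>/4) + \<epsilon>/4 * (1 + \<epsilon>/4) \<le> 1 + \<epsilon>" using e by linarith
      qed
      finally show ?case using lo by simp
    qed
  qed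
  then show ?thesis
    by (intro tendsto_ratio_1I regular_tail_pos[OF g(1)]) (blast intro: eventually_mono)+
qed


text \<open>The second-order term of \<open>f\<close> is at most what remains after the first-order term, so it
  is small relative to \<open>g\<close>; the smoothing by \<open>u\<close> is then undone.\<close>

lemma small_middle_if_density_asymp:
  assumes g: "regular_tail g" and lim: "((\<lambda>x. f x / g x) \<longlongrightarrow> 1) at_top"
  shows "small_middle g"
proof (rule small_middleI)
  fix \<epsilon> :: real assume "0 < \<epsilon>"
  obtain a where a: "\<And>A r m q. a \<le> A \<Longrightarrow> r \<in> borel_measurable borel \<Longrightarrow>
      (\<integral>\<^sup>+x. r x \<partial>lborel) = ennreal m \<Longrightarrow> 0 \<le> m \<Longrightarrow>
      (\<integral>\<^sup>+x. r x * ennreal (exp (\<gamma> * x)) \<partial>lborel) < \<infinity> \<Longrightarrow>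
      (m < q \<longrightarrow> eventually (\<lambda>x. nconv r (tail_part g A) x \<le> ennreal (q * g x)) at_top) \<and>
      (q < m \<longrightarrow> eventually (\<lambda>x. ennreal (q * g x) \<le> nconv r (tail_part g A) x) at_top)"
    using nconv_tail_part_asymp[OF g gam] by blast
  define p where "p = exp (- lam) / 2"
  have p: "0 < p" "p < exp (- lam)" by (auto simp: p_def)
  obtain B where B: "0 < B" "ennreal p \<le> (\<integral>\<^sup>+x. u x * indicator {x. \<bar>x\<bar> \<le> B} x \<partial>lborel)"
    using nn_integral_inside_ge[OF u_meas u_mass p(2)] by auto
  obtain C b where C: "0 < C" "\<And>x. b \<le> x \<Longrightarrow> 0 < g x"
    "\<And>x y. b \<le> x \<Longrightarrow> b \<le> x - y \<Longrightarrow> g (x - y) \<le> C * (1 + exp (\<gamma> * y)) * g x"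
    using regular_tail_potter[OF g gam] by blast
  define D where "D = C * (1 + exp (\<gamma> * B))"
  have "0 < D" using C(1) by (auto simp: D_def intro!: mult_pos_pos add_pos_pos)
  have D: "g w \<le> D * g (w - z)" if "\<bar>z\<bar> \<le> B" "b + B \<le> w" for w z
  proof -
    have "g (w - z - - z) \<le> C * (1 + exp (\<gamma> * - z)) * g (w - z)"
      using that B(1) by (intro C(3)) auto
    also have "\<dots> \<le> D * g (w - z)"
      unfolding D_def using that C(1) gam g_nonneg
      by (intro mult_right_mono mult_left_mono add_left_mono) (auto simp: algebra_simps intro: mult_left_mono[of "-z" B \<gamma>, simplified])
    finally show ?thesis by simp
  qed
  define \<eta> where "\<eta> = \<epsilon> * p / (4 * D)"
  have "0 < \<eta>" using \<open>0 < \<epsilon>\<close> p \<open>0 < D\<close> by (simp add: \<eta>_def)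
  obtain A0 where A0: "\<And>A. A0 \<le> A \<Longrightarrow> 1 \<le> A \<and> (\<exists>r m. light_tail \<gamma> r \<and> F = nexp (tail_part g A) r \<and> (\<forall>x. u x \<le> r x) \<and>
    (\<integral>\<^sup>+x. r x \<partial>lborel) = ennreal m \<and> 0 \<le> m \<and> 1 - min \<eta> 1 < m \<and> m \<le> 1)"
    using cutoff[of "min \<eta> 1"] \<open>0 < \<eta>\<close> by auto
  define A where "A = max a A0"
  have "A0 \<le> A" by (simp add: A_def)
  then obtain r m where r: "light_tail \<gamma> r" "F = nexp (tail_part g A) r" "\<And>x. u x \<le> r x"
    "(\<integral>\<^sup>+x. r x \<partial>lborel) = ennreal m" "0 \<le> m" "1 - min \<eta> 1 < m" "m \<le> 1"
    using A0 by blast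
  note [measurable] = light_tail_measurable[OF r(1)]
  define t where "t = tail_part g A"
  have [measurable]: "t \<in> borel_measurable borel" by (simp add: t_def)
  note ab = a[OF _ light_tail_measurable[OF r(1)] r(4,5) light_tail_finite(2)[OF r(1)], of A]
  \<comment> \<open>The mass \<open>m\<close> of \<open>r\<close> exceeds \<open>1 - min \<eta> 1\<close>, so the first-order term nearly exhausts \<open>f\<close>.\<close>
  have L: "eventually (\<lambda>x. ennreal ((1 - min \<eta> 1) * g x) \<le> nconv r t x) at_top"
    using ab r(6) by (auto simp: t_def A_def)
  have U: "eventually (\<lambda>x. f x \<le> (1 + \<eta>) * g x) at_top"
    by (rule ratio_bounds(2)[OF lim regular_tail_pos[OF g]]) (use \<open>0 < \<eta>\<close> in simp)
  have tt: "eventually (\<lambda>x. nconv u (nconv t t) x \<le> ennreal (4 * \<eta> * g x)) at_top"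
    using L U F_eq_f
  proof eventually_elim
    case (elim x)
    have le: "1 - \<eta> \<le> 1 - min \<eta> 1" by simp
    have "nconv r t x + ennreal (1/2) * nconv (nconv r t) t x \<le> ennreal ((1 + \<eta>) * g x)"
      using nexp_ge_second_order[of r t x] elim(2,3) by (simp add: r(2) t_def[symmetric] ennreal_leI order_trans)
    then have "ennreal (1/2) * nconv (nconv r t) t x \<le> ennreal ((1 + \<eta>) * g x - (1 - min \<eta> 1) * g x)"
      using elim(1) g_nonneg[of x] \<open>0 < \<eta>\<close>
      by (intro ennreal_le_cancel_middle[where P="nconv r t x"] mult_right_mono) auto
    also have "\<dots> \<le> ennreal (2 * \<eta> * g x)"
    proof (rule ennreal_leI)
      have "(1 - \<eta>) * g x \<le> (1 - min \<eta> 1) * g x" by (intro mult_right_mono g_nonneg le)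
      then show "(1 + \<eta>) * g x - (1 - min \<eta> 1) * g x \<le> 2 * \<eta> * g x" by (simp add: algebra_simps)
    qed
    finally have "ennreal 2 * (ennreal (1/2) * nconv (nconv r t) t x) \<le> ennreal 2 * ennreal (2 * \<eta> * g x)"
      by (rule mult_left_mono) simp
    then have "nconv (nconv r t) t x \<le> ennreal (4 * \<eta> * g x)"
      using \<open>0 < \<eta>\<close> g_nonneg[of x] by (simp only: mult.assoc[symmetric] ennreal_mult'[symmetric]) simp
    moreover have "nconv u (nconv t t) x \<le> nconv r (nconv t t) x"
      by (intro nconv_mono r(3)) simp_all
    ultimately show ?case by (simp add: nconv_assoc)
  qed
  define A' where "A' = max A b + B"
  define t' where "t' = tail_part g A'"
  have [measurable]: "t' \<in> borel_measurable borel" by (simp add: t'_def)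
  \<comment> \<open>Deconvolution: \<open>t' * t'\<close> at \<open>x\<close> is dominated by \<open>t * t\<close> at every point within distance \<open>B\<close>.\<close>
  have shift: "nconv t' t' x \<le> ennreal D * nconv t t (x - z)" if z: "\<bar>z\<bar> \<le> B" for x z
  proof -
    have "t' (x - y) \<le> ennreal D * t (x - z - y)" for y
    proof (cases "A' < x - y")
      case True
      then have "A < x - z - y" using z by (auto simp: A'_def)
      moreover have "g (x - y) \<le> D * g (x - y - z)" using True z by (intro D) (auto simp: A'_def)
      moreover have "x - y - z = x - z - y" by simp
      ultimately show ?thesis using True \<open>0 < D\<close> g_nonneg
        by (simp add: t'_def t_def tail_part_def ennreal_mult[symmetric] ennreal_leI)
    qed (simp add: t'_def tail_part_def)
    moreover have "t' y \<le> t y" for y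
      unfolding t_def t'_def by (rule tail_part_antimono) (use B in \<open>simp add: A'_def\<close>)
    ultimately have "nconv t' t' x \<le> (\<integral>\<^sup>+y. ennreal D * (t (x - z - y) * t y) \<partial>lborel)"
      unfolding nconv_def by (intro nn_integral_mono) (simp add: mult.assoc[symmetric] mult_mono)
    then show ?thesis by (simp add: nconv_def nn_integral_cmult)
  qed
  have dec: "ennreal p * nconv t' t' x \<le> ennreal D * nconv u (nconv t t) x" for x
  proof -
    have "ennreal p * nconv t' t' x \<le> (\<integral>\<^sup>+z. u z * indicator {z. \<bar>z\<bar> \<le> B} z \<partial>lborel) * nconv t' t' x"
      by (intro mult_right_mono B) simp
    also have "\<dots> = (\<integral>\<^sup>+z. u z * indicator {z. \<bar>z\<bar> \<le> B} z * nconv t' t' x \<partial>lborel)"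
      by (subst nn_integral_multc) auto
    also have "\<dots> \<le> (\<integral>\<^sup>+z. ennreal D * (nconv t t (x - z) * u z) \<partial>lborel)"
    proof (rule nn_integral_mono)
      fix z
      show "u z * indicator {z. \<bar>z\<bar> \<le> B} z * nconv t' t' x \<le> ennreal D * (nconv t t (x - z) * u z)"
        using mult_left_mono[OF shift[of z x], of "u z"] by (auto simp: indicator_def mult_ac)
    qed
    also have "\<dots> = ennreal D * nconv (nconv t t) u x" by (simp add: nconv_def[of _ u] nn_integral_cmult)
    finally show ?thesis by (simp add: nconv_commute[of u])
  qed
  show "\<exists>A. eventually (\<lambda>x. nconv (tail_part g A) (tail_part g A) x \<le> ennreal (\<epsilon> * g x)) at_top"
    using tt
  proof (intro exI[of _ A'], elim eventually_mono)
    fix x assume x: "nconv u (nconv t t) x \<le> ennreal (4 * \<eta> * g x)"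
    have "ennreal (1 / p) * (ennreal p * nconv t' t' x) \<le> ennreal (1 / p) * (ennreal D * ennreal (4 * \<eta> * g x))"
      by (intro mult_left_mono order_trans[OF dec] x) auto
    also have "\<dots> = ennreal (1 / p * (D * (4 * \<eta> * g x)))"
    proof -
      have "0 \<le> 1 / p" "0 \<le> D" using p \<open>0 < D\<close> by auto
      then show ?thesis by (simp only: ennreal_mult')
    qed
    also have "1 / p * (D * (4 * \<eta> * g x)) = \<epsilon> * g x"
      using p \<open>0 < D\<close> by (simp add: \<eta>_def field_simps)
    also have "ennreal (1 / p) * (ennreal p * nconv t' t' x) = nconv t' t' x"
      using p by (simp add: mult.assoc[symmetric] ennreal_mult[symmetric])
    finally show "nconv (tail_part g A') (tail_part g A') x \<le> ennreal (\<epsilon> * g x)" by (simp add: t'_def)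
  qed
qed


text \<open>Most of the mass of \<open>r\<close> lies in \<open>[- B, B]\<close>, and there \<open>g\<close> evaluated at \<open>x - y\<close> is nearly at least
  \<open>g (x + B)\<close>.\<close>

lemma nconv_tail_part_ge:
  assumes mon: "\<And>w x. A < w \<Longrightarrow> w \<le> x \<Longrightarrow> g x \<le> (1 + \<eta>) * g w" and "0 \<le> \<eta>"
    and [measurable]: "r \<in> borel_measurable borel"
    and r: "(\<integral>\<^sup>+x. r x \<partial>lborel) = ennreal m" "0 \<le> m" "q < m" "0 \<le> q"
  obtains B where "eventually (\<lambda>x. ennreal (q * g (x + B)) \<le> ennreal (1 + \<eta>) * nconv r (tail_part g A) x) at_top"
proof -
  obtain B where B: "0 < B" "ennreal q \<le> (\<integral>\<^sup>+x. r x * indicator {x. \<bar>x\<bar> \<le> B} x \<partial>lborel)"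
    using nn_integral_inside_ge[OF assms(3) r(1,3,2)] by auto
  have "ennreal (q * g (x + B)) \<le> ennreal (1 + \<eta>) * nconv r (tail_part g A) x" if "A + B < x" for x
  proof -
    have "ennreal (q * g (x + B)) \<le> (\<integral>\<^sup>+y. r y * indicator {y. \<bar>y\<bar> \<le> B} y \<partial>lborel) * ennreal (g (x + B))"
      using r(4) g_nonneg by (simp add: ennreal_mult mult_right_mono B)
    also have "\<dots> = (\<integral>\<^sup>+y. r y * indicator {y. \<bar>y\<bar> \<le> B} y * ennreal (g (x + B)) \<partial>lborel)"
      by (subst nn_integral_multc) auto
    also have "\<dots> \<le> (\<integral>\<^sup>+y. ennreal (1 + \<eta>) * (tail_part g A (x - y) * r y) \<partial>lborel)"
    proof (rule nn_integral_mono)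
      fix y
      show "r y * indicator {y. \<bar>y\<bar> \<le> B} y * ennreal (g (x + B))
          \<le> ennreal (1 + \<eta>) * (tail_part g A (x - y) * r y)"
      proof (cases "\<bar>y\<bar> \<le> B")
        case True
        have "A < x - y" "x - y \<le> x + B" using True that by auto
        then have "ennreal (g (x + B)) \<le> ennreal (1 + \<eta>) * tail_part g A (x - y)"
          using mon[of "x - y" "x + B"] \<open>0 \<le> \<eta>\<close> g_nonneg
          by (simp add: tail_part_def ennreal_mult[symmetric] ennreal_leI del: ennreal_plus)
        from mult_left_mono[OF this, of "r y"] show ?thesis using True by (simp add: mult_ac)
      qed simp
    qed
    also have "\<dots> = ennreal (1 + \<eta>) * nconv (tail_part g A) r x"
      by (simp add: nconv_def nn_integral_cmult)
    finally show ?thesis by (simp add: nconv_commute[of r])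
  qed
  then show thesis by (intro that[of B]) (auto intro: eventually_at_top_linorderI[of "A + B + 1"])
qed

text \<open>The asymptotic monotonicity of \<open>g\<close> enters only as the inequality \<open>mon\<close>; that
  \<open>g\<close> is long-tailed then follows from the conclusion.\<close>

lemma density_asymp_if_density_subexponential:
  assumes mon: "\<And>\<eta>. 0 < \<eta> \<Longrightarrow> \<exists>X. \<forall>w\<ge>X. \<forall>x\<ge>w. g x \<le> (1 + \<eta>) * g w"
    and gpos: "eventually (\<lambda>x. 0 < g x) at_top"
    and f: "regular_tail f" "small_middle f"
  shows "((\<lambda>x. f x / g x) \<longlongrightarrow> 1) at_top"
proof -
  note fpos = regular_tail_pos[OF f(1)]
  have shift: "eventually (\<lambda>x. f (x + y) \<le> (1 + \<eta>) * f x) at_top" if "0 < \<eta>" for y \<eta>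
    by (rule ratio_bounds(2)[OF regular_tail_shift[OF f(1)] fpos]) (use that in simp)
  have lower: "\<exists>B. eventually (\<lambda>x. (1 - \<eta>) * g (x + B) \<le> (1 + \<eta>) * f x) at_top"
    if \<eta>: "0 < \<eta>" "\<eta> < 1" for \<eta>
  proof -
    obtain X where X: "\<And>w x. X \<le> w \<Longrightarrow> w \<le> x \<Longrightarrow> g x \<le> (1 + \<eta>) * g w" using mon[OF \<eta>(1)] by blast
    obtain A0 where A0: "\<And>A. A0 \<le> A \<Longrightarrow> 1 \<le> A \<and> (\<exists>r m. light_tail \<gamma> r \<and> F = nexp (tail_part g A) r \<and> (\<forall>x. u x \<le> r x) \<and>
      (\<integral>\<^sup>+x. r x \<partial>lborel) = ennreal m \<and> 0 \<le> m \<and> 1 - \<eta> < m \<and> m \<le> 1)"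
      using cutoff[OF \<eta>(1)] by blast
    define A where "A = max X A0"
    have "A0 \<le> A" by (simp add: A_def)
    then obtain r m where r: "light_tail \<gamma> r" "F = nexp (tail_part g A) r"
      "(\<integral>\<^sup>+x. r x \<partial>lborel) = ennreal m" "0 \<le> m" "1 - \<eta> < m" using A0 by blast
    obtain B where B: "eventually (\<lambda>x. ennreal ((1 - \<eta>) * g (x + B)) \<le> ennreal (1 + \<eta>) * nconv r (tail_part g A) x) at_top"
      using nconv_tail_part_ge[of A \<eta> r m "1 - \<eta>"] X r light_tail_measurable[OF r(1)] \<eta>
      by (auto simp: A_def)
    have "eventually (\<lambda>x. (1 - \<eta>) * g (x + B) \<le> (1 + \<eta>) * f x) at_top"
      using B F_eq_f
    proof eventually_elim
      case (elim x)
      have "nconv r (tail_part g A) x \<le> F x"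
        unfolding r(2) by (rule order_trans[OF add_increasing2[OF zero_le order_refl] nexp_ge_second_order])
      then have "ennreal ((1 - \<eta>) * g (x + B)) \<le> ennreal (1 + \<eta>) * F x"
        using elim(1) by (meson mult_left_mono order_trans zero_le)
      then show ?case using elim(2) \<eta> f_nonneg[of x] by (simp add: ennreal_mult[symmetric] del: ennreal_plus)
    qed
    then show ?thesis by blast
  qed
  \<comment> \<open>The lower bound with \<open>\<eta> = 1/2\<close>, and \<open>f (x - B) \<le> 2 f x\<close>, give even the factor 6.\<close>
  have dom: "eventually (\<lambda>x. g x \<le> 9 * f x) at_top"
  proof -
    obtain B where B: "eventually (\<lambda>x. (1 - 1/2) * g (x + B) \<le> (1 + 1/2) * f x) at_top"
      using lower[of "1/2"] by auto
    have "eventually (\<lambda>x. (1 - 1/2) * g (x + -B + B) \<le> (1 + 1/2) * f (x + -B)) at_top"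
      using eventually_at_top_shift[OF B] .
    then show ?thesis using shift[of 1 "- B", OF zero_less_one]
    proof eventually_elim
      case (elim x)
      then have "1/2 * g x \<le> 3/2 * f (x - B)" "f (x - B) \<le> 2 * f x" by simp_all
      then show ?case using f_nonneg[of x] by linarith
    qed
  qed
  have L: "eventually (\<lambda>x. (1 - \<epsilon>) * g x \<le> f x) at_top" if e: "0 < \<epsilon>" "\<epsilon> < 1" for \<epsilon>
  proof -
    define \<eta> where "\<eta> = \<epsilon> / 3"
    have \<eta>: "0 < \<eta>" "\<eta> < 1" "\<epsilon> = 3 * \<eta>" using e by (auto simp: \<eta>_def)
    obtain B where B: "eventually (\<lambda>x. (1 - \<eta>) * g (x + B) \<le> (1 + \<eta>) * f x) at_top"
      using lower[OF \<eta>(1,2)] by auto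
    have "eventually (\<lambda>x. (1 - \<eta>) * g (x + -B + B) \<le> (1 + \<eta>) * f (x + -B)) at_top"
      using eventually_at_top_shift[OF B] .
    then show ?thesis using shift[OF \<eta>(1), of "-B"]
    proof eventually_elim
      case (elim x)
      have "(1 + \<eta>)^2 * (1 - 3 * \<eta>) \<le> 1 - \<eta>"
      proof -
        have "(1 + \<eta>)^2 * (1 - 3 * \<eta>) = (1 - \<eta>) - (5 * \<eta>^2 + 3 * \<eta>^3)"
          by (simp add: power2_eq_square power3_eq_cube algebra_simps)
        moreover have "0 \<le> 5 * \<eta>^2 + 3 * \<eta>^3" using \<eta> by (intro add_nonneg_nonneg) auto
        ultimately show ?thesis by linarith
      qed
      then have "(1 + \<eta>)^2 * (1 - 3 * \<eta>) * g x \<le> (1 - \<eta>) * g x"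
        by (rule mult_right_mono) (rule g_nonneg)
      also have "\<dots> \<le> (1 + \<eta>) * f (x + -B)" using elim(1) by simp
      also have "\<dots> \<le> (1 + \<eta>) * ((1 + \<eta>) * f x)" using elim(2) \<eta> by (intro mult_left_mono) auto
      also have "\<dots> = (1 + \<eta>)^2 * f x" by (simp add: power2_eq_square)
      finally have "(1 + \<eta>)^2 * ((1 - 3 * \<eta>) * g x) \<le> (1 + \<eta>)^2 * f x" by (simp only: mult.assoc)
      then show ?case unfolding \<eta>(3) using \<eta>(1) by (subst (asm) mult_le_cancel_left_pos) auto
    qed
  qed
  \<comment> \<open>The error terms: \<open>r\<close>, the part of \<open>r * t\<close> with \<open>\<bar>y\<bar> > B\<close>, and the higher orders, with \<open>C = 9\<close>.\<close>
  define \<kappa> where "\<kappa> = 1 + 2 * 9 + exp 1 * 9^2 * (2::real)"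
  have upper: "\<exists>B. eventually (\<lambda>x. (1 - \<kappa> * \<eta>) * f x \<le> (1 + \<eta>) * g (x - B)) at_top"
    if \<eta>: "0 < \<eta>" "9 * \<eta> \<le> 1" for \<eta>
  proof -
    obtain X where X: "\<And>w x. X \<le> w \<Longrightarrow> w \<le> x \<Longrightarrow> g x \<le> (1 + \<eta>) * g w" using mon[OF \<eta>(1)] by blast
    obtain A0 where A0: "\<And>A. A0 \<le> A \<Longrightarrow> 1 \<le> A \<and> (\<exists>r m. light_tail \<gamma> r \<and> F = nexp (tail_part g A) r \<and> (\<forall>x. u x \<le> r x) \<and>
      (\<integral>\<^sup>+x. r x \<partial>lborel) = ennreal m \<and> 0 \<le> m \<and> 1 - \<eta> < m \<and> m \<le> 1)"
      using cutoff[OF \<eta>(1)] by blast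
    obtain A1 where A1: "\<And>A x. A1 \<le> A \<Longrightarrow>
        nconv (tail_part f A) (tail_part f A) x \<le> ennreal \<eta> * tail_part f A x"
      using small_middleD[OF f(2) f_nonneg \<eta>(1)] by blast
    obtain A2 where A2: "\<And>x. A2 \<le> x \<Longrightarrow> g x \<le> 9 * f x" using dom by (auto simp: eventually_at_top_linorder)
    obtain a where a: "\<And>A r m q. a \<le> A \<Longrightarrow> r \<in> borel_measurable borel \<Longrightarrow>
        (\<integral>\<^sup>+x. r x \<partial>lborel) = ennreal m \<Longrightarrow> 0 \<le> m \<Longrightarrow>
        (\<integral>\<^sup>+x. r x * ennreal (exp (\<gamma> * x)) \<partial>lborel) < \<infinity> \<Longrightarrow>
        (m < q \<longrightarrow> eventually (\<lambda>x. nconv r (tail_part f A) x \<le> ennreal (q * f x)) at_top) \<and>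
        (q < m \<longrightarrow> eventually (\<lambda>x. ennreal (q * f x) \<le> nconv r (tail_part f A) x) at_top)"
      using nconv_tail_part_asymp[OF f(1) gam] by blast
    define A where "A = Max {X, A0, A1, A2, a}"
    have A: "X \<le> A" "A0 \<le> A" "A1 \<le> A" "A2 \<le> A" "a \<le> A" by (auto simp: A_def)
    obtain r m where r: "light_tail \<gamma> r" "F = nexp (tail_part g A) r"
      "(\<integral>\<^sup>+x. r x \<partial>lborel) = ennreal m" "0 \<le> m" "m \<le> 1" using A0 A(2) by blast
    note [measurable] = light_tail_measurable[OF r(1)]
    define t where "t = tail_part g A"
    define k where "k = tail_part f A"
    have [measurable]: "t \<in> borel_measurable borel" "k \<in> borel_measurable borel" by (simp_all add: t_def k_def)
    have tk: "t x \<le> ennreal 9 * k x" for x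
    proof (cases "A < x")
      case True
      then show ?thesis using A2[of x] A f_nonneg[of x] unfolding t_def k_def tail_part_def
        by (simp add: ennreal_mult'[symmetric] ennreal_leI del: ennreal_numeral)
    qed (simp add: t_def tail_part_def)
    have kk: "nconv k k x \<le> ennreal \<eta> * k x" for x unfolding k_def using A1[of A x] A by simp
    obtain B where B: "0 < B" "(\<integral>\<^sup>+x. r x * indicator {x. B < \<bar>x\<bar>} x \<partial>lborel) < ennreal \<eta>"
      using nn_integral_outside[of r "ennreal \<eta>"] r(3) \<eta> by (auto simp: ennreal_less_top)
    define r' where "r' y = r y * indicator {x. B < \<bar>x\<bar>} y" for y
    have [measurable]: "r' \<in> borel_measurable borel" unfolding r'_def[abs_def] by measurable
    obtain m' where m': "(\<integral>\<^sup>+x. r' x \<partial>lborel) = ennreal m'" "0 \<le> m'" "m' < \<eta>"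
      using B(2) unfolding r'_def
      by (cases "\<integral>\<^sup>+x. r x * indicator {x. B < \<bar>x\<bar>} x \<partial>lborel" rule: ennreal_cases) (auto simp: ennreal_less_iff)
    have e': "(\<integral>\<^sup>+x. r' x * ennreal (exp (\<gamma> * x)) \<partial>lborel) < \<infinity>"
      by (rule le_less_trans[OF nn_integral_mono light_tail_finite(2)[OF r(1)]]) (auto simp: r'_def indicator_def)
    have U1: "eventually (\<lambda>x. r x \<le> ennreal (\<eta> * f x)) at_top"
      by (rule light_tail_negligible[OF f(1) r(1) gam \<eta>(1)])
    have U2: "eventually (\<lambda>x. nconv r k x \<le> ennreal (2 * f x)) at_top"
      using a[OF A(5) light_tail_measurable[OF r(1)] r(3,4) light_tail_finite(2)[OF r(1)], of 2] r(5) by (auto simp: k_def)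
    have U3: "eventually (\<lambda>x. nconv r' k x \<le> ennreal ((2 * \<eta>) * f x)) at_top"
      using a[OF A(5) _ m'(1,2) e', of "2 * \<eta>"] m'(3) \<eta> by (auto simp: k_def)
    \<comment> \<open>Near the origin asymptotic monotonicity is used; on \<open>\<bar>y\<bar> > B\<close> the bound \<open>t \<le> 9 k\<close>, as \<open>g\<close> is not known to be long-tailed.\<close>
    have U4: "nconv r t x \<le> ennreal ((1 + \<eta>) * g (x - B)) + ennreal 9 * nconv r' k x" if "A + B < x" for x
    proof -
      have "nconv r t x = nconv t r x" by (simp add: nconv_commute)
      also have "\<dots> \<le> (\<integral>\<^sup>+y. ennreal ((1 + \<eta>) * g (x - B)) * r y + t (x - y) * r' y \<partial>lborel)"
        unfolding nconv_def
      proof (rule nn_integral_mono)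
        fix y
        show "t (x - y) * r y \<le> ennreal ((1 + \<eta>) * g (x - B)) * r y + t (x - y) * r' y"
        proof (cases "\<bar>y\<bar> \<le> B")
          case True
          have "t (x - y) \<le> ennreal ((1 + \<eta>) * g (x - B))"
            using X[of "x - B" "x - y"] True that A by (auto simp: t_def tail_part_def intro!: ennreal_leI)
          then show ?thesis by (intro add_increasing2 mult_right_mono) auto
        qed (simp add: r'_def)
      qed
      also have "\<dots> = ennreal ((1 + \<eta>) * g (x - B)) * ennreal m + nconv r' t x"
        by (simp add: nn_integral_add nn_integral_cmult r(3) nconv_commute[of r'] nconv_def[of t])
      also have "\<dots> \<le> ennreal ((1 + \<eta>) * g (x - B)) * 1 + nconv r' (\<lambda>x. ennreal 9 * k x) x"
        using r(5) tk by (intro add_mono mult_left_mono nconv_mono) auto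
      finally show ?thesis by (simp add: nconv_cmult_right del: ennreal_numeral)
    qed
    have "eventually (\<lambda>x. (1 - \<kappa> * \<eta>) * f x \<le> (1 + \<eta>) * g (x - B)) at_top"
      using U1 U2 U3 eventually_gt_at_top[of "A + B"] F_eq_f
    proof eventually_elim
      case (elim x)
      have "F x \<le> r x + nconv r t x + ennreal (exp 1 * 9^2 * \<eta>) * nconv r k x"
        unfolding r(2) t_def[symmetric] by (rule nexp_remainder) (use tk kk \<eta> in auto)
      also have "\<dots> \<le> ennreal (\<eta> * f x) + (ennreal ((1 + \<eta>) * g (x - B)) + ennreal 9 * ennreal (2 * \<eta> * f x))
          + ennreal (exp 1 * 9^2 * \<eta>) * ennreal (2 * f x)"
        using elim by (intro add_mono mult_left_mono order_trans[OF U4]) auto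
      also have "\<dots> = ennreal (\<eta> * f x + ((1 + \<eta>) * g (x - B) + 9 * (2 * \<eta> * f x)) + exp 1 * 9^2 * \<eta> * (2 * f x))"
      proof -
        have "0 \<le> \<eta> * f x" "0 \<le> (1 + \<eta>) * g (x - B)" "0 \<le> 2 * \<eta> * f x" "0 \<le> exp 1 * 9^2 * \<eta>" "0 \<le> 2 * f x"
          using \<eta> f_nonneg[of x] g_nonneg[of "x - B"] by auto
        then show ?thesis
          by (simp only: ennreal_plus ennreal_mult add_nonneg_nonneg mult_nonneg_nonneg zero_le_numeral)
      qed
      finally have "f x \<le> \<eta> * f x + ((1 + \<eta>) * g (x - B) + 9 * (2 * \<eta> * f x)) + exp 1 * 9^2 * \<eta> * (2 * f x)"
        unfolding elim(5) using \<eta> f_nonneg[of x] g_nonneg[of "x - B"]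
        by (subst (asm) ennreal_le_iff) (auto intro!: add_nonneg_nonneg mult_nonneg_nonneg)
      then show ?case by (simp add: \<kappa>_def algebra_simps)
    qed
    then show ?thesis by blast
  qed
  have U: "eventually (\<lambda>x. f x \<le> (1 + \<epsilon>) * g x) at_top" if e: "0 < \<epsilon>" "\<epsilon> < 1" for \<epsilon>
  proof -
    have "((\<lambda>\<eta>. (1 + \<eta>) * (1 + \<eta>) / (1 - \<kappa> * \<eta>)) \<longlongrightarrow> (1 + 0) * (1 + 0) / (1 - \<kappa> * 0)) (at_right 0)"
      by (intro tendsto_intros) auto
    then have "eventually (\<lambda>\<eta>. (1 + \<eta>) * (1 + \<eta>) / (1 - \<kappa> * \<eta>) < 1 + \<epsilon>) (at_right 0)"
      using e by (intro order_tendstoD) auto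
    moreover have "((\<lambda>\<eta>. \<kappa> * \<eta>) \<longlongrightarrow> \<kappa> * 0) (at_right 0)" by (intro tendsto_intros)
    then have "eventually (\<lambda>\<eta>. \<kappa> * \<eta> < 1) (at_right 0)" by (intro order_tendstoD) auto
    moreover have "eventually (\<lambda>\<eta>::real. 0 < \<eta>) (at_right 0)" by (rule eventually_at_right_less)
    moreover have "eventually (\<lambda>\<eta>::real. \<eta> < 1/9) (at_right 0)"
      using eventually_at_right_field[of "\<lambda>\<eta>::real. \<eta> < 1/9" 0] by (auto intro!: exI[of _ "1/9"])
    ultimately have "eventually (\<lambda>\<eta>. (1 + \<eta>) * (1 + \<eta>) / (1 - \<kappa> * \<eta>) < 1 + \<epsilon> \<and> \<kappa> * \<eta> < 1 \<and> 0 < \<eta> \<and> \<eta> < 1/9) (at_right 0)"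
      by eventually_elim auto
    then obtain \<eta> where \<eta>: "(1 + \<eta>) * (1 + \<eta>) / (1 - \<kappa> * \<eta>) < 1 + \<epsilon>" "\<kappa> * \<eta> < 1" "0 < \<eta>" "\<eta> < 1/9"
      using eventually_happens' trivial_limit_at_right_real by blast
    have \<eta>': "(1 + \<eta>) * (1 + \<eta>) \<le> (1 + \<epsilon>) * (1 - \<kappa> * \<eta>)" using \<eta>(1,2) by (simp add: pos_divide_less_eq)
    obtain B where B: "eventually (\<lambda>x. (1 - \<kappa> * \<eta>) * f x \<le> (1 + \<eta>) * g (x - B)) at_top"
      using upper[of \<eta>] \<eta> by auto
    have "eventually (\<lambda>x. (1 - \<kappa> * \<eta>) * f (x + B) \<le> (1 + \<eta>) * g (x + B - B)) at_top"
      using eventually_at_top_shift[OF B] .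
    moreover have "eventually (\<lambda>x. f (x + B + - B) \<le> (1 + \<eta>) * f (x + B)) at_top"
      using eventually_at_top_shift[OF shift[OF \<eta>(3)]] .
    ultimately show ?thesis
    proof eventually_elim
      case (elim x)
      have "(1 - \<kappa> * \<eta>) * f x \<le> (1 - \<kappa> * \<eta>) * ((1 + \<eta>) * f (x + B))"
        using elim(2) \<eta>(2) by (intro mult_left_mono) auto
      also have "\<dots> = (1 + \<eta>) * ((1 - \<kappa> * \<eta>) * f (x + B))" by (simp add: mult_ac)
      also have "\<dots> \<le> (1 + \<eta>) * ((1 + \<eta>) * g x)" using elim(1) \<eta>(3) by (intro mult_left_mono) auto
      also have "\<dots> \<le> (1 - \<kappa> * \<eta>) * ((1 + \<epsilon>) * g x)"
        using mult_right_mono[OF \<eta>' g_nonneg[of x]] by (simp add: mult_ac)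
      finally show ?case using \<eta>(2) by (subst (asm) mult_le_cancel_left_pos) auto
    qed
  qed
  show ?thesis by (rule tendsto_ratio_1I[OF gpos L U])
qed

end

section \<open>Relation to the classes of densities\<close>

lemma regular_tailI:
  assumes lt: "long_tailed_density h" and ad: "almost_decreasing h"
  shows "regular_tail h"
proof -
  obtain x0 K where K: "0 < K" "\<And>x y. x0 < x \<Longrightarrow> 0 < y \<Longrightarrow> h (x + y) \<le> K * h x"
    using ad unfolding almost_decreasing_def by blast
  obtain x1 where x1: "\<And>x. x1 \<le> x \<Longrightarrow> 0 < h x" using lt unfolding long_tailed_density_def by blast
  have "h (x + y) \<le> max K 1 * h x" if "max (x0 + 1) x1 \<le> x" "0 \<le> y" for x y
  proof -
    have "K * h x \<le> max K 1 * h x" "1 * h x \<le> max K 1 * h x"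
      using x1[of x] that by (auto intro!: mult_right_mono)
    then show ?thesis using K(2)[of x y] that by (cases "y = 0") auto
  qed
  then have "\<exists>a K. \<forall>x\<ge>a. \<forall>y\<ge>0. h (x + y) \<le> K * h x" by blast
  then show ?thesis
    using lt unfolding long_tailed_density_def probability_density_def regular_tail_def by blast
qed

lemma regular_tail_almost_decreasing:
  assumes "regular_tail h" shows "almost_decreasing h"
proof -
  obtain a K where K: "\<And>x y. a \<le> x \<Longrightarrow> 0 \<le> y \<Longrightarrow> h (x + y) \<le> K * h x"
    using assms unfolding regular_tail_def by blast
  have h0: "0 \<le> h x" for x using assms by (simp add: regular_tail_def)
  have "h (x + y) \<le> max K 1 * h x" if "max a 1 < x" "0 < y" for x y
    using K[of x y] that mult_right_mono[of K "max K 1" "h x"] h0[of x] by auto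
  then show ?thesis unfolding almost_decreasing_def
    by (intro exI[of _ "max a 1"] conjI exI[of _ "max K 1"]) auto
qed

lemma regular_tail_long_tailed:
  assumes "regular_tail h" "probability_density h" shows "long_tailed_density h"
proof -
  obtain a where "\<forall>x\<ge>a. 0 < h x" using assms(1) unfolding regular_tail_def by blast
  then have "\<exists>x0>0. \<forall>x\<ge>x0. 0 < h x" by (intro exI[of _ "max a 1"]) auto
  then show ?thesis using assms unfolding regular_tail_def long_tailed_density_def by blast
qed

text \<open>For \<open>x > 2 A\<close>, \<open>k * k\<close> splits into twice the convolution of \<open>k 1\<^bsub>(- \<infinity>,A]\<^esub>\<close> with
  \<open>k 1\<^bsub>(A,\<infinity>)\<^esub>\<close>, which is close to \<open>2 k\<close>, and the middle part.\<close>

lemma subexponential_density_iff: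
  assumes k: "regular_tail k" and pd: "probability_density k" and neg: "\<And>x. x < 0 \<Longrightarrow> k x = 0"
  shows "subexponential_density k \<longleftrightarrow> small_middle k"
proof -
  have [measurable]: "k \<in> borel_measurable borel" and k0: "\<And>x. 0 \<le> k x"
    using k by (auto simp: regular_tail_def)
  define K where "K x = ennreal (k x)" for x
  define L where "L A x = (if x \<le> A then K x else 0)" for A x
  define T where "T = tail_part k"
  have [measurable]: "K \<in> borel_measurable borel" unfolding K_def[abs_def] by measurable
  have [measurable]: "T A \<in> borel_measurable borel" for A by (simp add: T_def)
  have [measurable]: "L A \<in> borel_measurable borel" for A
    unfolding L_def[abs_def] by (intro measurable_If) auto
  have one: "(\<integral>\<^sup>+x. K x \<partial>lborel) = 1"
  proof -
    interpret prob_space "density lborel (\<lambda>x. ennreal (k x))" using pd by (simp add: probability_density_def)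
    show ?thesis using emeasure_space_1 by (simp add: emeasure_density K_def)
  qed
  have dc: "density_convolution k k x = enn2real (nconv K K x)" for x
    unfolding density_convolution_def nconv_def K_def
    by (subst integral_eq_nn_integral) (auto simp: k0 ennreal_mult)
  have split: "nconv K K x = (nconv (L A) (T A) x + nconv (L A) (T A) x) + nconv (T A) (T A) x" if "2 * A < x" for A x
  proof -
    have K: "K = (\<lambda>x. L A x + T A x)" by (auto simp: L_def T_def tail_part_def K_def)
    \<comment> \<open>Two summands at most \<open>A\<close> cannot reach \<open>x > 2 A\<close>.\<close>
    have LL: "nconv (L A) (L A) x = 0"
    proof -
      have "L A (x - y) * L A y = 0" for y using that by (auto simp: L_def)
      then show ?thesis by (simp add: nconv_def del: mult_eq_0_iff)
    qed
    have "nconv K K x = nconv K (L A) x + nconv K (T A) x"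
      using nconv_add_right[of K "L A" "T A" x] by (simp only: K[symmetric]) simp
    also have "nconv K (L A) x = nconv (L A) (L A) x + nconv (T A) (L A) x"
      using nconv_add_left[of "L A" "T A" "L A" x] by (simp only: K[symmetric]) simp
    also have "nconv K (T A) x = nconv (L A) (T A) x + nconv (T A) (T A) x"
      using nconv_add_left[of "L A" "T A" "T A" x] by (simp only: K[symmetric]) simp
    also have "nconv (T A) (L A) x = nconv (L A) (T A) x"
      using nconv_commute[of "T A" "L A"] by simp
    finally show ?thesis by (simp add: LL add.assoc)
  qed
  obtain a where a: "\<And>A r m q. a \<le> A \<Longrightarrow> r \<in> borel_measurable borel \<Longrightarrow>
      (\<integral>\<^sup>+x. r x \<partial>lborel) = ennreal m \<Longrightarrow> 0 \<le> m \<Longrightarrow>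
      (\<integral>\<^sup>+x. r x * ennreal (exp (1 * x)) \<partial>lborel) < \<infinity> \<Longrightarrow>
      (m < q \<longrightarrow> eventually (\<lambda>x. nconv r (tail_part k A) x \<le> ennreal (q * k x)) at_top) \<and>
      (q < m \<longrightarrow> eventually (\<lambda>x. ennreal (q * k x) \<le> nconv r (tail_part k A) x) at_top)"
    using nconv_tail_part_asymp[OF k zero_less_one] by blast
  have le1: "(\<integral>\<^sup>+x. L A x \<partial>lborel) \<le> 1" for A
    unfolding one[symmetric] by (intro nn_integral_mono) (auto simp: L_def)
  \<comment> \<open>The exponent 1 is arbitrary: \<open>L A\<close> vanishes on \<open>(A, \<infinity>)\<close>.\<close>
  have Lexp: "(\<integral>\<^sup>+x. L A x * ennreal (exp (1 * x)) \<partial>lborel) < \<infinity>" for A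
  proof -
    have "(\<integral>\<^sup>+x. L A x * ennreal (exp (1 * x)) \<partial>lborel) \<le> (\<integral>\<^sup>+x. L A x * ennreal (exp A) \<partial>lborel)"
      by (intro nn_integral_mono) (auto simp: L_def intro!: mult_left_mono ennreal_leI)
    also have "\<dots> = (\<integral>\<^sup>+x. L A x \<partial>lborel) * ennreal (exp A)" by (simp add: nn_integral_multc)
    also have "\<dots> < \<infinity>" using le1[of A] by (auto simp: ennreal_mult_less_top le_less_trans)
    finally show ?thesis .
  qed
  have Lup: "eventually (\<lambda>x. nconv (L A) (T A) x \<le> ennreal (q * k x)) at_top" if "a \<le> A" "1 < q" for A q
  proof -
    obtain m where m: "(\<integral>\<^sup>+x. L A x \<partial>lborel) = ennreal m" "0 \<le> m" "m \<le> 1"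
      using le1[of A] by (cases "\<integral>\<^sup>+x. L A x \<partial>lborel" rule: ennreal_cases) (auto simp: top_unique)
    show ?thesis using a[OF that(1) _ m(1,2) Lexp, of q] m(3) that by (auto simp: T_def)
  qed
  have Llow: "\<exists>A0. \<forall>A\<ge>A0. eventually (\<lambda>x. ennreal ((1 - \<delta>) * k x) \<le> nconv (L A) (T A) x) at_top" if "0 < \<delta>" for \<delta>
  proof -
    obtain B where B: "ennreal (1 - \<delta> / 2) \<le> (\<integral>\<^sup>+x. K x * indicator {x. \<bar>x\<bar> \<le> B} x \<partial>lborel)"
      by (rule nn_integral_inside_ge[of K 1 "1 - \<delta> / 2"]) (use one \<open>0 < \<delta>\<close> in auto)
    show ?thesis
    proof (intro exI[of _ "max a B"] allI impI)
      fix A assume A: "max a B \<le> A"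
      obtain m where m: "(\<integral>\<^sup>+x. L A x \<partial>lborel) = ennreal m" "0 \<le> m"
        using le1[of A] by (cases "\<integral>\<^sup>+x. L A x \<partial>lborel" rule: ennreal_cases) (auto simp: top_unique)
      have "ennreal (1 - \<delta> / 2) \<le> ennreal m"
        unfolding m(1)[symmetric] using A
        by (intro order_trans[OF B] nn_integral_mono) (auto simp: L_def indicator_def)
      then have "1 - \<delta> < m" using m(2) that by (auto simp: ennreal_le_iff)
      then show "eventually (\<lambda>x. ennreal ((1 - \<delta>) * k x) \<le> nconv (L A) (T A) x) at_top"
        using a[of A "L A" m "1 - \<delta>"] A m Lexp by (auto simp: T_def)
    qed
  qed
  have kpos: "eventually (\<lambda>x. 0 < k x) at_top" by (rule regular_tail_pos[OF k])
  then have kpos2: "eventually (\<lambda>x. 0 < 2 * k x) at_top" by (auto elim: eventually_mono)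
  have "density_convolution k k \<sim>[at_top] (\<lambda>x. 2 * k x) \<longleftrightarrow> small_middle k"
  proof
    assume sm: "small_middle k"
    have "eventually (\<lambda>x. (1 - \<epsilon>) * (2 * k x) \<le> density_convolution k k x
        \<and> density_convolution k k x \<le> (1 + \<epsilon>) * (2 * k x)) at_top" if e: "0 < \<epsilon>" "\<epsilon> < 1" for \<epsilon>
    proof -
      obtain A1 where A1: "\<And>A' x. A1 \<le> A' \<Longrightarrow> nconv (T A') (T A') x \<le> ennreal (\<epsilon> * k x)"
        using sm e unfolding small_middle_def T_def by blast
      obtain A2 where A2: "\<And>A. A2 \<le> A \<Longrightarrow> eventually (\<lambda>x. ennreal ((1 - \<epsilon>) * k x) \<le> nconv (L A) (T A) x) at_top"
        using Llow[OF e(1)] by blast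
      define A where "A = max a (max A1 A2)"
      have A: "a \<le> A" "A1 \<le> A" "A2 \<le> A" by (auto simp: A_def)
      show ?thesis using A2[OF A(3)] Lup[OF A(1), of "1 + \<epsilon>/2", simplified, OF e(1)] eventually_gt_at_top[of "2 * A"]
      proof eventually_elim
        case (elim x)
        have "nconv K K x \<le> (ennreal ((1 + \<epsilon>/2) * k x) + ennreal ((1 + \<epsilon>/2) * k x)) + ennreal (\<epsilon> * k x)"
          unfolding split[OF elim(3)] using elim A1[OF A(2)] by (intro add_mono) auto
        also have "\<dots> = ennreal (((1 + \<epsilon>/2) * k x + (1 + \<epsilon>/2) * k x) + \<epsilon> * k x)"
          using e k0[of x] by (simp only: ennreal_plus add_nonneg_nonneg mult_nonneg_nonneg zero_le_one divide_nonneg_pos zero_less_numeral less_imp_le)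
        also have "((1 + \<epsilon>/2) * k x + (1 + \<epsilon>/2) * k x) + \<epsilon> * k x = (1 + \<epsilon>) * (2 * k x)"
          by (simp add: algebra_simps)
        finally have up: "nconv K K x \<le> ennreal ((1 + \<epsilon>) * (2 * k x))" .
        then have fin: "nconv K K x < top" by (rule le_less_trans) simp
        have "ennreal ((1 - \<epsilon>) * (2 * k x)) = ennreal ((1 - \<epsilon>) * k x + (1 - \<epsilon>) * k x)" by (simp add: algebra_simps)
        also have "\<dots> = ennreal ((1 - \<epsilon>) * k x) + ennreal ((1 - \<epsilon>) * k x)"
          using e k0[of x] by (intro ennreal_plus) auto
        also have "\<dots> \<le> nconv K K x"
          unfolding split[OF elim(3)] using elim by (intro add_increasing2 add_mono) auto
        finally have lo: "ennreal ((1 - \<epsilon>) * (2 * k x)) \<le> nconv K K x" .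
        have up2: "enn2real (nconv K K x) \<le> (1 + \<epsilon>) * (2 * k x)"
          using enn2real_mono[OF up] e k0[of x] by (simp add: enn2real_ennreal)
        have lo2: "(1 - \<epsilon>) * (2 * k x) \<le> enn2real (nconv K K x)"
          using enn2real_mono[OF lo fin] e k0[of x] by (simp add: enn2real_ennreal)
        show ?case using up2 lo2 by (simp add: dc)
      qed
    qed
    then have "((\<lambda>x. density_convolution k k x / (2 * k x)) \<longlongrightarrow> 1) at_top"
      by (intro tendsto_ratio_1I kpos2) (blast intro: eventually_mono)+
    then show "density_convolution k k \<sim>[at_top] (\<lambda>x. 2 * k x)"
      by (intro asymp_equivI')
  next
    assume "density_convolution k k \<sim>[at_top] (\<lambda>x. 2 * k x)"
    then have lim: "((\<lambda>x. density_convolution k k x / (2 * k x)) \<longlongrightarrow> 1) at_top"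
      by (rule asymp_equivD_strong) (use kpos in \<open>auto elim: eventually_mono\<close>)
    show "small_middle k"
    proof (rule small_middleI)
      fix \<epsilon> :: real assume "0 < \<epsilon>"
      define \<delta> where "\<delta> = min (\<epsilon> / 4) (1 / 2)"
      have \<delta>: "0 < \<delta>" "\<delta> < 1" "4 * \<delta> \<le> \<epsilon>" using \<open>0 < \<epsilon>\<close> by (auto simp: \<delta>_def)
      obtain A where A: "eventually (\<lambda>x. ennreal ((1 - \<delta>) * k x) \<le> nconv (L A) (T A) x) at_top"
        using Llow[OF \<delta>(1)] by blast
      have R1: "eventually (\<lambda>x. 1/2 * (2 * k x) \<le> density_convolution k k x) at_top"
        by (rule ratio_bounds(1)[OF lim kpos2]) simp
      have R2: "eventually (\<lambda>x. density_convolution k k x \<le> (1 + \<delta>) * (2 * k x)) at_top"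
        by (rule ratio_bounds(2)[OF lim kpos2]) (use \<delta> in simp)
      have "eventually (\<lambda>x. nconv (tail_part k A) (tail_part k A) x \<le> ennreal (\<epsilon> * k x)) at_top"
        using A R1 R2 kpos
          eventually_gt_at_top[of "2 * A"]
      proof eventually_elim
        case (elim x)
        \<comment> \<open>An infinite convolution would have real value 0, so positivity shows that it is finite.\<close>
        have pos: "0 < enn2real (nconv K K x)" using elim(2,4) by (simp add: dc)
        then have "nconv K K x = ennreal (enn2real (nconv K K x))"
          by (intro ennreal_enn2real[symmetric]) (auto simp: enn2real_positive_iff)
        also have "\<dots> \<le> ennreal ((1 + \<delta>) * (2 * k x))" using elim(3) \<delta> by (simp add: dc ennreal_leI)
        finally have up: "nconv K K x \<le> ennreal ((1 + \<delta>) * (2 * k x))" .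
        have "ennreal ((1 - \<delta>) * (2 * k x)) = ennreal ((1 - \<delta>) * k x + (1 - \<delta>) * k x)" by (simp add: algebra_simps)
        also have "\<dots> = ennreal ((1 - \<delta>) * k x) + ennreal ((1 - \<delta>) * k x)"
          using \<delta> k0[of x] by (intro ennreal_plus) auto
        also have "\<dots> \<le> nconv (L A) (T A) x + nconv (L A) (T A) x" using elim(1) by (intro add_mono)
        finally have lo: "ennreal ((1 - \<delta>) * (2 * k x)) \<le> nconv (L A) (T A) x + nconv (L A) (T A) x" .
        have "nconv (T A) (T A) x \<le> ennreal ((1 + \<delta>) * (2 * k x) - (1 - \<delta>) * (2 * k x))"
          using up unfolding split[OF elim(5)]
          by (rule ennreal_le_cancel_middle[OF lo]) (use \<delta> k0[of x] in \<open>auto intro: mult_right_mono\<close>)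
        also have "(1 + \<delta>) * (2 * k x) - (1 - \<delta>) * (2 * k x) = 4 * \<delta> * k x" by (simp add: algebra_simps)
        also have "ennreal (4 * \<delta> * k x) \<le> ennreal (\<epsilon> * k x)"
          by (intro ennreal_leI mult_right_mono \<delta> k0)
        finally show ?case by (simp add: T_def)
      qed
      then show "\<exists>A. eventually (\<lambda>x. nconv (tail_part k A) (tail_part k A) x \<le> ennreal (\<epsilon> * k x)) at_top"
        by blast
    qed
  qed
  then show ?thesis
    using regular_tail_long_tailed[OF k pd] by (simp add: subexponential_density_def)
qed

lemma positive_part_density_props:
  assumes f: "regular_tail f" and pd: "probability_density f"
  shows "0 < tail_df f 0" "probability_density (positive_part_density f)"
proof -
  have [measurable]: "f \<in> borel_measurable borel" and f0: "\<And>x. 0 \<le> f x"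
    using f by (auto simp: regular_tail_def)
  define M where "M = density lborel (\<lambda>x. ennreal (f x))"
  have [measurable_cong, simp]: "sets M = sets borel" by (simp add: M_def)
  have sM: "space M = UNIV" by (simp add: M_def)
  interpret M: prob_space M using pd by (simp add: M_def probability_density_def)
  have "tail_df f 0 = 1 - measure M {..0}" by (simp add: tail_df_def cdf_def M_def)
  also have "\<dots> = measure M (space M - {..0})" by (rule M.prob_compl[symmetric]) simp
  also have "space M - {..0} = {0<..}" by (auto simp: sM)
  finally have td: "tail_df f 0 = measure M {0<..}" .
  have em: "emeasure M {0<..} = (\<integral>\<^sup>+x. ennreal (f x) * indicator {0<..} x \<partial>lborel)"
    unfolding M_def by (rule emeasure_density) auto
  obtain a where a: "\<And>x. a \<le> x \<Longrightarrow> 0 < f x" using f unfolding regular_tail_def by blast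
  have "emeasure M {0<..} \<noteq> 0"
  proof
    assume "emeasure M {0<..} = 0"
    then have "AE x in lborel. ennreal (f x) * indicator {0<..} x = 0"
      unfolding em by (subst (asm) nn_integral_0_iff_AE) auto
    then have "AE x in lborel. x \<notin> {max a 1..max a 1 + 1}"
    proof eventually_elim
      case (elim x)
      then show ?case using a[of x] f0[of x] by (auto simp: indicator_def ennreal_eq_0_iff split: if_splits)
    qed
    then have "{max a 1..max a 1 + 1} \<in> null_sets lborel"
      by (subst AE_iff_null_sets) auto
    then show False by (simp add: null_sets_def)
  qed
  then show pos: "0 < tail_df f 0"
    unfolding td by (simp add: M.emeasure_eq_measure zero_less_measure_iff)
  define c where "c = tail_df f 0"
  have "emeasure (density lborel (\<lambda>x. ennreal (positive_part_density f x))) UNIV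
      = (\<integral>\<^sup>+x. ennreal (1 / c) * (ennreal (f x) * indicator {0<..} x) \<partial>lborel)"
  proof -
    have "AE x in lborel. x \<noteq> (0::real)" by (rule AE_lborel_singleton)
    then have "(\<integral>\<^sup>+x. ennreal (positive_part_density f x) \<partial>lborel)
        = (\<integral>\<^sup>+x. ennreal (1 / c) * (ennreal (f x) * indicator {0<..} x) \<partial>lborel)"
      using pos f0
      by (intro nn_integral_cong_AE)
        (auto simp: positive_part_density_def indicator_def c_def ennreal_mult[symmetric] elim!: eventually_mono)
    then show ?thesis by (subst emeasure_density) (auto simp: positive_part_density_def)
  qed
  also have "\<dots> = ennreal (1 / c) * emeasure M {0<..}" unfolding em by (rule nn_integral_cmult) measurable
  also have "emeasure M {0<..} = ennreal c" by (simp add: M.emeasure_eq_measure c_def td)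
  also have "ennreal (1 / c) * ennreal c = 1" using pos by (simp add: c_def ennreal_mult[symmetric])
  finally have "prob_space (density lborel (\<lambda>x. ennreal (positive_part_density f x)))"
    by (intro prob_spaceI) simp
  then show "probability_density (positive_part_density f)"
    unfolding probability_density_def using pos f0 by (auto simp: positive_part_density_def[abs_def])
qed

text \<open>Passing to the positive part multiplies \<open>f\<close> by a constant near \<open>\<infinity>\<close>, which affects neither side.\<close>

lemma weakly_subexponential_iff:
  assumes f: "regular_tail f" and pd: "probability_density f"
  shows "weakly_subexponential_density f \<longleftrightarrow> small_middle f"
proof -
  have [measurable]: "f \<in> borel_measurable borel" and f0: "\<And>x. 0 \<le> f x"
    using f by (auto simp: regular_tail_def)
  define c where "c = tail_df f 0"
  define k where "k = positive_part_density f"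
  have c: "0 < c" and k: "probability_density k"
    using positive_part_density_props[OF f pd] by (auto simp: c_def k_def)
  have [measurable]: "k \<in> borel_measurable borel" and k0: "\<And>x. 0 \<le> k x"
    using k by (auto simp: probability_density_def)
  have kf: "eventually (\<lambda>x. k x = f x / c) at_top"
    using eventually_ge_at_top[of 0] by eventually_elim (simp add: k_def positive_part_density_def c_def)
  have lim: "((\<lambda>x. k x / f x) \<longlongrightarrow> 1 / c) at_top"
    by (rule tendsto_eventually) (use kf regular_tail_pos[OF f] in \<open>eventually_elim, auto\<close>)
  have rk: "regular_tail k"
    using regular_tail_transfer[OF f lim] c k0 by simp
  have "subexponential_density k \<longleftrightarrow> small_middle k"
    by (rule subexponential_density_iff[OF rk k]) (simp add: k_def positive_part_density_def)
  also have "\<dots> \<longleftrightarrow> small_middle f"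
  proof
    have 1: "eventually (\<lambda>x. k x \<le> 1 / c * f x) at_top" and 2: "eventually (\<lambda>x. f x \<le> c * k x) at_top"
      using kf c by (auto elim: eventually_mono)
    show "small_middle f" if "small_middle k"
      by (rule small_middle_transfer[OF that _ _ _ _ 2 1]) (use c k0 in auto)
    show "small_middle k" if "small_middle f"
      by (rule small_middle_transfer[OF that _ _ _ _ 1 2]) (use c f0 in auto)
  qed
  finally show ?thesis
    using regular_tail_long_tailed[OF f pd] by (simp add: weakly_subexponential_density_def k_def)
qed

lemma asymptotic_to_nonincreasingD:
  assumes "asymptotic_to_nonincreasing h"
  shows "eventually (\<lambda>x. 0 < h x) at_top"
    and "0 < \<eta> \<Longrightarrow> \<exists>X. \<forall>w\<ge>X. \<forall>x\<ge>w. h x \<le> (1 + \<eta>) * h w"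
    and "almost_decreasing h"
proof -
  obtain x0 where x0: "\<And>x. x0 \<le> x \<Longrightarrow> 0 < h x" "bdd_above (h ` {x0..})"
    and eq: "(\<lambda>x. SUP t\<in>{x..}. h t) \<sim>[at_top] h"
    using assms unfolding asymptotic_to_nonincreasing_def by blast
  show pos: "eventually (\<lambda>x. 0 < h x) at_top" using x0(1) by (auto simp: eventually_at_top_linorder)
  have lim: "((\<lambda>x. (SUP t\<in>{x..}. h t) / h x) \<longlongrightarrow> 1) at_top"
    by (rule asymp_equivD_strong[OF eq]) (use pos in \<open>auto elim: eventually_mono\<close>)
  have mon: "\<exists>X. \<forall>w\<ge>X. \<forall>x\<ge>w. h x \<le> (1 + \<eta>) * h w" if "0 < \<eta>" for \<eta>
  proof -
    have "eventually (\<lambda>x. (SUP t\<in>{x..}. h t) \<le> (1 + \<eta>) * h x) at_top"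
      by (rule ratio_bounds(2)[OF lim pos]) (use that in simp)
    then obtain X where X: "\<And>w. X \<le> w \<Longrightarrow> (SUP t\<in>{w..}. h t) \<le> (1 + \<eta>) * h w"
      by (auto simp: eventually_at_top_linorder)
    have "h x \<le> (1 + \<eta>) * h w" if "max X x0 \<le> w" "w \<le> x" for w x
    proof -
      have "h x \<le> (SUP t\<in>{w..}. h t)"
        by (rule cSUP_upper) (use that in \<open>auto intro: bdd_above_mono[OF x0(2)]\<close>)
      with X[of w] that show ?thesis by auto
    qed
    then show ?thesis by blast
  qed
  show "0 < \<eta> \<Longrightarrow> \<exists>X. \<forall>w\<ge>X. \<forall>x\<ge>w. h x \<le> (1 + \<eta>) * h w" by (rule mon)
  obtain X where X: "\<And>w x. X \<le> w \<Longrightarrow> w \<le> x \<Longrightarrow> h x \<le> (1 + 1) * h w" using mon[of 1] by auto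
  then show "almost_decreasing h"
    unfolding almost_decreasing_def
    by (intro exI[of _ "max X 1"] conjI exI[of _ 2] allI impI) auto
qed

section \<open>Characteristic functions\<close>

text \<open>The Fourier transform of a function, as the characteristic function of the (not necessarily
  normalised) measure with that density.\<close>

abbreviation ft :: "(real \<Rightarrow> ennreal) \<Rightarrow> real \<Rightarrow> complex" where
  "ft w \<equiv> char (density lborel w)"

lemma density_enn2real:
  assumes [measurable]: "w \<in> borel_measurable borel" and w: "(\<integral>\<^sup>+x. w x \<partial>lborel) < \<infinity>"
  shows "AE x in lborel. w x = ennreal (enn2real (w x))"
    and "density lborel w = density lborel (\<lambda>x. ennreal (enn2real (w x)))"
    and "integrable lborel (\<lambda>x. enn2real (w x))"
    and "ennreal (\<integral>x. enn2real (w x) \<partial>lborel) = (\<integral>\<^sup>+x. w x \<partial>lborel)"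
proof -
  have "AE x in lborel. w x \<noteq> \<infinity>" using w by (intro nn_integral_PInf_AE) auto
  then show ae: "AE x in lborel. w x = ennreal (enn2real (w x))"
    by eventually_elim (simp add: less_top)
  show "density lborel w = density lborel (\<lambda>x. ennreal (enn2real (w x)))"
    by (rule density_cong) (use ae in auto)
  have eq: "(\<integral>\<^sup>+x. ennreal (enn2real (w x)) \<partial>lborel) = (\<integral>\<^sup>+x. w x \<partial>lborel)"
    by (rule nn_integral_cong_AE) (use ae in \<open>eventually_elim, simp\<close>)
  then show int: "integrable lborel (\<lambda>x. enn2real (w x))"
    using w by (intro integrableI_bounded) (simp_all del: ennreal_enn2real_if)
  show "ennreal (\<integral>x. enn2real (w x) \<partial>lborel) = (\<integral>\<^sup>+x. w x \<partial>lborel)"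
    unfolding eq[symmetric] by (rule nn_integral_eq_integral[symmetric, OF int]) auto
qed

lemma ft_eq_integral:
  assumes [measurable]: "w \<in> borel_measurable borel" and w: "(\<integral>\<^sup>+x. w x \<partial>lborel) < \<infinity>"
  shows "ft w z = (CLINT x|lborel. enn2real (w x) *\<^sub>R iexp (z * x))"
  unfolding char_def density_enn2real(2)[OF assms] by (subst integral_density) auto

lemma integrable_iexp:
  fixes h :: "real \<Rightarrow> real"
  assumes "integrable lborel h" shows "integrable lborel (\<lambda>x. h x *\<^sub>R iexp (z * x))"
  by (rule Bochner_Integration.integrable_bound[OF assms]) (use borel_measurable_integrable[OF assms] in auto)

lemma ft_nconv:
  assumes [measurable]: "u \<in> borel_measurable borel" "v \<in> borel_measurable borel"
    and u: "(\<integral>\<^sup>+x. u x \<partial>lborel) < \<infinity>" and v: "(\<integral>\<^sup>+x. v x \<partial>lborel) < \<infinity>"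
  shows "ft (nconv u v) z = ft u z * ft v z"
proof -
  define M where "M = density lborel u"
  define N where "N = density lborel v"
  have [measurable_cong, simp]: "sets M = sets borel" "sets N = sets borel" by (simp_all add: M_def N_def)
  have sp: "space M = UNIV" "space N = UNIV" by (simp_all add: M_def N_def)
  interpret M: finite_measure M by standard (use u in \<open>simp add: sp, simp add: M_def emeasure_density\<close>)
  interpret N: finite_measure N by standard (use v in \<open>simp add: sp, simp add: N_def emeasure_density\<close>)
  interpret P: pair_sigma_finite M N ..
  interpret P: finite_measure "M \<Otimes>\<^sub>M N" by (intro finite_measure_pair_measure) unfold_locales
  have eq: "density lborel (nconv u v) = distr (M \<Otimes>\<^sub>M N) borel (\<lambda>(x, y). x + y)"
    using convolution_density[of u v] M.finite_measure_axioms N.finite_measure_axioms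
    by (simp add: M_def N_def nconv_def[abs_def] convolution_def)
  have "ft (nconv u v) z = (CLINT p|M \<Otimes>\<^sub>M N. iexp (z * (fst p + snd p)))"
    unfolding char_def eq by (subst integral_distr) (auto simp: case_prod_unfold)
  also have "\<dots> = (CLINT p|M \<Otimes>\<^sub>M N. iexp (z * fst p) * iexp (z * snd p))"
    by (simp add: exp_add[symmetric] algebra_simps)
  also have "\<dots> = (CLINT x|M. CLINT y|N. iexp (z * x) * iexp (z * y))"
  proof -
    have "integrable (M \<Otimes>\<^sub>M N) (\<lambda>p. iexp (z * fst p) * iexp (z * snd p))"
      by (rule P.integrable_const_bound[where B=1]) (auto simp: norm_mult)
    from P.integral_fst'[OF this] show ?thesis by simp
  qed
  also have "\<dots> = ft u z * ft v z" by (simp add: char_def M_def N_def)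
  finally show ?thesis .
qed

lemma ft_cmult:
  assumes [measurable]: "u \<in> borel_measurable borel"
    and u: "(\<integral>\<^sup>+x. u x \<partial>lborel) < \<infinity>" and c: "0 \<le> c"
  shows "ft (\<lambda>x. ennreal c * u x) z = of_real c * ft u z"
proof -
  have fin: "(\<integral>\<^sup>+x. ennreal c * u x \<partial>lborel) < \<infinity>" using u by (simp add: nn_integral_cmult ennreal_mult_less_top)
  have "ft (\<lambda>x. ennreal c * u x) z = (CLINT x|lborel. c *\<^sub>R (enn2real (u x) *\<^sub>R iexp (z * x)))"
    by (subst ft_eq_integral[OF _ fin]) (auto simp: enn2real_mult c)
  also have "\<dots> = of_real c * ft u z"
    unfolding ft_eq_integral[OF assms(1) u] integral_scaleR_right by (rule scaleR_conv_of_real)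
  finally show ?thesis .
qed

lemma ft_suminf:
  fixes w :: "nat \<Rightarrow> real \<Rightarrow> ennreal"
  assumes [measurable]: "\<And>n. w n \<in> borel_measurable borel"
    and fin: "(\<integral>\<^sup>+x. (\<Sum>n. w n x) \<partial>lborel) < \<infinity>"
  shows "(\<lambda>n. ft (w n) z) sums ft (\<lambda>x. \<Sum>n. w n x) z"
proof -
  define W where "W x = (\<Sum>n. w n x)" for x
  have [measurable]: "W \<in> borel_measurable borel" unfolding W_def[abs_def] by measurable
  have Wfin: "(\<integral>\<^sup>+x. W x \<partial>lborel) < \<infinity>" using fin by (simp add: W_def)
  have le: "w n x \<le> W x" for n x
    using sum_le_suminf[of "\<lambda>n. w n x" "{n}"] by (simp add: W_def)
  have wfin: "(\<integral>\<^sup>+x. w n x \<partial>lborel) < \<infinity>" for n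
    by (rule le_less_trans[OF nn_integral_mono Wfin]) (rule le)
  define h where "h n x = enn2real (w n x)" for n x
  have hW: "AE x in lborel. (\<lambda>n. h n x) sums enn2real (W x)"
    using density_enn2real(1)[OF _ Wfin, simplified]
  proof eventually_elim
    case (elim x)
    then have "W x < top" by (metis ennreal_less_top)
    then have wx: "w n x = ennreal (h n x)" for n
      using le_less_trans[OF le] by (simp add: h_def)
    have "(\<lambda>n. ennreal (h n x)) sums ennreal (enn2real (W x))"
      unfolding wx[symmetric] elim[symmetric] unfolding W_def by (rule summable_sums) simp
    then show ?case
      using sums_ennreal[of "\<lambda>n. h n x" "enn2real (W x)"] by (simp add: h_def)
  qed
  have ih: "integrable lborel (h n)" for n
    unfolding h_def using density_enn2real(3)[OF _ wfin] by simp
  have "(\<lambda>n. CLINT x|lborel. h n x *\<^sub>R iexp (z * x)) sums (CLINT x|lborel. (\<Sum>n. h n x *\<^sub>R iexp (z * x)))"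
  proof (rule sums_integral)
    show "integrable lborel (\<lambda>x. h n x *\<^sub>R iexp (z * x))" for n by (rule integrable_iexp[OF ih])
    show "AE x in lborel. summable (\<lambda>n. norm (h n x *\<^sub>R iexp (z * x)))"
      using hW by eventually_elim (auto simp: h_def sums_iff)
    have "(\<Sum>n. ennreal (\<integral>x. h n x \<partial>lborel)) = (\<integral>\<^sup>+x. W x \<partial>lborel)"
      using density_enn2real(4)[OF _ wfin] unfolding W_def h_def by (simp add: nn_integral_suminf)
    then have "summable (\<lambda>n. \<integral>x. h n x \<partial>lborel)"
      using Wfin by (intro summable_suminf_not_top) (auto simp: h_def)
    then show "summable (\<lambda>n. \<integral>x. norm (h n x *\<^sub>R iexp (z * x)) \<partial>lborel)" by (simp add: h_def)
  qed
  also have "(CLINT x|lborel. (\<Sum>n. h n x *\<^sub>R iexp (z * x))) = (CLINT x|lborel. enn2real (W x) *\<^sub>R iexp (z * x))"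
  proof (rule integral_cong_AE)
    show "AE x in lborel. (\<Sum>n. h n x *\<^sub>R iexp (z * x)) = enn2real (W x) *\<^sub>R iexp (z * x)"
      using hW by eventually_elim (metis sums_scaleR_left sums_unique)
  qed (auto simp: h_def)
  also have "\<dots> = ft W z" by (simp add: ft_eq_integral[OF _ Wfin])
  finally show ?thesis
    using ft_eq_integral[OF _ wfin] by (simp add: h_def W_def[abs_def])
qed

lemma ft_nexp:
  assumes [measurable]: "u \<in> borel_measurable borel" "v \<in> borel_measurable borel"
    and u: "(\<integral>\<^sup>+x. u x \<partial>lborel) < \<infinity>" and v: "(\<integral>\<^sup>+x. v x \<partial>lborel) < \<infinity>"
  shows "ft (nexp v u) z = ft u z * exp (ft v z)"
proof -
  obtain l where l: "(\<integral>\<^sup>+x. v x \<partial>lborel) = ennreal l" "0 \<le> l"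
    using v by (cases "\<integral>\<^sup>+x. v x \<partial>lborel" rule: ennreal_cases) auto
  have cfin: "(\<integral>\<^sup>+x. cpow v n u x \<partial>lborel) < \<infinity>" for n
    using u by (simp add: nn_integral_cpow l ennreal_mult_less_top power_less_top_ennreal)
  have c: "ft (cpow v n u) z = ft u z * ft v z ^ n" for n
    by (induction n) (auto simp: ft_nconv[OF _ _ cfin v] mult_ac)
  have "(\<integral>\<^sup>+x. nexp v u x \<partial>lborel) < \<infinity>"
    using u by (simp add: nn_integral_nexp[OF _ _ l] ennreal_mult_less_top)
  then have "(\<lambda>n. ft (\<lambda>x. ennreal (1 / fact n) * cpow v n u x) z) sums ft (nexp v u) z"
    unfolding nexp_def[abs_def] by (intro ft_suminf) auto
  moreover have "ft (\<lambda>x. ennreal (1 / fact n) * cpow v n u x) z = ft u z * (ft v z ^ n /\<^sub>R fact n)" for n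
    by (subst ft_cmult[OF _ cfin]) (auto simp: c scaleR_conv_of_real divide_inverse)
  ultimately have "(\<lambda>n. ft u z * (ft v z ^ n /\<^sub>R fact n)) sums ft (nexp v u) z" by simp
  moreover have "(\<lambda>n. ft u z * (ft v z ^ n /\<^sub>R fact n)) sums (ft u z * exp (ft v z))"
    by (intro sums_mult exp_converges)
  ultimately show ?thesis by (rule sums_unique2)
qed

lemma ft_translate:
  assumes [measurable]: "u \<in> borel_measurable borel"
    and u: "(\<integral>\<^sup>+x. u x \<partial>lborel) < \<infinity>"
  shows "ft (\<lambda>x. u (x - a)) z = exp (\<i> * of_real a * of_real z) * ft u z"
proof -
  have "(\<integral>\<^sup>+x. u (x - a) \<partial>lborel) < \<infinity>" using u by (simp add: nn_integral_translate)
  then have "ft (\<lambda>x. u (x - a)) z = (CLINT x|lborel. enn2real (u (x - a)) *\<^sub>R iexp (z * x))"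
    by (subst ft_eq_integral) auto
  also have "\<dots> = (CLINT x|lborel. enn2real (u x) *\<^sub>R iexp (z * (a + x)))"
    by (subst lborel_integral_real_affine[where c=1 and t=a]) auto
  also have "\<dots> = (CLINT x|lborel. exp (\<i> * of_real a * of_real z) * (enn2real (u x) *\<^sub>R iexp (z * x)))"
    by (intro Bochner_Integration.integral_cong refl) (simp add: exp_add[symmetric] algebra_simps)
  also have "\<dots> = exp (\<i> * of_real a * of_real z) * ft u z"
    unfolding ft_eq_integral[OF assms(1) u] by (rule integral_mult_right_zero)
  finally show ?thesis .
qed

lemma normal_density_mass:
  assumes "0 < b"
  shows "(\<integral>\<^sup>+x. ennreal (normal_density m b x) \<partial>lborel) = 1"
proof -
  interpret prob_space "density lborel (normal_density m b)" using assms by (rule prob_space_normal_density)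
  show ?thesis using emeasure_space_1 by (simp add: emeasure_density)
qed

lemma ft_normal:
  assumes "0 < b"
  shows "ft (\<lambda>x. ennreal (normal_density 0 b x)) z = of_real (exp (- (b\<^sup>2 * z\<^sup>2 / 2)))"
proof -
  have n: "normal_density 0 b (b * x) = std_normal_density x / b" for x
    using assms by (simp add: normal_density_def real_sqrt_mult power_mult_distrib field_simps)
  have "ft (\<lambda>x. ennreal (normal_density 0 b x)) z = (CLINT x|lborel. normal_density 0 b x *\<^sub>R iexp (z * x))"
    unfolding char_def by (subst integral_density) auto
  also have "\<dots> = \<bar>b\<bar> *\<^sub>R (CLINT x|lborel. normal_density 0 b (0 + b * x) *\<^sub>R iexp (z * (0 + b * x)))"
    using assms by (intro lborel_integral_real_affine) auto
  also have "\<dots> = (CLINT x|lborel. b *\<^sub>R (normal_density 0 b (b * x) *\<^sub>R iexp (z * (b * x))))"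
    using assms by (simp only: integral_scaleR_right abs_of_pos add_0)
  also have "\<dots> = (CLINT x|lborel. std_normal_density x *\<^sub>R iexp ((z * b) * x))"
    using assms by (intro Bochner_Integration.integral_cong refl) (simp add: n mult.assoc)
  also have "\<dots> = char std_normal_distribution (z * b)"
    unfolding char_def by (subst integral_density) auto
  finally show ?thesis by (simp add: char_std_normal_distribution power_mult_distrib mult.commute)
qed

lemma normal_density_tilt:
  assumes "0 < b"
  shows "normal_density 0 b x * exp (\<gamma> * x) = exp (\<gamma>\<^sup>2 * b\<^sup>2 / 2) * normal_density (\<gamma> * b\<^sup>2) b x"
proof -
  have "- x\<^sup>2 / (2 * b\<^sup>2) + \<gamma> * x = \<gamma>\<^sup>2 * b\<^sup>2 / 2 + - (x - \<gamma> * b\<^sup>2)\<^sup>2 / (2 * b\<^sup>2)"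
    using assms by (simp add: field_simps power2_eq_square)
  then have "exp (- x\<^sup>2 / (2 * b\<^sup>2)) * exp (\<gamma> * x) = exp (\<gamma>\<^sup>2 * b\<^sup>2 / 2) * exp (- (x - \<gamma> * b\<^sup>2)\<^sup>2 / (2 * b\<^sup>2))"
    by (simp only: exp_add[symmetric])
  then show ?thesis by (simp add: normal_density_def mult_ac)
qed

lemma light_tail_normal:
  assumes u: "light_tail \<gamma> u" and b: "0 < b"
  shows "light_tail \<gamma> (nconv u (\<lambda>x. ennreal (normal_density 0 b x)))"
proof -
  define E where "E = exp (\<gamma>\<^sup>2 * b\<^sup>2 / 2)"
  have t: "ennreal (normal_density 0 b x) * ennreal (exp (\<gamma> * x)) = ennreal E * ennreal (normal_density (\<gamma> * b\<^sup>2) b x)" for x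
    using normal_density_tilt[OF b, of x \<gamma>] by (simp add: E_def ennreal_mult[symmetric] normal_density_nonneg)
  define L where "L = ennreal E * max 1 (ennreal (1 / sqrt (2 * pi * b\<^sup>2)))"
  show ?thesis
  proof (rule light_tail_nconv[OF u, where L=L])
    show "(\<integral>\<^sup>+x. ennreal (normal_density 0 b x) * ennreal (exp (\<gamma> * x)) \<partial>lborel) \<le> L"
      unfolding t L_def using mult_left_mono[of 1 "max 1 (ennreal (1 / sqrt (2 * pi * b\<^sup>2)))" "ennreal E"]
      by (subst nn_integral_cmult) (auto simp: normal_density_mass[OF b])
    show "ennreal (normal_density 0 b x) * ennreal (exp (\<gamma> * x)) \<le> L" for x
      unfolding t L_def
    proof (intro mult_left_mono)
      have "normal_density (\<gamma> * b\<^sup>2) b x \<le> 1 / sqrt (2 * pi * b\<^sup>2)"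
        unfolding normal_density_def by (rule mult_left_le) auto
      then show "ennreal (normal_density (\<gamma> * b\<^sup>2) b x) \<le> max 1 (ennreal (1 / sqrt (2 * pi * b\<^sup>2)))"
        by (intro max.coboundedI2 ennreal_leI)
    qed simp
    show "L < \<infinity>" by (simp add: L_def ennreal_mult_less_top)
  qed (auto simp: normal_density_mass[OF b])
qed

lemma light_tail_translate:
  assumes u: "light_tail \<gamma> u" shows "light_tail \<gamma> (\<lambda>x. u (x - a))"
proof -
  have [measurable]: "u \<in> borel_measurable borel" and ui: "(\<integral>\<^sup>+x. u x \<partial>lborel) < \<infinity>"
    using u by (auto simp: light_tail_def)
  obtain c W where W: "W < \<infinity>" "(\<integral>\<^sup>+x. u x * ennreal (exp (\<gamma> * x)) \<partial>lborel) \<le> W"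
    "\<And>x. c \<le> x \<Longrightarrow> u x * ennreal (exp (\<gamma> * x)) \<le> W" using u unfolding light_tail_def by blast
  define E where "E = ennreal (exp (\<gamma> * a))"
  have e: "u (x - a) * ennreal (exp (\<gamma> * x)) = u (x - a) * ennreal (exp (\<gamma> * (x - a))) * E" for x
    by (simp add: E_def mult.assoc ennreal_mult[symmetric] exp_add[symmetric] algebra_simps)
  have "(\<integral>\<^sup>+x. u (x - a) * ennreal (exp (\<gamma> * x)) \<partial>lborel) = (\<integral>\<^sup>+x. u x * ennreal (exp (\<gamma> * x)) \<partial>lborel) * E"
    unfolding e by (subst nn_integral_multc) (auto simp: nn_integral_translate[where u="\<lambda>x. u x * ennreal (exp (\<gamma> * x))"])
  then have "(\<integral>\<^sup>+x. u (x - a) * ennreal (exp (\<gamma> * x)) \<partial>lborel) \<le> W * E"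
    using W(2) by (simp add: mult_right_mono)
  moreover have "u (x - a) * ennreal (exp (\<gamma> * x)) \<le> W * E" if "c + a \<le> x" for x
    unfolding e using W(3)[of "x - a"] that by (intro mult_right_mono) auto
  moreover have "W * E < \<infinity>" using W(1) by (simp add: E_def ennreal_mult_less_top)
  ultimately show ?thesis
    unfolding light_tail_def using ui by (auto simp: nn_integral_translate intro!: exI[of _ "c + a"] exI[of _ "W * E"])
qed

lemma light_tail_cmult:
  assumes u: "light_tail \<gamma> u" and "c < \<infinity>" shows "light_tail \<gamma> (\<lambda>x. c * u x)"
proof -
  have [measurable]: "u \<in> borel_measurable borel" and ui: "(\<integral>\<^sup>+x. u x \<partial>lborel) < \<infinity>"
    using u by (auto simp: light_tail_def)
  obtain a W where W: "W < \<infinity>" "(\<integral>\<^sup>+x. u x * ennreal (exp (\<gamma> * x)) \<partial>lborel) \<le> W"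
    "\<And>x. a \<le> x \<Longrightarrow> u x * ennreal (exp (\<gamma> * x)) \<le> W" using u unfolding light_tail_def by blast
  have "(\<integral>\<^sup>+x. c * u x * ennreal (exp (\<gamma> * x)) \<partial>lborel) \<le> c * W"
    using W(2) by (simp add: mult.assoc nn_integral_cmult mult_left_mono)
  moreover have "c * u x * ennreal (exp (\<gamma> * x)) \<le> c * W" if "a \<le> x" for x
    using W(3)[OF that] by (simp add: mult.assoc mult_left_mono)
  ultimately show ?thesis
    unfolding light_tail_def using ui W(1) \<open>c < \<infinity>\<close>
    by (intro conjI exI[of _ a] exI[of _ "c * W"]) (auto simp: nn_integral_cmult ennreal_mult_less_top)
qed

text \<open>Halving the exponent makes the exponential moment finite.\<close>

lemma light_tailI:
  assumes [measurable]: "h \<in> borel_measurable borel" and h0: "\<And>x. 0 \<le> h x"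
    and mass: "(\<integral>\<^sup>+x. ennreal (h x) \<partial>lborel) < \<infinity>"
    and lim: "((\<lambda>x. exp (\<gamma> * x) * h x) \<longlongrightarrow> 0) at_top" and "0 < \<gamma>"
  shows "light_tail (\<gamma> / 2) (\<lambda>x. ennreal (h x))"
proof -
  have "eventually (\<lambda>x. exp (\<gamma> * x) * h x < 1) at_top" using lim by (rule order_tendstoD) simp
  then obtain a0 where a0: "\<And>x. a0 \<le> x \<Longrightarrow> exp (\<gamma> * x) * h x < 1" by (auto simp: eventually_at_top_linorder)
  define a where "a = max a0 0"
  have b: "h x * exp (\<gamma> / 2 * x) \<le> exp (- (\<gamma> / 2) * x)" if "a \<le> x" for x
  proof -
    have "h x * exp (\<gamma> / 2 * x) = (exp (\<gamma> * x) * h x) * exp (- (\<gamma> / 2) * x)"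
      by (simp add: mult_ac exp_add[symmetric])
    also have "\<dots> \<le> 1 * exp (- (\<gamma> / 2) * x)" using a0[of x] that by (intro mult_right_mono) (auto simp: a_def)
    finally show ?thesis by simp
  qed
  define W where "W = ennreal (exp (\<gamma> / 2 * a)) * (\<integral>\<^sup>+x. ennreal (h x) \<partial>lborel) + ennreal (2 / \<gamma>) + 1"
  have "(\<integral>\<^sup>+x. ennreal (h x) * ennreal (exp (\<gamma> / 2 * x)) \<partial>lborel)
      \<le> (\<integral>\<^sup>+x. ennreal (exp (\<gamma> / 2 * a)) * ennreal (h x) + ennreal (exp (- (\<gamma> / 2) * x)) * indicator {0..} x \<partial>lborel)"
  proof (rule nn_integral_mono)
    fix x
    show "ennreal (h x) * ennreal (exp (\<gamma> / 2 * x))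
        \<le> ennreal (exp (\<gamma> / 2 * a)) * ennreal (h x) + ennreal (exp (- (\<gamma> / 2) * x)) * indicator {0..} x"
    proof (cases "a \<le> x")
      case True
      then have "0 \<le> x" by (simp add: a_def)
      then show ?thesis using b[OF True] h0
        by (intro add_increasing) (auto simp: ennreal_mult[symmetric] intro!: ennreal_leI)
    next
      case False
      then have "h x * exp (\<gamma> / 2 * x) \<le> exp (\<gamma> / 2 * a) * h x"
        using h0[of x] \<open>0 < \<gamma>\<close> by (subst mult.commute) (intro mult_right_mono, auto)
      then show ?thesis using h0
        by (intro add_increasing2) (auto simp: ennreal_mult[symmetric] intro!: ennreal_leI)
    qed
  qed
  also have "\<dots> = ennreal (exp (\<gamma> / 2 * a)) * (\<integral>\<^sup>+x. ennreal (h x) \<partial>lborel)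
      + (\<integral>\<^sup>+x. ennreal (exp (- (\<gamma> / 2) * x)) * indicator {0..} x \<partial>lborel)"
    by (simp add: nn_integral_add nn_integral_cmult)
  also have "(\<integral>\<^sup>+x. ennreal (exp (- (\<gamma> / 2) * x)) * indicator {0..} x \<partial>lborel) = ennreal (2 / \<gamma>)"
  proof -
    have "(\<integral>\<^sup>+x. ennreal (exp (- (\<gamma> / 2) * x)) * indicator {0..} x \<partial>lborel)
        = ennreal (0 - - (2 / \<gamma>) * exp (- (\<gamma> / 2) * 0))"
    proof (rule nn_integral_FTC_atLeast)
      show "((\<lambda>x. - (2 / \<gamma>) * exp (- (\<gamma> / 2) * x)) \<longlongrightarrow> 0) at_top" using \<open>0 < \<gamma>\<close> by real_asymp
      show "((\<lambda>x. - (2 / \<gamma>) * exp (- (\<gamma> / 2) * x)) has_real_derivative exp (- (\<gamma> / 2) * x)) (at x)" for x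
        using \<open>0 < \<gamma>\<close> by (auto intro!: derivative_eq_intros)
    qed auto
    then show ?thesis by simp
  qed
  finally have "(\<integral>\<^sup>+x. ennreal (h x) * ennreal (exp (\<gamma> / 2 * x)) \<partial>lborel) \<le> W"
    unfolding W_def by (rule order_trans) simp
  moreover have "ennreal (h x) * ennreal (exp (\<gamma> / 2 * x)) \<le> W" if "a \<le> x" for x
  proof -
    have "0 \<le> x" using that by (simp add: a_def)
    then have "exp (- (\<gamma> / 2) * x) \<le> 1" using \<open>0 < \<gamma>\<close> by simp
    then have "ennreal (h x) * ennreal (exp (\<gamma> / 2 * x)) \<le> 1"
      using order_trans[OF b[OF that]] h0 by (simp add: ennreal_mult[symmetric])
    also have "1 \<le> W" by (simp add: W_def)
    finally show ?thesis .
  qed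
  moreover have "W < \<infinity>" using mass by (simp add: W_def ennreal_mult_less_top)
  ultimately show ?thesis
    unfolding light_tail_def using mass by (intro conjI exI[of _ a] exI[of _ W]) auto
qed

section \<open>Infinitely divisible distributions\<close>

text \<open>Jumps larger than 1 in absolute value need no compensation and contribute a compound Poisson factor.\<close>

lemma levy_exponent_split:
  assumes [measurable]: "g \<in> borel_measurable borel" and g0: "\<And>x. 0 \<le> g x"
    and nu: "\<nu> = density lborel (\<lambda>x. ennreal (g x))"
    and fin: "(\<integral>\<^sup>+x. ennreal (min 1 (x\<^sup>2)) \<partial>\<nu>) < \<infinity>"
    and lam: "(\<integral>\<^sup>+y. (if 1 < \<bar>y\<bar> then ennreal (g y) else 0) \<partial>lborel) = ennreal lam" "0 \<le> lam"
  shows "(CLINT y|\<nu>. iexp (z * y) - 1 - \<i> * of_real z * of_real y * indicator {y. \<bar>y\<bar> \<le> 1} y)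
    = (CLBINT y:{-1..1}. (iexp (z * y) - 1 - \<i> * of_real z * of_real y) * of_real (g y))
      + (ft (\<lambda>y. if 1 < \<bar>y\<bar> then ennreal (g y) else 0) z - of_real lam)"
proof -
  define v where "v y = (if 1 < \<bar>y\<bar> then ennreal (g y) else 0)" for y
  have [measurable]: "v \<in> borel_measurable borel" unfolding v_def[abs_def] by (intro measurable_If) auto
  have vr: "enn2real (v y) = (if 1 < \<bar>y\<bar> then g y else 0)" for y using g0 by (simp add: v_def)
  have vfin: "(\<integral>\<^sup>+y. v y \<partial>lborel) < \<infinity>" using lam by (simp add: v_def)
  have iv: "integrable lborel (\<lambda>y. enn2real (v y))" by (rule density_enn2real(3)[OF _ vfin]) simp
  have vint: "(\<integral>y. enn2real (v y) \<partial>lborel) = lam"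
    using density_enn2real(4)[OF _ vfin] lam by (simp add: v_def[symmetric] integral_nonneg_AE)
  define S where "S y = indicator {-1..1} y *\<^sub>R ((iexp (z * y) - 1 - \<i> * of_real z * of_real y) * of_real (g y))" for y :: real
  define T where "T y = enn2real (v y) *\<^sub>R iexp (z * y) - of_real (enn2real (v y))" for y :: real
  have iT: "integrable lborel T"
    unfolding T_def by (intro Bochner_Integration.integrable_diff integrable_iexp integrable_of_real iv)
  have iS: "integrable lborel S"
  proof (rule Bochner_Integration.integrable_bound)
    have "(\<integral>\<^sup>+x. ennreal (g x * min 1 (x\<^sup>2)) \<partial>lborel) < \<infinity>"
      using fin g0 unfolding nu by (subst (asm) nn_integral_density) (auto simp: ennreal_mult)
    then have "integrable lborel (\<lambda>x. g x * min 1 (x\<^sup>2))"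
      using g0 by (intro integrableI_bounded) auto
    then show "integrable lborel (\<lambda>x. z\<^sup>2 / 2 * (g x * min 1 (x\<^sup>2)))" by (rule integrable_mult_right)
    show "S \<in> borel_measurable lborel" unfolding S_def[abs_def] by measurable
    show "AE x in lborel. norm (S x) \<le> norm (z\<^sup>2 / 2 * (g x * min 1 (x\<^sup>2)))"
    proof (rule AE_I2)
      fix x
      have "cmod (iexp (z * x) - 1 - \<i> * of_real z * of_real x) \<le> (z * x)\<^sup>2 / 2"
        using iexp_approx1[of "z * x" 1] by (simp add: diff_diff_eq mult.assoc power2_eq_square abs_mult[symmetric] numeral_2_eq_2)
      then have "cmod (iexp (z * x) - 1 - \<i> * of_real z * of_real x) * g x \<le> (z * x)\<^sup>2 / 2 * g x"
        by (rule mult_right_mono) (rule g0)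
      moreover have "x\<^sup>2 \<le> 1" if "x \<in> {-1..1}" using that by (simp add: abs_square_le_1 abs_le_iff)
      ultimately show "norm (S x) \<le> norm (z\<^sup>2 / 2 * (g x * min 1 (x\<^sup>2)))"
        using g0[of x] by (auto simp: S_def indicator_def norm_mult power_mult_distrib mult_ac min_absorb2)
    qed
  qed
  have "(CLINT y|\<nu>. iexp (z * y) - 1 - \<i> * of_real z * of_real y * indicator {y. \<bar>y\<bar> \<le> 1} y)
      = (CLINT y|lborel. g y *\<^sub>R (iexp (z * y) - 1 - \<i> * of_real z * of_real y * indicator {y. \<bar>y\<bar> \<le> 1} y))"
    unfolding nu by (rule integral_density) (use g0 in auto)
  also have "\<dots> = (CLINT y|lborel. S y + T y)"
    by (intro Bochner_Integration.integral_cong refl)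
      (auto simp: S_def T_def vr indicator_def scaleR_conv_of_real algebra_simps abs_le_iff)
  also have "\<dots> = (CLINT y|lborel. S y) + (CLINT y|lborel. T y)"
    by (rule Bochner_Integration.integral_add[OF iS iT])
  also have "(CLINT y|lborel. T y) = ft v z - of_real lam"
    unfolding T_def Bochner_Integration.integral_diff[OF integrable_iexp[OF iv] integrable_of_real[OF iv]]
    by (simp add: ft_eq_integral[OF _ vfin] vint)
  finally show ?thesis by (simp add: S_def set_lebesgue_integral_def v_def[abs_def])
qed

theorem theorem3p2:
  fixes \<mu> \<mu>0 \<nu> :: "real measure" and g g1 f0 :: "real \<Rightarrow> real"
  assumes mu: "infinitely_divisible \<mu>" "has_levy_measure \<mu> \<nu>"
    and nu: "density_of \<nu> g" "emeasure \<nu> UNIV = \<infinity>" "emeasure \<nu> {1<..} > 0"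
    and mu0: "infinitely_divisible \<mu>0"
      "\<And>z. char \<mu>0 z =
         exp (CLBINT y:{-1..1}. (iexp (z * y) - 1 - \<i> * of_real z * of_real y) * of_real (g y))"
    and f0: "density_of \<mu>0 f0"
    and g1: "g1 = (\<lambda>x. indicator {1<..} x * g x / measure \<nu> {1<..})" "bounded (range g1)"
    and light: "\<exists>\<gamma>>0. ((\<lambda>x. exp (\<gamma> * x) * f0 x) \<longlongrightarrow> 0) at_top"
  shows
    "(asymptotic_to_nonincreasing g \<longrightarrow>
       (\<exists>f. density_of \<mu> f \<and>
          ((weakly_subexponential_density f \<and> almost_decreasing f) \<longleftrightarrow>
             weakly_subexponential_density g1) \<and>
          (weakly_subexponential_density g1 \<longleftrightarrow>
             (long_tailed_density g1 \<and>
               ((\<lambda>x. f x / g1 x) \<longlongrightarrow> measure \<nu> {1<..}) at_top))))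
     \<and>
     (almost_decreasing g \<longrightarrow>
       (\<exists>f. density_of \<mu> f \<and>
          (weakly_subexponential_density g1 \<longleftrightarrow>
             (long_tailed_density g1 \<and>
               ((\<lambda>x. f x / g1 x) \<longlongrightarrow> measure \<nu> {1<..}) at_top)) \<and>
          (weakly_subexponential_density g1 \<longrightarrow>
             (weakly_subexponential_density f \<and> almost_decreasing f))))"
proof -
  have g_meas [measurable]: "g \<in> borel_measurable borel" and g0: "\<And>x. 0 \<le> g x"
    and nu_eq: "\<nu> = density lborel (\<lambda>x. ennreal (g x))"
    using nu(1) by (auto simp: density_of_def)
  have f0_meas [measurable]: "f0 \<in> borel_measurable borel" and f00: "\<And>x. 0 \<le> f0 x"
    and mu0_eq: "\<mu>0 = density lborel (\<lambda>x. ennreal (f0 x))"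
    using f0 by (auto simp: density_of_def)
  obtain \<gamma> where gam: "0 < \<gamma>" "((\<lambda>x. exp (\<gamma> * x) * f0 x) \<longlongrightarrow> 0) at_top" using light by auto
  have lfin: "(\<integral>\<^sup>+x. ennreal (min 1 (x\<^sup>2)) \<partial>\<nu>) < \<infinity>"
    using mu(2) by (auto simp: has_levy_measure_def levy_measure_def)
  obtain a b where b: "0 \<le> b" and mu_char: "\<And>z. char \<mu> z =
      exp ((CLINT y|\<nu>. iexp (z * y) - 1 - \<i> * of_real z * of_real y * indicator {y. \<bar>y\<bar> \<le> 1} y)
        + \<i> * of_real a * of_real z - of_real (b\<^sup>2 * z\<^sup>2 / 2))"
    using mu(2) unfolding has_levy_measure_def by blast
  interpret mu0: real_distribution \<mu>0 using mu0(1) by (simp add: infinitely_divisible_def)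
  interpret mu: real_distribution \<mu> using mu(1) by (simp add: infinitely_divisible_def)
  have f0_mass: "(\<integral>\<^sup>+x. ennreal (f0 x) \<partial>lborel) = 1"
    using mu0.emeasure_space_1 by (simp add: mu0_eq emeasure_density)
  define v where "v = (\<lambda>y. if 1 < \<bar>y\<bar> then ennreal (g y) else 0)"
  have v_meas [measurable]: "v \<in> borel_measurable borel" unfolding v_def by (intro measurable_If) auto
  have "(\<integral>\<^sup>+y. v y \<partial>lborel) \<le> (\<integral>\<^sup>+x. ennreal (g x) * ennreal (min 1 (x\<^sup>2)) \<partial>lborel)"
  proof (rule nn_integral_mono)
    fix y :: real
    have "min 1 (y\<^sup>2) = 1" if "1 < \<bar>y\<bar>" using that one_le_power[of "\<bar>y\<bar>" 2] by (simp add: min_def)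
    then show "v y \<le> ennreal (g y) * ennreal (min 1 (y\<^sup>2))" by (auto simp: v_def)
  qed
  also have "\<dots> < \<infinity>" using lfin unfolding nu_eq by (subst (asm) nn_integral_density) auto
  finally have v_fin: "(\<integral>\<^sup>+y. v y \<partial>lborel) < \<infinity>" .
  define lam where "lam = enn2real (\<integral>\<^sup>+y. v y \<partial>lborel)"
  have lam: "(\<integral>\<^sup>+y. v y \<partial>lborel) = ennreal lam" "0 \<le> lam" using v_fin by (auto simp: lam_def)
  define c where "c = measure \<nu> {1<..}"
  have em: "emeasure \<nu> {1<..} = (\<integral>\<^sup>+x. ennreal (g x) * indicator {1<..} x \<partial>lborel)"
    unfolding nu_eq by (rule emeasure_density) auto
  also have "\<dots> \<le> (\<integral>\<^sup>+y. v y \<partial>lborel)" by (intro nn_integral_mono) (auto simp: v_def indicator_def)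
  finally have em_fin: "emeasure \<nu> {1<..} < \<infinity>" using v_fin by (rule le_less_trans)
  have c_eq: "emeasure \<nu> {1<..} = ennreal c"
    using em_fin by (simp add: c_def measure_def)
  have c: "0 < c" using nu(3) by (simp add: c_eq)
  have g1_eq: "g1 x = indicator {1<..} x * g x / c" for x by (simp add: g1(1) c_def)
  have g1_meas [measurable]: "g1 \<in> borel_measurable borel" unfolding g1(1) by measurable
  have g10: "0 \<le> g1 x" for x using g0 c by (simp add: g1_eq)
  have g_bdd: "\<exists>B. \<forall>x>1. g x \<le> B"
  proof -
    obtain B where B: "\<And>x. norm (g1 x) \<le> B" using g1(2) by (auto simp: bounded_iff)
    have "g x \<le> c * B" if "1 < x" for x
      using B[of x] that c g0[of x] by (simp add: g1_eq field_simps)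
    then show ?thesis by blast
  qed
  \<comment> \<open>A Gaussian component smooths \<open>f0\<close>; without one (\<open>b = 0\<close>) there is no normal density to convolve with.\<close>
  define w where "w = (if b = 0 then (\<lambda>x. ennreal (f0 x)) else nconv (\<lambda>x. ennreal (f0 x)) (\<lambda>x. ennreal (normal_density 0 b x)))"
  have lf0: "light_tail (\<gamma> / 2) (\<lambda>x. ennreal (f0 x))"
    by (rule light_tailI[OF f0_meas f00 _ gam(2,1)]) (simp add: f0_mass)
  have w_light: "light_tail (\<gamma> / 2) w"
    using lf0 light_tail_normal[OF lf0, of b] b by (simp add: w_def)
  then have w_meas [measurable]: "w \<in> borel_measurable borel" by (rule light_tail_measurable)
  have w_mass: "(\<integral>\<^sup>+x. w x \<partial>lborel) = 1"
    using b by (simp add: w_def f0_mass nn_integral_nconv normal_density_mass)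
  have w_ft: "ft w z = char \<mu>0 z * of_real (exp (- (b\<^sup>2 * z\<^sup>2 / 2)))" for z
    using b by (simp add: w_def mu0_eq ft_nconv f0_mass normal_density_mass ft_normal)
  define u where "u x = ennreal (exp (- lam)) * w (x - a)" for x
  have u_light: "light_tail (\<gamma> / 2) u"
    unfolding u_def[abs_def] by (intro light_tail_cmult light_tail_translate w_light) simp
  then have u_meas [measurable]: "u \<in> borel_measurable borel" by (rule light_tail_measurable)
  have u_mass: "(\<integral>\<^sup>+x. u x \<partial>lborel) = ennreal (exp (- lam))"
    by (simp add: u_def nn_integral_cmult nn_integral_translate w_mass)
  have u_ft: "ft u z = of_real (exp (- lam)) * (exp (\<i> * of_real a * of_real z) * ft w z)" for z
    unfolding u_def[abs_def] by (subst ft_cmult) (auto simp: ft_translate nn_integral_translate w_mass)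
  define F where "F = nexp v u"
  define f where "f = (\<lambda>x. enn2real (F x))"
  interpret P: perturbed_exponential g u "\<gamma> / 2" lam v F f
    by unfold_locales (use v_def F_def f_def g0 g_bdd lam gam u_light u_mass in auto)
  have F_mass: "(\<integral>\<^sup>+x. F x \<partial>lborel) = 1" by (rule P.F_mass)
  have dens: "density lborel F = density lborel (\<lambda>x. ennreal (f x))"
    unfolding f_def by (rule density_enn2real(2)) (auto simp: F_mass)
  have pF: "prob_space (density lborel F)"
    by (intro prob_spaceI) (simp add: emeasure_density F_mass)
  have F_ft: "ft F z = char \<mu> z" for z
  proof -
    have "ft F z = ft u z * exp (ft v z)"
      unfolding F_def by (rule ft_nexp) (auto simp: u_mass lam)
    also have "\<dots> = exp ((CLBINT y:{-1..1}. (iexp (z * y) - 1 - \<i> * of_real z * of_real y) * of_real (g y))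
        + (ft v z - of_real lam) + \<i> * of_real a * of_real z - of_real (b\<^sup>2 * z\<^sup>2 / 2))"
      unfolding u_ft w_ft mu0(2) exp_of_real[symmetric] exp_add[symmetric]
      by (rule arg_cong[where f=exp]) simp
    also have "\<dots> = char \<mu> z"
      unfolding mu_char v_def by (subst levy_exponent_split[OF g_meas g0 nu_eq lfin lam[unfolded v_def]]) simp
    finally show ?thesis .
  qed
  have mu_eq: "\<mu> = density lborel (\<lambda>x. ennreal (f x))"
  proof (rule Levy_uniqueness)
    show "real_distribution (density lborel (\<lambda>x. ennreal (f x)))"
      using pF unfolding dens by (simp add: real_distribution_def real_distribution_axioms_def)
    show "char \<mu> = char (density lborel (\<lambda>x. ennreal (f x)))"
      using F_ft by (auto simp: dens)
  qed unfold_locales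
  have dens_f: "density_of \<mu> f"
    using mu_eq P.f_meas P.f_nonneg by (simp add: density_of_def)
  have pd_f: "probability_density f"
    using pF P.f_meas P.f_nonneg by (simp add: probability_density_def dens)
  have pd_g1: "probability_density g1"
  proof -
    have "emeasure (density lborel (\<lambda>x. ennreal (g1 x))) UNIV = (\<integral>\<^sup>+x. ennreal (1 / c) * (ennreal (g x) * indicator {1<..} x) \<partial>lborel)"
      using c g0 by (subst emeasure_density) (auto intro!: nn_integral_cong simp: g1_eq indicator_def ennreal_mult[symmetric])
    also have "\<dots> = ennreal (1 / c) * ennreal c" unfolding c_eq[symmetric] em by (rule nn_integral_cmult) measurable
    also have "\<dots> = 1" using c by (simp add: ennreal_mult[symmetric])
    finally have "prob_space (density lborel (\<lambda>x. ennreal (g1 x)))" by (intro prob_spaceI) simp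
    then show ?thesis using g10 by (simp add: probability_density_def)
  qed
  have g1_ev: "eventually (\<lambda>x. g1 x = g x / c) at_top"
    using eventually_gt_at_top[of 1] by eventually_elim (simp add: g1_eq)
  have lim_iff: "((\<lambda>x. f x / g1 x) \<longlongrightarrow> c) at_top \<longleftrightarrow> ((\<lambda>x. f x / g x) \<longlongrightarrow> 1) at_top"
  proof -
    have "eventually (\<lambda>x. c * (f x / g x) = f x / g1 x) at_top"
      using g1_ev by eventually_elim (simp add: mult.commute)
    then have "((\<lambda>x. f x / g1 x) \<longlongrightarrow> c) at_top \<longleftrightarrow> ((\<lambda>x. c * (f x / g x)) \<longlongrightarrow> c) at_top"
      by (rule tendsto_cong[symmetric])
    also have "\<dots> \<longleftrightarrow> ((\<lambda>x. f x / g x) \<longlongrightarrow> 1) at_top"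
      using tendsto_mult_left_iff[of c "\<lambda>x. f x / g x" 1 at_top] c by simp
    finally show ?thesis .
  qed
  have reg_g1: "regular_tail g1" if g: "regular_tail g"
  proof (rule regular_tail_transfer[OF g _ _ g1_meas g10])
    show "((\<lambda>x. g1 x / g x) \<longlongrightarrow> 1 / c) at_top"
      by (rule tendsto_eventually) (use g1_ev regular_tail_pos[OF g] in \<open>eventually_elim, auto\<close>)
  qed (use c in simp)
  have reg_g: "regular_tail g" if ad: "almost_decreasing g" and lt: "long_tailed_density g1"
  proof -
    obtain x0 K where K: "0 < x0" "0 < K" "\<And>x y. x0 < x \<Longrightarrow> 0 < y \<Longrightarrow> g (x + y) \<le> K * g x"
      using ad unfolding almost_decreasing_def by blast
    have "g1 (x + y) \<le> K * g1 x" if "max x0 1 < x" "0 < y" for x y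
      using K(3)[of x y] that c by (simp add: g1_eq divide_right_mono)
    then have "almost_decreasing g1"
      unfolding almost_decreasing_def using K by (intro exI[of _ "max x0 1"] conjI exI[of _ K]) auto
    then have g1r: "regular_tail g1" by (rule regular_tailI[OF lt])
    show ?thesis
    proof (rule regular_tail_transfer[OF g1r _ c g_meas g0])
      show "((\<lambda>x. g x / g1 x) \<longlongrightarrow> c) at_top"
      proof (rule tendsto_eventually)
        show "eventually (\<lambda>x. g x / g1 x = c) at_top"
          using g1_ev regular_tail_pos[OF g1r] by eventually_elim (use c in auto)
      qed
    qed
  qed
  have g1_iff: "weakly_subexponential_density g1 \<longleftrightarrow> small_middle g" if g: "regular_tail g"
  proof -
    have 1: "eventually (\<lambda>x. g1 x \<le> 1 / c * g x) at_top" and 2: "eventually (\<lambda>x. g x \<le> c * g1 x) at_top"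
      using g1_ev c by (auto elim: eventually_mono)
    have "small_middle g" if "small_middle g1"
      by (rule small_middle_transfer[OF that g1_meas _ _ g10 2 1]) (use c in auto)
    moreover have "small_middle g1" if "small_middle g"
      by (rule small_middle_transfer[OF that g_meas _ _ g0 1 2]) (use c in auto)
    ultimately show ?thesis using weakly_subexponential_iff[OF reg_g1[OF g] pd_g1] by blast
  qed
  have eqv: "weakly_subexponential_density g1 \<longleftrightarrow> long_tailed_density g1 \<and> ((\<lambda>x. f x / g1 x) \<longlongrightarrow> c) at_top"
    if ad: "almost_decreasing g"
  proof -
    have "weakly_subexponential_density g1 \<longleftrightarrow> long_tailed_density g1 \<and> weakly_subexponential_density g1"
      by (auto simp: weakly_subexponential_density_def)
    moreover have "weakly_subexponential_density g1 \<longleftrightarrow> ((\<lambda>x. f x / g1 x) \<longlongrightarrow> c) at_top"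
      if "long_tailed_density g1"
    proof -
      note g = reg_g[OF ad that]
      show ?thesis
        unfolding g1_iff[OF g] lim_iff
        using P.density_asymp_if_subexponential[OF g] P.small_middle_if_density_asymp[OF g] by (rule iffI)
    qed
    ultimately show ?thesis by blast
  qed
  have f_if_g1: "weakly_subexponential_density f \<and> almost_decreasing f"
    if ad: "almost_decreasing g" and ws: "weakly_subexponential_density g1"
  proof -
    have g: "regular_tail g" using reg_g[OF ad] ws by (simp add: weakly_subexponential_density_def)
    then have sm: "small_middle g" using g1_iff ws by blast
    then have lim: "((\<lambda>x. f x / g x) \<longlongrightarrow> 1) at_top" by (rule P.density_asymp_if_subexponential[OF g])
    have rf: "regular_tail f"
      using regular_tail_transfer[OF g lim] P.f_meas P.f_nonneg by simp
    have "eventually (\<lambda>x. f x \<le> 2 * g x) at_top"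
      by (rule ratio_bounds(2)[OF lim regular_tail_pos[OF g]]) simp
    moreover have "eventually (\<lambda>x. g x \<le> 2 * f x) at_top"
      using ratio_bounds(1)[OF lim regular_tail_pos[OF g], of "1/2"] by (auto elim: eventually_mono)
    ultimately have "small_middle f"
      by (intro small_middle_transfer[OF sm g_meas _ _ g0]) auto
    then show ?thesis
      using weakly_subexponential_iff[OF rf pd_f] regular_tail_almost_decreasing[OF rf] by blast
  qed
  have g1_if_f: "weakly_subexponential_density g1"
    if ani: "asymptotic_to_nonincreasing g" and ws: "weakly_subexponential_density f" and ad: "almost_decreasing f"
  proof -
    have rf: "regular_tail f"
      using ws ad by (intro regular_tailI) (auto simp: weakly_subexponential_density_def)
    have sf: "small_middle f" using ws weakly_subexponential_iff[OF rf pd_f] by blast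
    have lim: "((\<lambda>x. f x / g x) \<longlongrightarrow> 1) at_top"
      using P.density_asymp_if_density_subexponential[OF asymptotic_to_nonincreasingD(2,1)[OF ani] rf sf] by blast
    from tendsto_inverse[OF this] have "((\<lambda>x. g x / f x) \<longlongrightarrow> 1) at_top" by simp
    then have g: "regular_tail g" by (rule regular_tail_transfer[OF rf _ zero_less_one g_meas g0])
    then show ?thesis using g1_iff P.small_middle_if_density_asymp[OF g lim] by blast
  qed
  have ald: "almost_decreasing g" if "asymptotic_to_nonincreasing g"
    by (rule asymptotic_to_nonincreasingD(3)[OF that])
  show ?thesis
    unfolding c_def[symmetric]
  proof (intro conjI impI exI[of _ f] dens_f)
    assume ani: "asymptotic_to_nonincreasing g"
    show "(weakly_subexponential_density f \<and> almost_decreasing f) \<longleftrightarrow> weakly_subexponential_density g1"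
      using f_if_g1[OF ald[OF ani]] g1_if_f[OF ani] by blast
    show "weakly_subexponential_density g1 \<longleftrightarrow>
        (long_tailed_density g1 \<and> ((\<lambda>x. f x / g1 x) \<longlongrightarrow> c) at_top)"
      by (rule eqv[OF ald[OF ani]])
  next
    assume ad: "almost_decreasing g"
    show "weakly_subexponential_density g1 \<longleftrightarrow>
        (long_tailed_density g1 \<and> ((\<lambda>x. f x / g1 x) \<longlongrightarrow> c) at_top)"
      by (rule eqv[OF ad])
    show "weakly_subexponential_density f" "almost_decreasing f" if "weakly_subexponential_density g1"
      using f_if_g1[OF ad that] by auto
  qed
qed

end
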